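(* Let $\alpha_0,\alpha_1,\alpha_2,\beta_0,\beta_1,\beta_2>0$ with $\alpha_0\alpha_1\alpha_2=\beta_0\beta_1\beta_2=1$ and let $N\ge1$. Consider the $3\times2$-periodic Aztec diamond of size $6N$, i.e. the model $\mathbb P_n$ defined in the context. The kernel for the corresponding point process (heights shifted by $-3n$, $n\to\infty$) is $K$ given below; that is, for all distinct points $(12m_k,3\xi_k+r_k)$, $k=1,\dots,\ell$, with $0<m_k<N$, $\xi_k\in\mathbb Z$, $r_k\in\{0,1,2\}$, $$\lim_{n\to\infty}\mathbb P_n\big(\text{points at }(12m_k,3n+3\xi_k+r_k),\ k=1,\dots,\ell\big)=\det\Big(K(12m_k,3\xi_k+r_k;12m_l,3\xi_l+r_l)\Big)_{k,l=1}^\ell ,$$ where for $\xi,\xi'\in\mathbb Z$ and $0<m,m'<N$ (row index $i$, column index $j$) $$\left[K(12m,3\xi+j;12m',3\xi'+i)\right]_{i,j=0}^{2}=-\frac{\chi_{m>m'}}{2\pi\mathrm i}\oint_{\gamma_{int}}A(z)^{m-m'}B(z)^{m-m'}z^{\xi'-\xi}\frac{dz}{z}+\frac1{(2\pi\mathrm i)^2}\int_{\gamma_{int}}\int_{\gamma_{ext}}A(w)^{N-m'}B(w)^{-m'}A(z)^{m-N}B(z)^m\frac{w^{\xi'}}{z^{\xi+1}}\frac{dz\,dw}{z-w}$$ ($w\in\gamma_{int}$, $z\in\gamma_{ext}$ in the double integral). Here $$A(z)=N_d(z;\alpha_0,\alpha_1,\alpha_2)\,N_d(z;\beta_2c_0,\beta_0c_1,\beta_1c_2)\,N_d(z;\alpha_2c_0,\alpha_0c_1,\alpha_1c_2)\,N_d(z;\beta_1c_2c_0,\beta_2c_0c_1,\beta_0c_1c_2)\,N_d(z;\alpha_1c_2c_0,\alpha_2c_0c_1,\alpha_0c_1c_2)\,N_d(z;\beta_0,\beta_1,\beta_2),$$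 $$B(z)=M_d(z;\alpha_0,\alpha_1,\alpha_2)\,M_d(z;\beta_1c_2c_0,\beta_2c_0c_1,\beta_0c_1c_2)\,M_d(z;\alpha_1c_2c_0,\alpha_2c_0c_1,\alpha_0c_1c_2)\,M_d(z;\beta_2c_0,\beta_0c_1,\beta_1c_2)\,M_d(z;\alpha_2c_0,\alpha_0c_1,\alpha_1c_2)\,M_d(z;\beta_0,\beta_1,\beta_2),$$ $$c_0=\frac{\alpha_0+\beta_0}{\alpha_2+\beta_2},\qquad c_1=\frac{\alpha_1+\beta_1}{\alpha_0+\beta_0},\qquad c_2=\frac{\alpha_2+\beta_2}{\alpha_1+\beta_1},$$ $\gamma_{int}$ is a positively oriented simple closed contour around $0$ and $1$ with $-1$ in its exterior, and $\gamma_{ext}$ is a positively oriented simple closed contour around $\gamma_{int}$ with $-1$ in its exterior.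
   Context: For positive $a_0,a_1,a_2$ with $a=a_0a_1a_2$ put $$M_d(z;a_0,a_1,a_2)=\begin{pmatrix} 1 & 0 & a_2/z \\ a_0 & 1 & 0 \\ 0 & a_1 & 1 \end{pmatrix},\qquad N_d(z;a_0,a_1,a_2)=\frac{1}{1-a/z}\begin{pmatrix} 1 & a_1a_2/z & a_2/z \\ a_0 & 1 & a_0a_2/z \\ a_0a_1 & a_1 & 1 \end{pmatrix}.$$ The model. For $k=0,\dots,3N-1$ let $\phi_{4k+1}(z)=M_d(z;\alpha_0,\alpha_1,\alpha_2)$, $\phi_{4k+2}(z)=N_d(z;\alpha_0,\alpha_1,\alpha_2)$, $\phi_{4k+3}(z)=M_d(z;\beta_0,\beta_1,\beta_2)$, $\phi_{4k+4}(z)=N_d(z;\beta_0,\beta_1,\beta_2)$. Expand each $\phi_m$ in powers of $z^{-1}$ (convergent for $|z|>1$), $\phi_m(z)=\sum_k\hat\phi_m(k)z^k$, and let $T_{\phi_m}(3x+r,3y+s)=(\hat\phi_m(y-x))_{r+1,s+1}$, $r,s\in\{0,1,2\}$, $x,y\in\mathbb Z$, be the associated $3\times3$-block Toeplitz matrix. For $n\ge 2N$, $\mathbb P_n$ is the probability measure on point configurations $\{(m,u_m^j)\}_{1\le m\le 12N-1,\,1\le j\le3n}$ in $\{1,\dots,12N-1\}\times\mathbb Z$ proportional to $$\prod_{m=1}^{12N}\det\left(T_{\phi_m}(u_{m-1}^j,u_m^k)\right)_{j,k=1}^{3n},\qquad u_0^j=j-1,\quad u_{12N}^j=-6N+j-1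 .$$ This describes $3n$ non-intersecting paths, whose part at heights $3n-6N\le u\le3n-1$ encodes a random domino tiling of the $6N\times6N$ Aztec diamond with $3\times2$-periodic weights. $\chi_{m>m'}=1$ if $m>m'$ and $0$ otherwise. *)

theory Defs
  imports
    "HOL-Complex_Analysis.Complex_Analysis"
    "HOL-Probability.Probability"
    "Jordan_Normal_Form.Determinant"
begin

text \<open>
  Symbols are \<open>3 \<times> 3\<close> matrices of type \<open>complex^3^3\<close> (HOL-Analysis); determinants whose size
  depends on a natural number are taken in Jordan-Normal-Form. The index \<open>$\<close> is reserved for the
  former.
\<close>

no_notation vec_index (infixl \<open>$\<close> 100)

section \<open>Symbols of the model\<close>

definition M_d :: "complex \<Rightarrow> real \<Rightarrow> real \<Rightarrow> real \<Rightarrow> complex^3^3" where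
  "M_d z a0 a1 a2 =
     vector [vector [1, 0, of_real a2 / z],
             vector [of_real a0, 1, 0],
             vector [0, of_real a1, 1]]"

definition N_d :: "complex \<Rightarrow> real \<Rightarrow> real \<Rightarrow> real \<Rightarrow> complex^3^3" where
  "N_d z a0 a1 a2 =
     (\<chi> i j. 1 / (1 - of_real (a0 * a1 * a2) / z) *
       (vector [vector [1, of_real (a1 * a2) / z, of_real a2 / z],
                vector [of_real a0, 1, of_real (a0 * a2) / z],
                vector [of_real (a0 * a1), of_real a1, 1]] :: complex^3^3) $ i $ j)"

text \<open>
  The parameters \<open>\<alpha>\<^sub>0, \<alpha>\<^sub>1, \<alpha>\<^sub>2\<close> and \<open>\<beta>\<^sub>0, \<beta>\<^sub>1, \<beta>\<^sub>2\<close> are given as functions on \<open>nat\<close>, of which only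
  the values at \<open>0, 1, 2\<close> are used. The symbols are numbered \<open>m = 1, \<dots>, 12 N\<close>.
\<close>

definition phi :: "(nat \<Rightarrow> real) \<Rightarrow> (nat \<Rightarrow> real) \<Rightarrow> nat \<Rightarrow> complex \<Rightarrow> complex^3^3" where
  "phi \<alpha> \<beta> m z =
     (if m mod 4 = 1 then M_d z (\<alpha> 0) (\<alpha> 1) (\<alpha> 2)
      else if m mod 4 = 2 then N_d z (\<alpha> 0) (\<alpha> 1) (\<alpha> 2)
      else if m mod 4 = 3 then M_d z (\<beta> 0) (\<beta> 1) (\<beta> 2)
      else N_d z (\<beta> 0) (\<beta> 1) (\<beta> 2))"

text \<open>Coefficients of the expansion in powers of \<open>z\<^sup>-\<^sup>1\<close> on \<open>|z| > 1\<close>, which are unique if they exist.\<close>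

definition laurent_coeff :: "(complex \<Rightarrow> complex^3^3) \<Rightarrow> int \<Rightarrow> complex^3^3" where
  "laurent_coeff f = (THE c. (\<forall>k>0. c k = 0) \<and>
     (\<forall>z. norm z > 1 \<longrightarrow>
        (\<forall>i j. ((\<lambda>k. c k $ i $ j * z powi k) has_sum f z $ i $ j) UNIV)))"

text \<open>
  The position of the height \<open>u = 3 x + r\<close>, \<open>0 \<le> r < 3\<close>, in its block, as a row or column index
  \<open>r + 1\<close>; the index \<open>3\<close> equals \<open>0\<close> in the type \<open>3\<close>. Below, \<open>x = u div 3\<close>; \<open>div\<close> and \<open>mod\<close> on \<open>int\<close>
  round towards minus infinity.
\<close>

definition block_index :: "int \<Rightarrow> 3" where
  "block_index u = of_int (u mod 3 + 1)"

definition block_toeplitz :: "(complex \<Rightarrow> complex^3^3) \<Rightarrow> int \<Rightarrow> int \<Rightarrow> complex" where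
  "block_toeplitz f u v =
     laurent_coeff f (v div 3 - u div 3) $ block_index u $ block_index v"

section \<open>The probability measure\<close>

definition configs :: "nat \<Rightarrow> nat \<Rightarrow> (nat \<times> int) set set" where
  "configs N n = {C. finite C \<and> C \<subseteq> {1..12 * N - 1} \<times> UNIV \<and>
                     (\<forall>m\<in>{1..12 * N - 1}. card {u. (m, u) \<in> C} = 3 * n)}"

text \<open>
  \<open>path_pos N n C m j\<close> is the position \<open>u\<^sub>m\<^sup>j\<^sup>+\<^sup>1\<close> (\<open>j < 3 n\<close> counts from \<open>0\<close>). On each inner level the points
  are labelled increasingly; relabelling a level changes the sign of two consecutive factors
  of the weight, so the weight does not depend on the labelling.
\<close>

definition path_pos :: "nat \<Rightarrow> nat \<Rightarrow> (nat \<times> int) set \<Rightarrow> nat \<Rightarrow> nat \<Rightarrow> int" where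
  "path_pos N n C m j =
     (if m = 0 then int j
      else if m = 12 * N then - 6 * int N + int j
      else sorted_list_of_set {u. (m, u) \<in> C} ! j)"

definition config_weight ::
  "(nat \<Rightarrow> real) \<Rightarrow> (nat \<Rightarrow> real) \<Rightarrow> nat \<Rightarrow> nat \<Rightarrow> (nat \<times> int) set \<Rightarrow> complex" where
  "config_weight \<alpha> \<beta> N n C =
     (\<Prod>m=1..12 * N. Determinant.det (Matrix.mat (3 * n) (3 * n)
        (\<lambda>(j, k). block_toeplitz (phi \<alpha> \<beta> m) (path_pos N n C (m - 1) j) (path_pos N n C m k))))"

text \<open>
  The weights are real and nonnegative, so \<open>Re\<close> and \<open>ennreal\<close> only change the type; only finitely many
  of them are nonzero.
\<close>

definition path_measure ::
  "(nat \<Rightarrow> real) \<Rightarrow> (nat \<Rightarrow> real) \<Rightarrow> nat \<Rightarrow> nat \<Rightarrow> (nat \<times> int) set measure" where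
  "path_measure \<alpha> \<beta> N n =
     (let W = point_measure (configs N n) (\<lambda>C. ennreal (Re (config_weight \<alpha> \<beta> N n C)))
      in scale_measure (1 / emeasure W (space W)) W)"

section \<open>The limiting kernel\<close>

definition c_coeff :: "(nat \<Rightarrow> real) \<Rightarrow> (nat \<Rightarrow> real) \<Rightarrow> nat \<Rightarrow> real" where
  "c_coeff \<alpha> \<beta> i =
     (if i = 0 then (\<alpha> 0 + \<beta> 0) / (\<alpha> 2 + \<beta> 2)
      else if i = 1 then (\<alpha> 1 + \<beta> 1) / (\<alpha> 0 + \<beta> 0)
      else (\<alpha> 2 + \<beta> 2) / (\<alpha> 1 + \<beta> 1))"

definition A_mat :: "(nat \<Rightarrow> real) \<Rightarrow> (nat \<Rightarrow> real) \<Rightarrow> complex \<Rightarrow> complex^3^3" where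
  "A_mat \<alpha> \<beta> z =
     (let c0 = c_coeff \<alpha> \<beta> 0; c1 = c_coeff \<alpha> \<beta> 1; c2 = c_coeff \<alpha> \<beta> 2 in
      N_d z (\<alpha> 0) (\<alpha> 1) (\<alpha> 2) **
      N_d z (\<beta> 2 * c0) (\<beta> 0 * c1) (\<beta> 1 * c2) **
      N_d z (\<alpha> 2 * c0) (\<alpha> 0 * c1) (\<alpha> 1 * c2) **
      N_d z (\<beta> 1 * c2 * c0) (\<beta> 2 * c0 * c1) (\<beta> 0 * c1 * c2) **
      N_d z (\<alpha> 1 * c2 * c0) (\<alpha> 2 * c0 * c1) (\<alpha> 0 * c1 * c2) **
      N_d z (\<beta> 0) (\<beta> 1) (\<beta> 2))"

definition B_mat :: "(nat \<Rightarrow> real) \<Rightarrow> (nat \<Rightarrow> real) \<Rightarrow> complex \<Rightarrow> complex^3^3" where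
  "B_mat \<alpha> \<beta> z =
     (let c0 = c_coeff \<alpha> \<beta> 0; c1 = c_coeff \<alpha> \<beta> 1; c2 = c_coeff \<alpha> \<beta> 2 in
      M_d z (\<alpha> 0) (\<alpha> 1) (\<alpha> 2) **
      M_d z (\<beta> 1 * c2 * c0) (\<beta> 2 * c0 * c1) (\<beta> 0 * c1 * c2) **
      M_d z (\<alpha> 1 * c2 * c0) (\<alpha> 2 * c0 * c1) (\<alpha> 0 * c1 * c2) **
      M_d z (\<beta> 2 * c0) (\<beta> 0 * c1) (\<beta> 1 * c2) **
      M_d z (\<alpha> 2 * c0) (\<alpha> 0 * c1) (\<alpha> 1 * c2) **
      M_d z (\<beta> 0) (\<beta> 1) (\<beta> 2))"

definition matrix_powi :: "complex^3^3 \<Rightarrow> int \<Rightarrow> complex^3^3" where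
  "matrix_powi X k =
     (if k \<ge> 0 then (((**) X) ^^ nat k) (Finite_Cartesian_Product.mat 1)
      else (((**) (matrix_inv X)) ^^ nat (- k)) (Finite_Cartesian_Product.mat 1))"

definition pos_simple_closed_contour :: "(real \<Rightarrow> complex) \<Rightarrow> bool" where
  "pos_simple_closed_contour \<gamma> \<longleftrightarrow>
     valid_path \<gamma> \<and> simple_path \<gamma> \<and> pathfinish \<gamma> = pathstart \<gamma> \<and>
     (\<forall>z\<in>inside (path_image \<gamma>). winding_number \<gamma> z = 1)"

text \<open>
  \<open>K_block \<alpha> \<beta> N \<gamma>int \<gamma>ext m \<xi> m' \<xi>'\<close> is the matrix with entry \<open>K(12 m, 3 \<xi> + j; 12 m', 3 \<xi>' + i)\<close> in row
  \<open>i\<close> and column \<open>j\<close> (counted from \<open>0\<close>): the row belongs to the second point. Integrals are taken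
  entrywise, in \<open>w\<close> over \<open>\<gamma>int\<close> and in \<open>z\<close> over \<open>\<gamma>ext\<close>.
\<close>

definition K_block ::
  "(nat \<Rightarrow> real) \<Rightarrow> (nat \<Rightarrow> real) \<Rightarrow> nat \<Rightarrow> (real \<Rightarrow> complex) \<Rightarrow> (real \<Rightarrow> complex) \<Rightarrow>
   nat \<Rightarrow> int \<Rightarrow> nat \<Rightarrow> int \<Rightarrow> complex^3^3" where
  "K_block \<alpha> \<beta> N \<gamma>int \<gamma>ext m \<xi> m' \<xi>' =
     (\<chi> i j.
       - (if m > m' then 1 else 0) / (2 * of_real pi * \<i>) *
         contour_integral \<gamma>int (\<lambda>z.
           (matrix_powi (A_mat \<alpha> \<beta> z) (int m - int m') **
            matrix_powi (B_mat \<alpha> \<beta> z) (int m - int m')) $ i $ j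
           * z powi (\<xi>' - \<xi>) / z)
       + 1 / (2 * of_real pi * \<i>)\<^sup>2 *
         contour_integral \<gamma>int (\<lambda>w. contour_integral \<gamma>ext (\<lambda>z.
           (matrix_powi (A_mat \<alpha> \<beta> w) (int N - int m') **
            matrix_powi (B_mat \<alpha> \<beta> w) (- int m') **
            matrix_powi (A_mat \<alpha> \<beta> z) (int m - int N) **
            matrix_powi (B_mat \<alpha> \<beta> z) (int m)) $ i $ j
           * (w powi \<xi>' / z powi (\<xi> + 1)) / (z - w))))"

text \<open>The kernel at points whose levels are multiples of \<open>12\<close>.\<close>

definition K_limit ::
  "(nat \<Rightarrow> real) \<Rightarrow> (nat \<Rightarrow> real) \<Rightarrow> nat \<Rightarrow> (real \<Rightarrow> complex) \<Rightarrow> (real \<Rightarrow> complex) \<Rightarrow>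
   nat \<times> int \<Rightarrow> nat \<times> int \<Rightarrow> complex" where
  "K_limit \<alpha> \<beta> N \<gamma>int \<gamma>ext = (\<lambda>(t, u) (t', u').
     K_block \<alpha> \<beta> N \<gamma>int \<gamma>ext (t div 12) (u div 3) (t' div 12) (u' div 3)
       $ block_index u' $ block_index u)"

end

(* The symbols are lower triangular in the height, so all paths live in the finite window between -6N
   and 3n - 1, and the Eynard-Mehta theorem gives a determinantal formula for every n in terms of the
   inverse of the 3n x 3n Toeplitz minor G of Phi^N, where Phi = A B = B A is the product of twelve
   consecutive symbols. The rows of the matrix that is needed, b G^-1, can be written down:
   T(A^(N-m') B^(-m')) T(A^-N), with coefficients taken along the contour and sums cut off at the top
   height 3n - 1. It solves x G = b on the half line since A^-N is a Laurent polynomial in 1/z and B^N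
   is banded, and it vanishes at negative heights since Phi^-m' is regular inside the contour, the
   pole at 0 included. Hence the kernel at the shifted heights does not depend on n at all once n is
   large, and evaluating the z-integral by residues identifies it with the double integral. *)

theory Submission
  imports Defs
begin

section \<open>Minors and the Cauchy--Binet formula\<close>

text \<open>The constants c_i come from exchanging two bidiagonal factors. With M(a) = 1 + L_a, the
  identity M(-b') M(a) = M(a') M(-b) has a quadratic part, which asks for a'_i / a_(i-1) = b'_i /
  b_(i-1) = c_i, and a linear part, which then asks for a_i + b_i = c_i (a_(i-1) + b_(i-1)), indices
  mod 3. Since c_0 c_1 c_2 = 1, three exchanges return to the start; this matches the three periods
  of four symbols between consecutive levels divisible by 12. The obstacle is that the inverse of an
  M factor has its pole at -1, outside the contour. Hence the Toeplitz matrix of B^(-m') is not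
  triangular although all original symbols are, and truncated Toeplitz matrices do not multiply like
  their symbols. No infinite product is ever formed: every product is taken with a banded matrix, or
  is made finite by triangularity together with the cut at the top height.\<close>

lemma permutes_image_lessThan:
  assumes "p permutes {0..<k::nat}" "i < k"
  shows "p i < k"
  using permutes_in_image[OF assms(1), of i] assms(2) by simp

lemma det_mat_eq:
  "Determinant.det (Matrix.mat k k f) =
     (\<Sum>p\<in>{p. p permutes {0..<k}}. signof p * (\<Prod>i=0..<k. f (i, p i)))"
  by (subst det_def'[of _ k], simp, intro sum.cong refl arg_cong2[where f="(*)"] prod.cong)
     (auto simp: permutes_image_lessThan)

lemma det_mat_cong:
  assumes "\<And>i j. i < k \<Longrightarrow> j < k \<Longrightarrow> f (i, j) = g (i, j)"
  shows "Determinant.det (Matrix.mat k k f) = Determinant.det (Matrix.mat k k g)"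
  by (rule arg_cong[where f=Determinant.det], rule eq_matI) (auto simp: assms)

lemma det_mat_scale_rows:
  "Determinant.det (Matrix.mat k k (\<lambda>(i, j). c i * f i j)) =
     (\<Prod>i=0..<k. c i) * Determinant.det (Matrix.mat k k (\<lambda>(i, j). f i j))"
  for c :: "nat \<Rightarrow> 'a :: comm_ring_1"
  unfolding det_mat_eq
  by (simp add: prod.distrib sum_distrib_left mult.assoc mult.left_commute)

lemma det_mat_scale_cols:
  "Determinant.det (Matrix.mat k k (\<lambda>(i, j). f i j * c j)) =
     (\<Prod>i=0..<k. c i) * Determinant.det (Matrix.mat k k (\<lambda>(i, j). f i j))"
  for c :: "nat \<Rightarrow> 'a :: comm_ring_1"
proof -
  have "(\<Prod>i=0..<k. c (p i)) = (\<Prod>i=0..<k. c i)" if "p permutes {0..<k}" for p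
    using prod.permute[OF that, of c] by (simp add: o_def)
  then show ?thesis
    unfolding det_mat_eq by (simp add: prod.distrib sum_distrib_left mult_ac)
qed

lemma det_mat_nonzero_obtains_permutation:
  assumes "Determinant.det (Matrix.mat k k f) \<noteq> (0 :: 'a :: idom)"
  obtains p where "p permutes {0..<k}" "\<And>i. i < k \<Longrightarrow> f (i, p i) \<noteq> 0"
proof -
  obtain p where "p permutes {0..<k}" "signof p * (\<Prod>i=0..<k. f (i, p i)) \<noteq> 0"
    using assms unfolding det_mat_eq by (metis (mono_tags, lifting) mem_Collect_eq sum.neutral)
  then show ?thesis using that by (auto simp: prod_zero_iff)
qed

abbreviation nth_elem :: "'a::linorder set \<Rightarrow> nat \<Rightarrow> 'a" where
  "nth_elem S i \<equiv> sorted_list_of_set S ! i"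

lemma bij_betw_nth_elem:
  assumes "finite S" "card S = k"
  shows "bij_betw (nth_elem S) {0..<k} S"
  using assms by (intro bij_betw_nth) (auto simp: atLeast0LessThan)

lemma nth_elem_strict_mono:
  assumes "finite S" "i < j" "j < card S"
  shows "nth_elem S i < nth_elem S j"
  using assms by (metis sorted_wrt_nth_less strict_sorted_list_of_set length_sorted_list_of_set)

lemma prod_nth_elem:
  assumes "finite S" "card S = k"
  shows "(\<Prod>i=0..<k. f (nth_elem S i)) = (\<Prod>x\<in>S. f x)"
  using prod.reindex_bij_betw[OF bij_betw_nth_elem[OF assms], of f] .

text \<open>Multilinearity in the rows: a product of k sums over W is a sum over all choice
  functions f, and b then enters only through the rows picked by f.\<close>

lemma det_mat_function_rows:
  fixes a :: "nat \<Rightarrow> 'x \<Rightarrow> 'a :: comm_ring_1"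
  assumes "finite W"
  shows "Determinant.det (Matrix.mat k k (\<lambda>(i, j). \<Sum>x\<in>W. a i x * b x j)) =
    (\<Sum>f\<in>{0..<k} \<rightarrow>\<^sub>E W. (\<Prod>i=0..<k. a i (f i)) * Determinant.det (Matrix.mat k k (\<lambda>(i, j). b (f i) j)))"
proof -
  have "Determinant.det (Matrix.mat k k (\<lambda>(i, j). \<Sum>x\<in>W. a i x * b x j)) =
     (\<Sum>p\<in>{p. p permutes {0..<k}}. \<Sum>f\<in>{0..<k} \<rightarrow>\<^sub>E W.
        signof p * (\<Prod>i=0..<k. a i (f i) * b (f i) (p i)))"
    unfolding det_mat_eq by (simp add: prod_sum_PiE assms sum_distrib_left)
  also have "\<dots> = (\<Sum>f\<in>{0..<k} \<rightarrow>\<^sub>E W. \<Sum>p\<in>{p. p permutes {0..<k}}.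
        signof p * (\<Prod>i=0..<k. a i (f i) * b (f i) (p i)))"
    by (rule sum.swap)
  finally show ?thesis
    unfolding det_mat_eq
    by (simp add: prod.distrib sum_distrib_left mult.assoc mult.left_commute)
qed

lemma det_mat_identical_rows:
  assumes "i < k" "i' < k" "i \<noteq> i'" "\<And>j. j < k \<Longrightarrow> f (i, j) = f (i', j)"
  shows "Determinant.det (Matrix.mat k k f) = 0"
  by (rule det_identical_rows[of _ k i i']) (use assms in \<open>auto intro!: eq_vecI\<close>)

lemma det_mat_permute_rows:
  assumes "p permutes {0..<k}"
  shows "Determinant.det (Matrix.mat k k (\<lambda>(i, j). g (p i) j)) =
    signof p * Determinant.det (Matrix.mat k k (\<lambda>(i, j). g i j))"
proof -
  have "Determinant.det (Matrix.mat k k (\<lambda>(i, j). g (p i) j)) =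
    Determinant.det (Matrix.mat k k (\<lambda>(i, j). Matrix.mat k k (\<lambda>(i, j). g i j) $$ (p i, j)))"
    by (rule det_mat_cong) (use assms in \<open>auto simp: permutes_image_lessThan\<close>)
  also have "\<dots> = signof p * Determinant.det (Matrix.mat k k (\<lambda>(i, j). g i j))"
    by (rule det_permute_rows) (use assms in auto)
  finally show ?thesis .
qed

text \<open>Every enumeration of S differs from the increasing one by a permutation; this turns a
  sum over injective choice functions with image S into a Leibniz sum.\<close>

lemma bij_betw_permutations_enumerations:
  fixes S :: "'x :: linorder set"
  assumes S: "finite S" "card S = k"
  shows "bij_betw (\<lambda>p. restrict (\<lambda>i. nth_elem S (p i)) {0..<k}) {p. p permutes {0..<k}}
     {f \<in> {0..<k} \<rightarrow>\<^sub>E S. inj_on f {0..<k}}"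
proof -
  note bij = bij_betw_nth_elem[OF S]
  define e where "e = nth_elem S"
  define d where "d = inv_into {0..<k} e"
  have bije: "bij_betw e {0..<k} S" using bij unfolding e_def .
  have ed: "e (d s) = s" "d s \<in> {0..<k}" if "s \<in> S" for s
    using bije that unfolding d_def by (auto simp: bij_betw_def f_inv_into_f inv_into_into)
  have de: "d (e i) = i" if "i < k" for i
    using bije that unfolding d_def by (auto simp: bij_betw_def)
  have eS: "e i \<in> S" if "i < k" for i using bije that by (auto simp: bij_betw_def)
  show ?thesis unfolding e_def[symmetric]
  \<comment> \<open>The inverse map ranks the values of f in S and is the identity off
    \<open>{0..<k}\<close>, as \<open>permutes\<close> demands.\<close>
  proof (rule bij_betw_byWitness[where f'="\<lambda>f i. if i < k then d (f i) else i"])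
    show "\<forall>p\<in>{p. p permutes {0..<k}}.
       (\<lambda>i. if i < k then d (restrict (\<lambda>i. e (p i)) {0..<k} i) else i) = p"
      by (auto simp: fun_eq_iff de permutes_image_lessThan permutes_not_in)
    show "\<forall>f\<in>{f \<in> {0..<k} \<rightarrow>\<^sub>E S. inj_on f {0..<k}}.
       restrict (\<lambda>i. e (if i < k then d (f i) else i)) {0..<k} = f"
      by (auto simp: fun_eq_iff PiE_def Pi_def ed extensional_def)
    show "(\<lambda>p. restrict (\<lambda>i. e (p i)) {0..<k}) ` {p. p permutes {0..<k}}
       \<subseteq> {f \<in> {0..<k} \<rightarrow>\<^sub>E S. inj_on f {0..<k}}"
    proof (rule image_subsetI)
      fix p assume "p \<in> {p. p permutes {0..<k}}"
      then have p: "p permutes {0..<k}" by simp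
      have "inj_on (\<lambda>i. e (p i)) {0..<k}"
        by (rule inj_on_inverseI[where g="\<lambda>x. inv_into UNIV p (d x)"])
           (use p in \<open>auto simp: de permutes_image_lessThan permutes_inverses\<close>)
      then show "restrict (\<lambda>i. e (p i)) {0..<k} \<in> {f \<in> {0..<k} \<rightarrow>\<^sub>E S. inj_on f {0..<k}}"
        using p by (auto simp: eS permutes_image_lessThan inj_on_def)
    qed
    show "(\<lambda>f i. if i < k then d (f i) else i) ` {f \<in> {0..<k} \<rightarrow>\<^sub>E S. inj_on f {0..<k}}
       \<subseteq> {p. p permutes {0..<k}}"
    proof (rule image_subsetI)
      fix f assume f: "f \<in> {f \<in> {0..<k} \<rightarrow>\<^sub>E S. inj_on f {0..<k}}"
      have fS: "f i \<in> S" if "i < k" for i using f that by auto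
      have inj: "inj_on (\<lambda>i. if i < k then d (f i) else i) {0..<k}"
      proof (rule inj_onI)
        fix x y assume xy: "x \<in> {0..<k}" "y \<in> {0..<k}"
          "(if x < k then d (f x) else x) = (if y < k then d (f y) else y)"
        then have lt: "x < k" "y < k" by auto
        have "f x = e (d (f x))" by (rule ed(1)[OF fS[OF lt(1)], symmetric])
        also have "d (f x) = d (f y)" using xy(3) lt by simp
        also have "e (d (f y)) = f y" by (rule ed(1)[OF fS[OF lt(2)]])
        finally have fxy: "f x = f y" .
        have "inj_on f {0..<k}" using f by simp
        then show "x = y" using fxy xy(1,2) by (rule inj_onD)
      qed
      have sub: "(\<lambda>i. if i < k then d (f i) else i) ` {0..<k} \<subseteq> {0..<k}"
        using fS ed(2) by auto
      have "bij_betw (\<lambda>i. if i < k then d (f i) else i) {0..<k} {0..<k}"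
        unfolding bij_betw_def by (rule conjI[OF inj endo_inj_surj[OF finite_atLeastLessThan sub inj]])
      then have "(\<lambda>i. if i < k then d (f i) else i) permutes {0..<k}"
        by (rule bij_imp_permutes) simp
      then show "(\<lambda>i. if i < k then d (f i) else i) \<in> {p. p permutes {0..<k}}" by simp
    qed
  qed
qed

text \<open>Choice functions that repeat a value give two equal rows and drop out. The others are
  grouped by their image S; within a group the b-determinant changes only by the sign of the
  permutation, and these signs build the a-determinant.\<close>

theorem Cauchy_Binet:
  fixes a :: "nat \<Rightarrow> 'x :: linorder \<Rightarrow> 'a :: comm_ring_1"
  assumes W: "finite W"
  shows "Determinant.det (Matrix.mat k k (\<lambda>(i, j). \<Sum>x\<in>W. a i x * b x j)) =
    (\<Sum>S | S \<subseteq> W \<and> card S = k.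
       Determinant.det (Matrix.mat k k (\<lambda>(i, j). a i (nth_elem S j))) *
       Determinant.det (Matrix.mat k k (\<lambda>(i, j). b (nth_elem S i) j)))"
proof -
  let ?I = "{0..<k}"
  define h where "h f = (\<Prod>i=0..<k. a i (f i)) *
     Determinant.det (Matrix.mat k k (\<lambda>(i, j). b (f i) j))" for f
  define F where "F = {f \<in> ?I \<rightarrow>\<^sub>E W. inj_on f ?I}"
  define T where "T = {S. S \<subseteq> W \<and> card S = k}"
  have finF: "finite F" unfolding F_def using finite_PiE[of ?I "\<lambda>_. W"] W by auto
  have finT: "finite T" unfolding T_def using W by auto
  have "Determinant.det (Matrix.mat k k (\<lambda>(i, j). \<Sum>x\<in>W. a i x * b x j)) = (\<Sum>f\<in>?I \<rightarrow>\<^sub>E W. h f)"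
    unfolding h_def by (rule det_mat_function_rows[OF W])
  also have "\<dots> = (\<Sum>f\<in>F. h f)"
  proof (rule sum.mono_neutral_right)
    show "finite (?I \<rightarrow>\<^sub>E W)" using W by (auto intro: finite_PiE)
    show "F \<subseteq> ?I \<rightarrow>\<^sub>E W" by (auto simp: F_def)
    show "\<forall>f\<in>(?I \<rightarrow>\<^sub>E W) - F. h f = 0"
    proof
      fix f assume "f \<in> (?I \<rightarrow>\<^sub>E W) - F"
      then obtain i i' where "i < k" "i' < k" "i \<noteq> i'" "f i = f i'"
        by (auto simp: F_def inj_on_def)
      then show "h f = 0" unfolding h_def
        by (simp add: det_mat_identical_rows[of i k i'])
    qed
  qed
  also have "\<dots> = (\<Sum>S\<in>T. sum h {f \<in> F. f ` ?I = S})"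
    by (rule sum.group[symmetric, OF finF finT])
       (auto simp: F_def T_def card_image)
  also have "\<dots> = (\<Sum>S\<in>T. Determinant.det (Matrix.mat k k (\<lambda>(i, j). a i (nth_elem S j))) *
       Determinant.det (Matrix.mat k k (\<lambda>(i, j). b (nth_elem S i) j)))"
  proof (rule sum.cong[OF refl])
    fix S assume "S \<in> T"
    then have S: "S \<subseteq> W" "card S = k" "finite S" using W by (auto simp: T_def finite_subset)
    have "{f \<in> F. f ` ?I = S} = {f \<in> ?I \<rightarrow>\<^sub>E S. inj_on f ?I}"
    proof (intro equalityI subsetI)
      fix f assume f: "f \<in> {f \<in> ?I \<rightarrow>\<^sub>E S. inj_on f ?I}"
      have "f ` ?I = S"
        by (rule card_subset_eq) (use f S in \<open>auto simp: card_image\<close>)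
      then show "f \<in> {f \<in> F. f ` ?I = S}" using f S unfolding F_def by auto
    next
      fix f assume "f \<in> {f \<in> F. f ` ?I = S}"
      then show "f \<in> {f \<in> ?I \<rightarrow>\<^sub>E S. inj_on f ?I}" unfolding F_def by auto
    qed
    then have "sum h {f \<in> F. f ` ?I = S} =
        (\<Sum>p\<in>{p. p permutes ?I}. h (restrict (\<lambda>i. nth_elem S (p i)) ?I))"
      using sum.reindex_bij_betw[OF bij_betw_permutations_enumerations[OF S(3,2)], of h] by simp
    also have "\<dots> = (\<Sum>p\<in>{p. p permutes ?I}. (\<Prod>i=0..<k. a i (nth_elem S (p i))) *
        (signof p * Determinant.det (Matrix.mat k k (\<lambda>(i, j). b (nth_elem S i) j))))"
    proof (rule sum.cong[OF refl])
      fix p assume "p \<in> {p. p permutes ?I}"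
      then have p: "p permutes ?I" by simp
      have "Determinant.det (Matrix.mat k k (\<lambda>(i, j). b (restrict (\<lambda>i. nth_elem S (p i)) ?I i) j)) =
         Determinant.det (Matrix.mat k k (\<lambda>(i, j). b (nth_elem S (p i)) j))"
        by (rule det_mat_cong) auto
      also have "\<dots> = signof p * Determinant.det (Matrix.mat k k (\<lambda>(i, j). b (nth_elem S i) j))"
        by (rule det_mat_permute_rows[OF p, of "\<lambda>i. b (nth_elem S i)"])
      finally show "h (restrict (\<lambda>i. nth_elem S (p i)) ?I) = (\<Prod>i=0..<k. a i (nth_elem S (p i))) *
        (signof p * Determinant.det (Matrix.mat k k (\<lambda>(i, j). b (nth_elem S i) j)))"
        unfolding h_def by simp
    qed
    also have "\<dots> = Determinant.det (Matrix.mat k k (\<lambda>(i, j). a i (nth_elem S j))) *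
       Determinant.det (Matrix.mat k k (\<lambda>(i, j). b (nth_elem S i) j))"
      unfolding det_mat_eq[of k "\<lambda>(i, j). a i (nth_elem S j)"]
      by (simp add: sum_distrib_right mult.assoc mult.left_commute)
    finally show "sum h {f \<in> F. f ` ?I = S} = \<dots>" .
  qed
  finally show ?thesis unfolding T_def .
qed

section \<open>The Eynard--Mehta theorem\<close>

text \<open>Entry (x, u) of D_0 R_1 D_1 R_2 ... D_(m-1) R_m with diagonal D_j, the weighted count of
  single paths through W. The D_j carry marks on points; D = 1 gives plain transition
  products.\<close>

primrec chain :: "'x set \<Rightarrow> (nat \<Rightarrow> 'x \<Rightarrow> 'x \<Rightarrow> 'a::comm_ring_1) \<Rightarrow> (nat \<Rightarrow> 'x \<Rightarrow> 'a) \<Rightarrow>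
   'x \<Rightarrow> nat \<Rightarrow> 'x \<Rightarrow> 'a" where
  "chain W R D x 0 u = (if u = x then 1 else 0)"
| "chain W R D x (Suc m) u = (\<Sum>w\<in>W. chain W R D x m w * D m w * R (Suc m) w u)"

definition level_pos :: "(nat \<Rightarrow> 'x::linorder) \<Rightarrow> (nat \<Rightarrow> 'x set) \<Rightarrow> nat \<Rightarrow> nat \<Rightarrow> 'x" where
  "level_pos x s m i = (if m = 0 then x i else nth_elem (s m) i)"

text \<open>Levels 0 and q are pinned to x and y and only levels 1, ..., q - 1 vary, hence the
  separate last factor.\<close>

definition chain_weight :: "nat \<Rightarrow> (nat \<Rightarrow> 'x::linorder \<Rightarrow> 'x \<Rightarrow> 'a::comm_ring_1) \<Rightarrow> (nat \<Rightarrow> 'x) \<Rightarrow>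
   (nat \<Rightarrow> 'x) \<Rightarrow> nat \<Rightarrow> (nat \<Rightarrow> 'x set) \<Rightarrow> 'a" where
  "chain_weight k R x y q s =
     (\<Prod>m=1..<q. Determinant.det (Matrix.mat k k
        (\<lambda>(i, j). R m (level_pos x s (m - 1) i) (nth_elem (s m) j)))) *
     Determinant.det (Matrix.mat k k (\<lambda>(i, j). R q (level_pos x s (q - 1) i) (y j)))"

lemma sum_PiE_insert:
  assumes "finite A" "a \<notin> A"
  shows "(\<Sum>s\<in>insert a A \<rightarrow>\<^sub>E T. f s) = (\<Sum>S\<in>T. \<Sum>s\<in>A \<rightarrow>\<^sub>E T. f (s(a := S)))"
proof -
  have "(\<Sum>s\<in>insert a A \<rightarrow>\<^sub>E T. f s) = (\<Sum>(S, s)\<in>T \<times> (A \<rightarrow>\<^sub>E T). f (s(a := S)))"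
    unfolding PiE_insert_eq using assms
    by (subst sum.reindex[OF inj_combinator[OF assms(2)]]) (simp add: case_prod_unfold)
  then show ?thesis by (simp add: sum.cartesian_product)
qed

text \<open>The top level is summed out by Cauchy-Binet, one level at a time. The end points stay
  arbitrary in the induction because the hypothesis is applied with the increasing enumeration of
  the set at level q as end points.\<close>

lemma sum_chain_weight:
  fixes R :: "nat \<Rightarrow> 'x::linorder \<Rightarrow> 'x \<Rightarrow> 'a::comm_ring_1"
  assumes W: "finite W" and x: "\<And>i. i < k \<Longrightarrow> x i \<in> W" and D0: "\<And>u. D 0 u = 1" and q: "1 \<le> q"
  shows "(\<Sum>s\<in>{1..<q} \<rightarrow>\<^sub>E {S. S \<subseteq> W \<and> card S = k}.
            chain_weight k R x y q s * (\<Prod>m=1..<q. \<Prod>u\<in>s m. D m u)) =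
         Determinant.det (Matrix.mat k k (\<lambda>(i, j). chain W R D (x i) q (y j)))"
  using q
proof (induction q arbitrary: y rule: nat_induct_at_least)
  case base
  have "(\<Sum>w\<in>W. (if w = x i then 1 else 0) * D 0 w * R (Suc 0) w (y j)) = R (Suc 0) (x i) (y j)"
    if "i < k" for i j
    using x[OF that] W by (simp add: D0 if_distrib[of "\<lambda>c. c * _"] cong: if_cong)
  then show ?case
    by (auto simp: chain_weight_def level_pos_def intro!: det_mat_cong)
next
  case (Suc q)
  define T where "T = {S. S \<subseteq> W \<and> card S = k}"
  have ins: "{1..<Suc q} = insert q {1..<q}" using Suc by auto
  \<comment> \<open>With level q fixed to S the weight splits into a chain ending at S and the last
    transition, whose rows absorb the factors \<open>D q\<close>.\<close>
  have step: "chain_weight k R x y (Suc q) (s(q := S)) * (\<Prod>m=1..<Suc q. \<Prod>u\<in>(s(q := S)) m. D m u) =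
      chain_weight k R x (nth_elem S) q s * (\<Prod>m=1..<q. \<Prod>u\<in>s m. D m u) *
      ((\<Prod>u\<in>S. D q u) * Determinant.det (Matrix.mat k k (\<lambda>(i, j). R (Suc q) (nth_elem S i) (y j))))"
    for s S
  proof -
    have 1: "(\<Prod>m=1..<q. Determinant.det (Matrix.mat k k
          (\<lambda>(i, j). R m (level_pos x (s(q := S)) (m - 1) i) (nth_elem ((s(q := S)) m) j)))) =
        (\<Prod>m=1..<q. Determinant.det (Matrix.mat k k
          (\<lambda>(i, j). R m (level_pos x s (m - 1) i) (nth_elem (s m) j))))"
      by (intro prod.cong refl det_mat_cong) (auto simp: level_pos_def)
    have 2: "(\<Prod>m=1..<q. \<Prod>u\<in>(s(q := S)) m. D m u) = (\<Prod>m=1..<q. \<Prod>u\<in>s m. D m u)"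
      by (intro prod.cong) auto
    have 3: "level_pos x (s(q := S)) (q - 1) i = level_pos x s (q - 1) i" for i
      using Suc by (auto simp: level_pos_def)
    have 4: "level_pos x (s(q := S)) q i = nth_elem S i" for i
      using Suc by (auto simp: level_pos_def)
    show ?thesis
      unfolding chain_weight_def ins
      by (simp add: 1[simplified] 2[simplified] 3[simplified] 4 mult_ac)
  qed
  have "(\<Sum>s\<in>{1..<Suc q} \<rightarrow>\<^sub>E T. chain_weight k R x y (Suc q) s * (\<Prod>m=1..<Suc q. \<Prod>u\<in>s m. D m u)) =
     (\<Sum>S\<in>T. (\<Sum>s\<in>{1..<q} \<rightarrow>\<^sub>E T. chain_weight k R x (nth_elem S) q s * (\<Prod>m=1..<q. \<Prod>u\<in>s m. D m u)) *
       ((\<Prod>u\<in>S. D q u) * Determinant.det (Matrix.mat k k (\<lambda>(i, j). R (Suc q) (nth_elem S i) (y j)))))"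
    unfolding ins
    by (subst sum_PiE_insert[where a=q and A="{1..<q}" and T=T], simp, simp)
       (simp only: sum_distrib_right step[unfolded ins])
  also have "\<dots> = (\<Sum>S\<in>T. Determinant.det (Matrix.mat k k (\<lambda>(i, j). chain W R D (x i) q (nth_elem S j))) *
      Determinant.det (Matrix.mat k k (\<lambda>(i, j). D q (nth_elem S i) * R (Suc q) (nth_elem S i) (y j))))"
  proof (rule sum.cong[OF refl])
    fix S assume "S \<in> T"
    then have S: "finite S" "card S = k" using W by (auto simp: T_def finite_subset)
    show "(\<Sum>s\<in>{1..<q} \<rightarrow>\<^sub>E T. chain_weight k R x (nth_elem S) q s * (\<Prod>m=1..<q. \<Prod>u\<in>s m. D m u)) *
       ((\<Prod>u\<in>S. D q u) * Determinant.det (Matrix.mat k k (\<lambda>(i, j). R (Suc q) (nth_elem S i) (y j)))) =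
       Determinant.det (Matrix.mat k k (\<lambda>(i, j). chain W R D (x i) q (nth_elem S j))) *
      Determinant.det (Matrix.mat k k (\<lambda>(i, j). D q (nth_elem S i) * R (Suc q) (nth_elem S i) (y j)))"
      unfolding Suc.IH[folded T_def]
      by (subst det_mat_scale_rows[where c="\<lambda>i. D q (nth_elem S i)" and f="\<lambda>i j. R (Suc q) (nth_elem S i) (y j)"])
         (simp add: prod_nth_elem[OF S])
  qed
  also have "\<dots> = Determinant.det (Matrix.mat k k (\<lambda>(i, j). chain W R D (x i) (Suc q) (y j)))"
    using Cauchy_Binet[OF W, of k "\<lambda>i u. chain W R D (x i) q u" "\<lambda>u j. D q u * R (Suc q) u (y j)"]
    by (simp add: T_def mult.assoc)
  finally show ?case unfolding T_def .
qed

text \<open>The sum over all chains is split according to the last marked point that carries a factor \<open>t\<close>.\<close>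

lemma chain_last_marked_point:
  fixes R :: "nat \<Rightarrow> 'x \<Rightarrow> 'x \<Rightarrow> 'a::comm_ring_1" and \<mu> :: "nat \<Rightarrow> nat"
  assumes W: "finite W" and inj: "inj_on (\<lambda>l. (\<mu> l, \<upsilon> l)) {..<L}"
    and inW: "\<And>l. l < L \<Longrightarrow> \<upsilon> l \<in> W"
    and D: "\<And>m u. D m u = 1 + (if \<exists>l<L. (m, u) = (\<mu> l, \<upsilon> l) then t else 0)"
  shows "chain W R D x m u = chain W R (\<lambda>_ _. 1) x m u +
    t * (\<Sum>l<L. if \<mu> l < m then chain W R D x (\<mu> l) (\<upsilon> l) *
        chain W (\<lambda>j. R (\<mu> l + j)) (\<lambda>_ _. 1) (\<upsilon> l) (m - \<mu> l) u else 0)"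
proof (induction m arbitrary: u)
  case 0
  show ?case by simp
next
  case (Suc m)
  let ?V = "chain W R D x" and ?c = "\<lambda>l. chain W (\<lambda>j. R (\<mu> l + j)) (\<lambda>_ _. 1) (\<upsilon> l)"
  \<comment> \<open>Here the last mark sits on level m itself. Injectivity of the marks turns the
    sum over points into a sum over their indices.\<close>
  have mark: "(\<Sum>w\<in>W. ?V m w * (if \<exists>l<L. (m, w) = (\<mu> l, \<upsilon> l) then t else 0) * R (Suc m) w u) =
      t * (\<Sum>l<L. if \<mu> l = m then ?V m (\<upsilon> l) * R (Suc m) (\<upsilon> l) u else 0)"
  proof -
    define A where "A = {l\<in>{..<L}. \<mu> l = m}"
    have injA: "inj_on \<upsilon> A" using inj by (auto simp: A_def inj_on_def)
    have "(\<Sum>w\<in>W. ?V m w * (if \<exists>l<L. (m, w) = (\<mu> l, \<upsilon> l) then t else 0) * R (Suc m) w u) =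
      (\<Sum>w\<in>\<upsilon> ` A. ?V m w * t * R (Suc m) w u)"
      using W inW by (intro sum.mono_neutral_cong_right) (auto simp: A_def)
    also have "\<dots> = (\<Sum>l\<in>A. ?V m (\<upsilon> l) * t * R (Suc m) (\<upsilon> l) u)"
      by (simp add: sum.reindex[OF injA])
    also have "\<dots> = t * (\<Sum>l<L. if \<mu> l = m then ?V m (\<upsilon> l) * R (Suc m) (\<upsilon> l) u else 0)"
      unfolding A_def sum_distrib_left
      by (subst sum.inter_filter) (auto intro!: sum.cong simp: mult_ac)
    finally show ?thesis .
  qed
  have one: "(\<Sum>w\<in>W. (if w = \<upsilon> l then 1 else 0) * R (Suc m) w u) = R (Suc m) (\<upsilon> l) u" if "l < L" for l
    using inW[OF that] W by (simp add: if_distrib[of "\<lambda>c. c * _"] cong: if_cong)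
  have "?V (Suc m) u = (\<Sum>w\<in>W. ?V m w * R (Suc m) w u) +
      (\<Sum>w\<in>W. ?V m w * (if \<exists>l<L. (m, w) = (\<mu> l, \<upsilon> l) then t else 0) * R (Suc m) w u)"
    by (simp add: D distrib_left distrib_right sum.distrib del: prod.inject)
  also have "(\<Sum>w\<in>W. ?V m w * R (Suc m) w u) = chain W R (\<lambda>_ _. 1) x (Suc m) u +
      t * (\<Sum>l<L. if \<mu> l < m then ?V (\<mu> l) (\<upsilon> l) * ?c l (Suc m - \<mu> l) u else 0)"
  proof -
    have "(\<Sum>w\<in>W. ?V m w * R (Suc m) w u) = chain W R (\<lambda>_ _. 1) x (Suc m) u +
      (\<Sum>w\<in>W. \<Sum>l<L. t * (if \<mu> l < m then ?V (\<mu> l) (\<upsilon> l) * ?c l (m - \<mu> l) w else 0) * R (Suc m) w u)"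
      by (subst Suc.IH) (simp add: distrib_right sum.distrib sum_distrib_left sum_distrib_right)
    also have "(\<Sum>w\<in>W. \<Sum>l<L. t * (if \<mu> l < m then ?V (\<mu> l) (\<upsilon> l) * ?c l (m - \<mu> l) w else 0) * R (Suc m) w u)
       = (\<Sum>l<L. \<Sum>w\<in>W. t * (if \<mu> l < m then ?V (\<mu> l) (\<upsilon> l) * ?c l (m - \<mu> l) w else 0) * R (Suc m) w u)"
      by (rule sum.swap)
    also have "\<dots> = t * (\<Sum>l<L. if \<mu> l < m then ?V (\<mu> l) (\<upsilon> l) * ?c l (Suc m - \<mu> l) u else 0)"
      unfolding sum_distrib_left
    proof (rule sum.cong[OF refl])
      fix l assume "l \<in> {..<L}"
      show "(\<Sum>w\<in>W. t * (if \<mu> l < m then ?V (\<mu> l) (\<upsilon> l) * ?c l (m - \<mu> l) w else 0) * R (Suc m) w u) =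
        t * (if \<mu> l < m then ?V (\<mu> l) (\<upsilon> l) * ?c l (Suc m - \<mu> l) u else 0)"
      proof (cases "\<mu> l < m")
        case True
        then have "Suc m - \<mu> l = Suc (m - \<mu> l)" "\<mu> l + Suc (m - \<mu> l) = Suc m" by auto
        then show ?thesis using True by (simp add: sum_distrib_left mult_ac)
      qed simp
    qed
    finally show ?thesis .
  qed
  also note mark
  also have "(\<Sum>l<L. if \<mu> l = m then ?V m (\<upsilon> l) * R (Suc m) (\<upsilon> l) u else 0) =
      (\<Sum>l<L. if \<mu> l = m then ?V (\<mu> l) (\<upsilon> l) * ?c l (Suc m - \<mu> l) u else 0)"
    using one by (intro sum.cong) auto
  finally show ?case
    by (simp add: add.assoc distrib_left[symmetric] sum.distrib[symmetric] less_Suc_eq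
         del: chain.simps) (auto intro!: arg_cong[where f="\<lambda>x. t * x"] sum.cong simp del: chain.simps)
qed


text \<open>Sylvester's identity: multiplying \<open>M\<close> by the unipotent \<open>U\<close>
  from the right and from the left gives block triangular matrices that exhibit the two Schur
  complements.\<close>

lemma det_one_plus_mult_commute:
  fixes A B :: "'a::idom mat"
  assumes A: "A \<in> carrier_mat n m" and B: "B \<in> carrier_mat m n"
  shows "Determinant.det (1\<^sub>m n + A * B) = Determinant.det (1\<^sub>m m + B * A)"
proof -
  define M where "M = four_block_mat (1\<^sub>m n) (- A) B (1\<^sub>m m)"
  define U where "U = four_block_mat (1\<^sub>m n) A (0\<^sub>m m n) (1\<^sub>m m)"
  have A': "- A \<in> carrier_mat n m" using A by simp
  have M: "M \<in> carrier_mat (n + m) (n + m)" and U: "U \<in> carrier_mat (n + m) (n + m)"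
    unfolding M_def U_def using A B by auto
  have zero: "A + - A = 0\<^sub>m n m" "- A + A = 0\<^sub>m n m" "- 0\<^sub>m m m + 1\<^sub>m m = (1\<^sub>m m :: 'a mat)"
    using A by (auto intro!: eq_matI)
  have dU: "Determinant.det U = 1"
    unfolding U_def by (subst det_four_block_mat_lower_left_zero[OF _ A]) auto
  have "M * U = four_block_mat (1\<^sub>m n) (0\<^sub>m n m) B (1\<^sub>m m + B * A)"
    unfolding M_def U_def
    by (subst mult_four_block_mat[OF one_carrier_mat A' B one_carrier_mat one_carrier_mat A zero_carrier_mat one_carrier_mat])
       (use A B in \<open>simp add: comm_add_mat[of "B * A" m m] zero\<close>)
  moreover have "Determinant.det (four_block_mat (1\<^sub>m n) (0\<^sub>m n m) B (1\<^sub>m m + B * A)) =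
      Determinant.det (1\<^sub>m m + B * A)"
    using A B by (subst det_four_block_mat_upper_right_zero[of _ n _ m]) auto
  ultimately have 1: "Determinant.det M = Determinant.det (1\<^sub>m m + B * A)"
    using det_mult[OF M U] dU by simp
  have "U * M = four_block_mat (1\<^sub>m n + A * B) (0\<^sub>m n m) B (1\<^sub>m m)"
    unfolding M_def U_def
    by (subst mult_four_block_mat[OF one_carrier_mat A zero_carrier_mat one_carrier_mat one_carrier_mat A' B one_carrier_mat])
       (use A B in \<open>simp add: zero\<close>)
  moreover have "Determinant.det (four_block_mat (1\<^sub>m n + A * B) (0\<^sub>m n m) B (1\<^sub>m m)) =
      Determinant.det (1\<^sub>m n + A * B)"
    using A B by (subst det_four_block_mat_upper_right_zero[of _ n _ m]) auto
  ultimately have 2: "Determinant.det M = Determinant.det (1\<^sub>m n + A * B)"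
    using det_mult[OF U M] dU by simp
  show ?thesis using 1 2 by simp
qed

text \<open>\<open>C\<close> links an index only to one of strictly larger \<mu>. A nonzero Leibniz
  term can therefore only raise \<mu>, while a permutation preserves the total of \<mu>, so no index
  changes its level and only the identity survives.\<close>

lemma det_one_minus_level_increasing:
  fixes C :: "nat \<Rightarrow> nat \<Rightarrow> 'a::idom" and \<mu> :: "nat \<Rightarrow> nat"
  assumes "\<And>i j. i < L \<Longrightarrow> j < L \<Longrightarrow> \<not> \<mu> i < \<mu> j \<Longrightarrow> C i j = 0"
  shows "Determinant.det (Matrix.mat L L (\<lambda>(i, j). (if i = j then 1 else 0) - C i j)) = 1"
proof -
  let ?f = "\<lambda>p. (\<Prod>i=0..<L. (if i = p i then 1 else 0) - C i (p i))"
  have "?f p = 0" if p: "p permutes {0..<L}" and nid: "p \<noteq> id" for p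
  proof (rule ccontr)
    assume "?f p \<noteq> 0"
    then have nz: "(if i = p i then 1 else 0) - C i (p i) \<noteq> 0" if "i < L" for i
      using that by simp
    have le: "\<mu> i \<le> \<mu> (p i)" if "i < L" for i
      using nz[OF that] assms[OF that, of "p i"] permutes_image_lessThan[OF p that]
      by (cases "\<mu> i < \<mu> (p i)") (auto split: if_splits)
    have "(\<Sum>i=0..<L. \<mu> (p i)) = (\<Sum>i=0..<L. \<mu> i)"
      using sum.permute[OF p, of \<mu>] by (simp add: o_def)
    then have eq: "\<mu> (p i) = \<mu> i" if "i < L" for i
      using that sum_strict_mono_ex1[of "{0..<L}" \<mu> "\<lambda>i. \<mu> (p i)"] le
      by (metis atLeastLessThan_iff finite_atLeastLessThan le_neq_implies_less nat_less_le zero_le)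
    have "p i = i" if "i < L" for i
    proof (rule ccontr)
      assume "p i \<noteq> i"
      then show False using nz[OF that] assms[OF that, of "p i"] permutes_image_lessThan[OF p that]
        eq[OF that] by auto
    qed
    then have "p i = id i" for i using permutes_not_in[OF p, of i] by (cases "i < L") auto
    then have "p = id" by (rule ext)
    then show False using nid by simp
  qed
  then have "(\<Sum>p\<in>{p. p permutes {0..<L}}. signof p * ?f p) = (\<Sum>p\<in>{id}. signof p * ?f p)"
    by (intro sum.mono_neutral_right) (auto simp: finite_permutations permutes_id)
  also have "\<dots> = 1" using assms[of _ _] by simp
  finally show ?thesis unfolding det_mat_eq by simp
qed


text \<open>Splitting at the last mark writes the marked Gram matrix as (1 + X B) G0, where X holds
  the marked chains ending at the marks; Sylvester's identity moves the determinant to size L. The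
  unimodular J then replaces the marked chains in X by unmarked ones, which leaves 1 + t K.\<close>

theorem det_chain_marked:
  fixes R :: "nat \<Rightarrow> 'x \<Rightarrow> 'x \<Rightarrow> 'a::idom" and \<mu> :: "nat \<Rightarrow> nat"
  assumes W: "finite W" and inj: "inj_on (\<lambda>l. (\<mu> l, \<upsilon> l)) {..<L}"
    and inW: "\<And>l. l < L \<Longrightarrow> \<upsilon> l \<in> W" and \<mu>: "\<And>l. l < L \<Longrightarrow> \<mu> l < q"
    and D: "\<And>m u. D m u = 1 + (if \<exists>l<L. (m, u) = (\<mu> l, \<upsilon> l) then t else 0)"
    and \<beta>: "\<And>l j. l < L \<Longrightarrow> j < k \<Longrightarrow> (\<Sum>i<k. \<beta> l i * chain W R (\<lambda>_ _. 1) (x i) q (y j)) =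
       chain W (\<lambda>m. R (\<mu> l + m)) (\<lambda>_ _. 1) (\<upsilon> l) (q - \<mu> l) (y j)"
    and K: "\<And>l l'. l < L \<Longrightarrow> l' < L \<Longrightarrow>
      K l l' = (\<Sum>i<k. \<beta> l i * chain W R (\<lambda>_ _. 1) (x i) (\<mu> l') (\<upsilon> l')) -
         (if \<mu> l < \<mu> l' then chain W (\<lambda>m. R (\<mu> l + m)) (\<lambda>_ _. 1) (\<upsilon> l) (\<mu> l' - \<mu> l) (\<upsilon> l') else 0)"
  shows "Determinant.det (Matrix.mat k k (\<lambda>(i, j). chain W R D (x i) q (y j))) =
    Determinant.det (Matrix.mat k k (\<lambda>(i, j). chain W R (\<lambda>_ _. 1) (x i) q (y j))) *
    Determinant.det (Matrix.mat L L (\<lambda>(l, l'). (if l = l' then 1 else 0) + t * K l l'))"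
proof -
  define V where "V i m u = chain W R D (x i) m u" for i m u
  define V0 where "V0 i m u = chain W R (\<lambda>_ _. 1) (x i) m u" for i m u
  define c where "c l m u = chain W (\<lambda>m. R (\<mu> l + m)) (\<lambda>_ _. 1) (\<upsilon> l) (m - \<mu> l) u" for l m u
  define C where "C l l' = (if \<mu> l < \<mu> l' then c l (\<mu> l') (\<upsilon> l') else 0)" for l l'
  have V: "V i m u = V0 i m u + t * (\<Sum>l<L. if \<mu> l < m then V i (\<mu> l) (\<upsilon> l) * c l m u else 0)" for i m u
    unfolding V_def V0_def c_def by (rule chain_last_marked_point[OF W inj inW D]) simp
  define G where "G = Matrix.mat k k (\<lambda>(i, j). V i q (y j))"
  define G0 where "G0 = Matrix.mat k k (\<lambda>(i, j). V0 i q (y j))"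
  define X where "X = Matrix.mat k L (\<lambda>(i, l). V i (\<mu> l) (\<upsilon> l))"
  define B where "B = Matrix.mat L k (\<lambda>(l, i). t * \<beta> l i)"
  define J where "J = Matrix.mat L L (\<lambda>(l, l'). (if l = l' then 1 else 0) - t * C l l')"
  have car: "G0 \<in> carrier_mat k k" "X \<in> carrier_mat k L" "B \<in> carrier_mat L k" "J \<in> carrier_mat L L"
    by (auto simp: G0_def X_def B_def J_def)
  have BG: "(B * G0) $$ (l, j) = t * c l q (y j)" if "l < L" "j < k" for l j
    using \<beta>[OF that] that
    by (simp add: B_def G0_def scalar_prod_def V0_def c_def mult.assoc sum_distrib_left[symmetric]
        atLeast0LessThan)
  have "G = G0 + X * (B * G0)"
  proof (rule eq_matI, goal_cases)
    case (1 i j)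
    then have ij: "i < k" "j < k" by (auto simp: G0_def B_def X_def)
    have "(X * (B * G0)) $$ (i, j) = (\<Sum>l<L. V i (\<mu> l) (\<upsilon> l) * (B * G0) $$ (l, j))"
      using ij car by (simp add: scalar_prod_def atLeast0LessThan X_def)
    also have "\<dots> = (\<Sum>l<L. V i (\<mu> l) (\<upsilon> l) * (t * c l q (y j)))"
      using BG ij by simp
    finally show ?case using ij car \<mu>
      by (simp add: G_def G0_def V[of i q] sum_distrib_left mult_ac)
  qed (auto simp: G_def G0_def X_def B_def)
  also have "\<dots> = (1\<^sub>m k + X * B) * G0"
    using car by (simp add: add_mult_distrib_mat[of _ k k] assoc_mult_mat[of X k L B k G0 k])
  finally have "Determinant.det G = Determinant.det (1\<^sub>m k + X * B) * Determinant.det G0"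
    using car by (simp add: det_mult[of _ k])
  also have "Determinant.det (1\<^sub>m k + X * B) = Determinant.det (1\<^sub>m L + B * X)"
    by (rule det_one_plus_mult_commute) (use car in auto)
  also have "\<dots> = Determinant.det (1\<^sub>m L + B * X) * Determinant.det J"
    unfolding J_def by (subst det_one_minus_level_increasing[where \<mu>=\<mu>]) (auto simp: C_def)
  also have "\<dots> = Determinant.det ((1\<^sub>m L + B * X) * J)"
    using car by (simp add: det_mult[of _ L])
  also have "(1\<^sub>m L + B * X) * J = J + B * (X * J)"
    using car by (simp add: add_mult_distrib_mat[of _ L L] assoc_mult_mat[of B L k X L J L])
  also have "\<dots> = Matrix.mat L L (\<lambda>(l, l'). (if l = l' then 1 else 0) + t * K l l')"
  proof (rule eq_matI, goal_cases)
    case (1 l l')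
    then have ll: "l < L" "l' < L" by auto
    \<comment> \<open>The decomposition by the last mark, read at the marks themselves.\<close>
    have XJ: "(X * J) $$ (i, l') = V0 i (\<mu> l') (\<upsilon> l')" if "i < k" for i
    proof -
      have "(X * J) $$ (i, l') = (\<Sum>l<L. V i (\<mu> l) (\<upsilon> l) * ((if l = l' then 1 else 0) - t * C l l'))"
        using that ll by (simp add: X_def J_def scalar_prod_def atLeast0LessThan)
      also have "\<dots> = V i (\<mu> l') (\<upsilon> l') - t * (\<Sum>l<L. V i (\<mu> l) (\<upsilon> l) * C l l')"
        using ll by (simp add: right_diff_distrib sum_subtractf sum_distrib_left mult.left_commute
            if_distrib[of "\<lambda>c. _ * c"] cong: if_cong)
      also have "(\<Sum>l<L. V i (\<mu> l) (\<upsilon> l) * C l l') =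
          (\<Sum>l<L. if \<mu> l < \<mu> l' then V i (\<mu> l) (\<upsilon> l) * c l (\<mu> l') (\<upsilon> l') else 0)"
        by (intro sum.cong) (auto simp: C_def)
      finally show ?thesis using V[of i "\<mu> l'" "\<upsilon> l'"] by simp
    qed
    have "(B * (X * J)) $$ (l, l') = (\<Sum>i<k. t * \<beta> l i * (X * J) $$ (i, l'))"
      using ll car by (simp add: scalar_prod_def atLeast0LessThan B_def)
    also have "\<dots> = t * (\<Sum>i<k. \<beta> l i * V0 i (\<mu> l') (\<upsilon> l'))"
      using XJ by (simp add: sum_distrib_left mult.assoc)
    finally show ?case using ll car K[OF ll]
      by (simp add: J_def V0_def C_def c_def right_diff_distrib)
  qed (use car in auto)
  finally show ?thesis
    unfolding G_def G0_def V_def V0_def by (simp add: mult.commute)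
qed

text \<open>Row \<open>l\<close> of \<open>\<beta>\<close> solves \<open>\<beta> G = b\<close> for the Gram matrix \<open>G\<close>, which need not be invertible. Weighting each
  of the \<open>L\<close> marked points with \<open>1 + t\<close> turns the sum of all weights into \<open>det G * det (1 + t K)\<close>; the claim
  is the coefficient of \<open>t ^ L\<close>.\<close>

theorem Eynard_Mehta:
  fixes R :: "nat \<Rightarrow> 'x::linorder \<Rightarrow> 'x \<Rightarrow> complex" and \<mu> :: "nat \<Rightarrow> nat"
  defines "T \<equiv> \<lambda>W k. {S. S \<subseteq> W \<and> card S = k}"
  assumes W: "finite W" and x: "\<And>i. i < k \<Longrightarrow> x i \<in> W" and q: "1 \<le> q"
    and inj: "inj_on (\<lambda>l. (\<mu> l, \<upsilon> l)) {..<L}"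
    and inW: "\<And>l. l < L \<Longrightarrow> \<upsilon> l \<in> W" and \<mu>: "\<And>l. l < L \<Longrightarrow> 1 \<le> \<mu> l \<and> \<mu> l < q"
    and \<beta>: "\<And>l j. l < L \<Longrightarrow> j < k \<Longrightarrow> (\<Sum>i<k. \<beta> l i * chain W R (\<lambda>_ _. 1) (x i) q (y j)) =
       chain W (\<lambda>m. R (\<mu> l + m)) (\<lambda>_ _. 1) (\<upsilon> l) (q - \<mu> l) (y j)"
    and K: "\<And>l l'. l < L \<Longrightarrow> l' < L \<Longrightarrow>
      K l l' = (\<Sum>i<k. \<beta> l i * chain W R (\<lambda>_ _. 1) (x i) (\<mu> l') (\<upsilon> l')) -
         (if \<mu> l < \<mu> l' then chain W (\<lambda>m. R (\<mu> l + m)) (\<lambda>_ _. 1) (\<upsilon> l) (\<mu> l' - \<mu> l) (\<upsilon> l') else 0)"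
  shows "(\<Sum>s | s \<in> {1..<q} \<rightarrow>\<^sub>E T W k \<and> (\<forall>l<L. \<upsilon> l \<in> s (\<mu> l)). chain_weight k R x y q s) =
    (\<Sum>s\<in>{1..<q} \<rightarrow>\<^sub>E T W k. chain_weight k R x y q s) * Determinant.det (Matrix.mat L L (\<lambda>(l, l'). K l l'))"
proof -
  let ?P = "{1..<q} \<rightarrow>\<^sub>E T W k"
  let ?Z = "\<Sum>s\<in>?P. chain_weight k R x y q s"
  define n where "n s = card {l\<in>{..<L}. \<upsilon> l \<in> s (\<mu> l)}" for s :: "nat \<Rightarrow> 'x set"
  define D where "D t m u = 1 + (if \<exists>l<L. (m, u) = (\<mu> l, \<upsilon> l) then t else 0)" for t :: complex and m u
  have finP: "finite ?P" using W by (intro finite_PiE) (auto simp: T_def)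
  have nL: "n s \<le> L" for s
  proof -
    have "n s \<le> card {..<L}" unfolding n_def by (rule card_mono) auto
    then show ?thesis by simp
  qed
  have Dn: "(\<Prod>m=1..<q. \<Prod>u\<in>s m. D t m u) = (1 + t) ^ n s" if s: "s \<in> ?P" for s t
  proof -
    define A where "A = {l\<in>{..<L}. \<upsilon> l \<in> s (\<mu> l)}"
    have fs: "finite (s m)" if "m \<in> {1..<q}" for m
      using s that W by (auto simp: T_def PiE_def Pi_def intro: finite_subset)
    have "(\<Prod>m=1..<q. \<Prod>u\<in>s m. D t m u) = (\<Prod>p\<in>Sigma {1..<q} s. D t (fst p) (snd p))"
      by (subst prod.Sigma) (auto simp: fs case_prod_unfold)
    also have "\<dots> = (\<Prod>p\<in>(\<lambda>l. (\<mu> l, \<upsilon> l)) ` A. 1 + t)"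
    proof (rule prod.mono_neutral_cong_right)
      show "finite (Sigma {1..<q} s)" using fs by auto
      show "(\<lambda>l. (\<mu> l, \<upsilon> l)) ` A \<subseteq> Sigma {1..<q} s" using \<mu> by (auto simp: A_def)
      show "\<forall>p\<in>Sigma {1..<q} s - (\<lambda>l. (\<mu> l, \<upsilon> l)) ` A. D t (fst p) (snd p) = 1"
        by (auto simp: D_def A_def image_iff)
      show "D t (fst p) (snd p) = 1 + t" if "p \<in> (\<lambda>l. (\<mu> l, \<upsilon> l)) ` A" for p
        using that by (auto simp: D_def A_def)
    qed
    also have "\<dots> = (1 + t) ^ card ((\<lambda>l. (\<mu> l, \<upsilon> l)) ` A)" by simp
    also have "card ((\<lambda>l. (\<mu> l, \<upsilon> l)) ` A) = n s"
      unfolding n_def A_def by (rule card_image) (rule inj_on_subset[OF inj], auto)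
    finally show ?thesis .
  qed
  have Z0: "Determinant.det (Matrix.mat k k (\<lambda>(i, j). chain W R (\<lambda>_ _. 1) (x i) q (y j))) = ?Z"
    using sum_chain_weight[OF W x _ q, where D="\<lambda>_ _. 1" and R=R and y=y and k=k] by (simp add: T_def)
  have main: "(\<Sum>s\<in>?P. chain_weight k R x y q s * (1 + t) ^ n s) =
      ?Z * Determinant.det (Matrix.mat L L (\<lambda>(l, l'). (if l = l' then 1 else 0) + t * K l l'))" for t
  proof -
    have "(\<Sum>s\<in>?P. chain_weight k R x y q s * (1 + t) ^ n s) =
       (\<Sum>s\<in>?P. chain_weight k R x y q s * (\<Prod>m=1..<q. \<Prod>u\<in>s m. D t m u))"
      using Dn by simp
    also have "\<dots> = Determinant.det (Matrix.mat k k (\<lambda>(i, j). chain W R (D t) (x i) q (y j)))"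
      unfolding T_def by (rule sum_chain_weight[OF W x _ q]) (use \<mu> in \<open>force simp: D_def\<close>)+
    also have "\<dots> = ?Z * Determinant.det (Matrix.mat L L (\<lambda>(l, l'). (if l = l' then 1 else 0) + t * K l l'))"
      unfolding Z0[symmetric]
      by (rule det_chain_marked[OF W inj inW _ D_def \<beta> K]) (use \<mu> in auto)
    finally show ?thesis .
  qed
  \<comment> \<open>With t = 1/s and both sides multiplied by s^L, the coefficient of t^L becomes
    the value at s = 0. The identity holds for s \<noteq> 0 and is carried to 0 by
    continuity.\<close>
  define f where "f s = (\<Sum>\<sigma>\<in>?P. chain_weight k R x y q \<sigma> * ((s + 1) ^ n \<sigma> * s ^ (L - n \<sigma>)))" for s
  define g where "g s = ?Z * Determinant.det (Matrix.mat L L (\<lambda>(l, l'). (if l = l' then s else 0) + K l l'))" for s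
  have fg: "f s = g s" if s: "s \<noteq> 0" for s
  proof -
    have "f s = s ^ L * (\<Sum>\<sigma>\<in>?P. chain_weight k R x y q \<sigma> * (1 + 1 / s) ^ n \<sigma>)"
      unfolding f_def sum_distrib_left
    proof (rule sum.cong[OF refl])
      fix \<sigma>
      have "s ^ L = s ^ n \<sigma> * s ^ (L - n \<sigma>)" using nL[of \<sigma>] by (simp flip: power_add)
      moreover have "(s + 1) ^ n \<sigma> = s ^ n \<sigma> * (1 + 1 / s) ^ n \<sigma>"
        using s by (simp flip: power_mult_distrib add: distrib_left)
      ultimately show "chain_weight k R x y q \<sigma> * ((s + 1) ^ n \<sigma> * s ^ (L - n \<sigma>)) =
        s ^ L * (chain_weight k R x y q \<sigma> * (1 + 1 / s) ^ n \<sigma>)" by simp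
    qed
    also have "\<dots> = ?Z * (s ^ L * Determinant.det (Matrix.mat L L (\<lambda>(l, l'). (if l = l' then 1 else 0) + 1 / s * K l l')))"
      by (simp only: main) simp
    also have "s ^ L * Determinant.det (Matrix.mat L L (\<lambda>(l, l'). (if l = l' then 1 else 0) + 1 / s * K l l')) =
      Determinant.det (Matrix.mat L L (\<lambda>(l, l'). s * ((if l = l' then 1 else 0) + 1 / s * K l l')))"
      by (subst det_mat_scale_rows[where c="\<lambda>_. s"]) simp
    also have "\<dots> = Determinant.det (Matrix.mat L L (\<lambda>(l, l'). (if l = l' then s else 0) + K l l'))"
      using s by (intro det_mat_cong) (auto simp: distrib_left)
    finally show ?thesis unfolding g_def .
  qed
  have cf: "isCont f 0" unfolding f_def by (intro continuous_intros)
  have cif: "isCont (\<lambda>s. if l = l' then s else (0 :: complex)) 0" for l l' :: nat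
    by (cases "l = l'") auto
  have cg: "isCont g 0" unfolding g_def det_mat_eq prod.case
    by (intro continuous_intros cif)
  have "f 0 = g 0"
  proof (rule LIM_unique)
    show "f \<midarrow>0\<rightarrow> f 0" using cf by (simp add: isCont_def)
    have "g \<midarrow>0\<rightarrow> g 0" using cg by (simp add: isCont_def)
    then show "f \<midarrow>0\<rightarrow> g 0"
      by (rule Lim_transform_eventually) (auto simp: eventually_at_filter fg)
  qed
  moreover have "f 0 = (\<Sum>s | s \<in> ?P \<and> (\<forall>l<L. \<upsilon> l \<in> s (\<mu> l)). chain_weight k R x y q s)"
  proof -
    have full: "n s = L \<longleftrightarrow> (\<forall>l<L. \<upsilon> l \<in> s (\<mu> l))" for s
    proof
      assume "n s = L"
      then have "{l\<in>{..<L}. \<upsilon> l \<in> s (\<mu> l)} = {..<L}"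
        by (intro card_subset_eq) (auto simp: n_def)
      then show "\<forall>l<L. \<upsilon> l \<in> s (\<mu> l)" by auto
    next
      assume "\<forall>l<L. \<upsilon> l \<in> s (\<mu> l)"
      then have "{l\<in>{..<L}. \<upsilon> l \<in> s (\<mu> l)} = {..<L}" by auto
      then show "n s = L" by (simp add: n_def)
    qed
    \<comment> \<open>At s = 0 the factor \<open>0 ^ (L - n s)\<close> keeps exactly the families
      that contain every marked point.\<close>
    have "f 0 = (\<Sum>s\<in>?P. if n s = L then chain_weight k R x y q s else 0)"
      unfolding f_def
    proof (rule sum.cong[OF refl])
      fix s
      show "chain_weight k R x y q s * ((0 + 1) ^ n s * 0 ^ (L - n s)) =
        (if n s = L then chain_weight k R x y q s else 0)"
        using nL[of s] by (auto simp: power_0_left)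
    qed
    also have "\<dots> = (\<Sum>s | s \<in> ?P \<and> (\<forall>l<L. \<upsilon> l \<in> s (\<mu> l)). chain_weight k R x y q s)"
      unfolding full by (rule sum.inter_filter[OF finP, symmetric])
    finally show ?thesis .
  qed
  moreover have "g 0 = ?Z * Determinant.det (Matrix.mat L L (\<lambda>(l, l'). K l l'))"
    unfolding g_def by (intro arg_cong2[where f="(*)"] refl det_mat_cong) auto
  ultimately show ?thesis by simp
qed

section \<open>Symbols as words in the factors\<close>

text \<open>\<open>NF a\<close> is inverse to \<open>MF (- a)\<close>, so that words in the factors are closed under inversion.\<close>

datatype factor = MF "nat \<Rightarrow> real" | NF "nat \<Rightarrow> real"

primrec fsym :: "factor \<Rightarrow> complex \<Rightarrow> complex^3^3" where
  "fsym (MF a) z = M_d z (a 0) (a 1) (a 2)"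
| "fsym (NF a) z = N_d z (a 0) (a 1) (a 2)"

definition wsym :: "factor list \<Rightarrow> complex \<Rightarrow> complex^3^3" where
  "wsym ws z = foldr (\<lambda>x X. fsym x z ** X) ws (Finite_Cartesian_Product.mat 1)"

text \<open>Weight of the step from u down to u - 1; for u divisible by 3 it crosses a block
  boundary and is the entry of \<open>M_d\<close> with 1/z.\<close>

definition step_wt :: "(nat \<Rightarrow> real) \<Rightarrow> int \<Rightarrow> real" where
  "step_wt a u = a (nat ((u - 1) mod 3))"

definition period_wt :: "(nat \<Rightarrow> real) \<Rightarrow> int \<Rightarrow> real" where
  "period_wt a u = (if u mod 3 = 0 then 1 else if u mod 3 = 1 then a 0 else a 0 * a 1)"

text \<open>The block Toeplitz matrix of a factor, with its rows and columns indexed by heights. For \<open>NF a\<close> this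
  is correct only if \<open>a 0 * a 1 * a 2 = 1\<close>, which makes \<open>period_wt a\<close> the 3-periodic product of step weights.\<close>

primrec fop :: "factor \<Rightarrow> int \<Rightarrow> int \<Rightarrow> complex" where
  "fop (MF a) u v = (if v = u then 1 else if v = u - 1 then of_real (step_wt a u) else 0)"
| "fop (NF a) u v = (if v \<le> u then of_real (period_wt a u / period_wt a v) else 0)"

text \<open>For lower triangular matrices all terms with w outside \<open>{v..u}\<close> vanish, so
  this is the matrix product over all integers as a finite sum.\<close>

definition lmul :: "(int \<Rightarrow> int \<Rightarrow> complex) \<Rightarrow> (int \<Rightarrow> int \<Rightarrow> complex) \<Rightarrow> int \<Rightarrow> int \<Rightarrow> complex" where
  "lmul A B u v = (\<Sum>w\<in>{v..u}. A u w * B w v)"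

definition wop :: "factor list \<Rightarrow> int \<Rightarrow> int \<Rightarrow> complex" where
  "wop ws = foldr (\<lambda>x. lmul (fop x)) ws (\<lambda>u v. if u = v then 1 else 0)"

lemma wsym_Nil [simp]: "wsym [] z = Finite_Cartesian_Product.mat 1"
  and wsym_Cons: "wsym (x # ws) z = fsym x z ** wsym ws z"
  by (simp_all add: wsym_def)

lemma wsym_append: "wsym (xs @ ys) z = wsym xs z ** wsym ys z"
  by (induction xs) (simp_all add: wsym_Cons matrix_mul_assoc)

lemma wop_Nil: "wop [] u v = (if u = v then 1 else 0)"
  and wop_Cons: "wop (x # ws) = lmul (fop x) (wop ws)"
  by (simp_all add: wop_def)

lemma lmul_assoc: "lmul (lmul A B) C = lmul A (lmul B C)"
proof (intro ext)
  fix u v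
  have "(\<Sum>w\<in>{v..u}. \<Sum>x\<in>{w..u}. A u x * B x w * C w v) =
      (\<Sum>p\<in>Sigma {v..u} (\<lambda>w. {w..u}). A u (snd p) * B (snd p) (fst p) * C (fst p) v)"
    by (subst sum.Sigma) (auto simp: case_prod_unfold)
  also have "\<dots> = (\<Sum>p\<in>Sigma {v..u} (\<lambda>x. {v..x}). A u (fst p) * B (fst p) (snd p) * C (snd p) v)"
    by (rule sum.reindex_bij_witness[where i="\<lambda>p. (snd p, fst p)" and j="\<lambda>p. (snd p, fst p)"]) auto
  also have "\<dots> = (\<Sum>x\<in>{v..u}. \<Sum>w\<in>{v..x}. A u x * B x w * C w v)"
    by (subst sum.Sigma) (auto simp: case_prod_unfold)
  finally show "lmul (lmul A B) C u v = lmul A (lmul B C) u v"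
    by (simp add: lmul_def sum_distrib_left sum_distrib_right mult.assoc)
qed

lemma lmul_lower: "u < v \<Longrightarrow> lmul A B u v = 0"
  by (simp add: lmul_def)

lemma wop_lower: "u < v \<Longrightarrow> wop ws u v = 0"
  by (cases ws) (auto simp: wop_Nil wop_Cons lmul_lower)

lemma lmul_wop_Nil: "lmul (wop []) (wop ws) = wop ws"
proof (intro ext)
  fix u v
  show "lmul (wop []) (wop ws) u v = wop ws u v"
    by (cases "v \<le> u")
       (auto simp: lmul_def wop_Nil wop_lower if_distrib[of "\<lambda>c. c * _"] cong: if_cong)
qed

lemma wop_append: "wop (xs @ ys) = lmul (wop xs) (wop ys)"
  by (induction xs) (simp_all add: lmul_wop_Nil wop_Cons lmul_assoc)

lemma wop_single: "wop [x] u v = (if v \<le> u then fop x u v else 0)"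
  by (auto simp: wop_Cons wop_Nil lmul_def if_distrib[of "\<lambda>c. _ * c"] cong: if_cong)

lemma fop_lower: "u < v \<Longrightarrow> fop x u v = 0"
  by (cases x) auto

lemma wop_single_eq_fop: "wop [x] = fop x"
  by (intro ext) (simp add: wop_single fop_lower)

lemma fop_MF_lmul:
  assumes "\<And>u v. u < v \<Longrightarrow> B u v = 0"
  shows "lmul (fop (MF a)) B u v = B u v + of_real (step_wt a u) * B (u - 1) v"
proof -
  consider "u < v" | "u = v" | "v < u" by linarith
  then show ?thesis
  proof cases
    case 3
    have "lmul (fop (MF a)) B u v = (\<Sum>w\<in>{u - 1, u}. fop (MF a) u w * B w v)"
      unfolding lmul_def by (rule sum.mono_neutral_right) (use 3 in auto)
    then show ?thesis by simp
  qed (auto simp: lmul_def assms)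
qed

definition is_MF :: "factor \<Rightarrow> bool" where
  "is_MF x \<longleftrightarrow> (\<exists>a. x = MF a)"

lemma wop_banded:
  assumes "list_all is_MF ws" "v + int (length ws) < u"
  shows "wop ws u v = 0"
  using assms
proof (induction ws arbitrary: u)
  case Nil
  then show ?case by (simp add: wop_Nil)
next
  case (Cons x ws)
  then obtain a where x: "x = MF a" by (auto simp: is_MF_def)
  show ?case using Cons unfolding x wop_Cons
    by (simp add: fop_MF_lmul[OF wop_lower] del: fop.simps)
qed

text \<open>A row vector in C^3 spread over all heights, one power of 1/z per block. Multiplication
  by a symbol at fixed z thereby becomes a scalar recursion in the height.\<close>

definition vec_row :: "complex^3 \<Rightarrow> complex \<Rightarrow> int \<Rightarrow> complex" where
  "vec_row F z s = F $ block_index s * z powi (- (s div 3))"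

text \<open>For u in block x and v in block y this is the symbol entry times z^(x - y); integrated
  against dz/z it yields the coefficient of z^(y - x), as in the block Toeplitz convention.\<close>

definition ent :: "complex^3^3 \<Rightarrow> complex \<Rightarrow> int \<Rightarrow> int \<Rightarrow> complex" where
  "ent X z u v = X $ block_index u $ block_index v * z powi (u div 3 - v div 3)"

lemma ent_eq_row: "z \<noteq> 0 \<Longrightarrow> ent X z u v = z powi (u div 3) * vec_row (X $ block_index u) z v"
  by (simp add: ent_def vec_row_def power_int_diff power_int_minus field_simps)

lemma matrix_mult_row: "(A ** B) $ i = A $ i v* B" for A :: "complex^3^3"
  by (simp add: matrix_matrix_mult_def vector_matrix_mult_def Finite_Cartesian_Product.vec_eq_iff mult.commute)

lemma int_mod3_cases:
  obtains x :: int where "u = 3 * x" | x where "u = 3 * x + 1" | x where "u = 3 * x + 2"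
proof -
  have "u = 3 * (u div 3) + u mod 3" by simp
  moreover have "u mod 3 = 0 \<or> u mod 3 = 1 \<or> u mod 3 = 2" by presburger
  ultimately show ?thesis using that by (metis add.right_neutral)
qed

lemma block_index_simps [simp]:
  "block_index (3 * x) = 1" "block_index (3 * x + 1) = 2" "block_index (3 * x + 2) = 3"
  "block_index (3 * x + 3) = 1"
proof -
  have m: "(3 * x) mod 3 = 0" "(3 * x + 1) mod 3 = 1" "(3 * x + 2) mod 3 = 2" "(3 * x + 3) mod 3 = 0"
    by presburger+
  show "block_index (3 * x) = 1" "block_index (3 * x + 1) = 2" "block_index (3 * x + 2) = 3"
    "block_index (3 * x + 3) = 1"
    unfolding block_index_def m by simp_all
qed

lemma div3_simps [simp]:
  "(3 * x + 1) div 3 = x" "(3 * x + 2) div 3 = x" "(3 * x + 3) div 3 = x + 1" for x :: int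
  by presburger+

lemma mod3_simps [simp]:
  "(3 * x + 1) mod 3 = 1" "(3 * x + 2) mod 3 = 2" "(3 * x + 3) mod 3 = 0" for x :: int
  by presburger+

text \<open>At a block boundary the entry \<open>a 2 / z\<close> supplies exactly the power of z by
  which neighbouring blocks differ, so a single recursion covers all three residues.\<close>

lemma vec_row_M_d:
  assumes "z \<noteq> 0"
  shows "vec_row (F v* M_d z (a 0) (a 1) (a 2)) z v =
    vec_row F z v + of_real (step_wt a (v + 1)) * vec_row F z (v + 1)"
proof -
  note simps = vec_row_def vector_matrix_mult_def sum_3 M_d_def step_wt_def distrib_right
  show ?thesis
  proof (cases v rule: int_mod3_cases)
    case (1 x)
    then have "block_index v = 1" "block_index (v + 1) = 2" "v div 3 = x" "(v + 1) div 3 = x"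
      "v mod 3 = 0" by simp_all
    then show ?thesis by (simp add: simps)
  next
    case (2 x)
    then have "v + 1 = 3 * x + 2" by simp
    then have "block_index v = 2" "block_index (v + 1) = 3" "v div 3 = x" "(v + 1) div 3 = x"
      "v mod 3 = 1" using 2 by (simp_all only: block_index_simps div3_simps mod3_simps)
    then show ?thesis by (simp add: simps)
  next
    case (3 x)
    then have "v + 1 = 3 * x + 3" by simp
    then have e: "block_index v = 3" "block_index (v + 1) = 1" "v div 3 = x" "(v + 1) div 3 = x + 1"
      "v mod 3 = 2" using 3 by (simp_all only: block_index_simps div3_simps mod3_simps)
    have "z powi (- (x + 1)) = z powi (- x) / z"
      using assms power_int_diff[of z "- x" 1] by simp
    with e show ?thesis by (simp add: simps)
  qed
qed

text \<open>The height h may be any bound beyond the band of the word. The row F is arbitrary, so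
  nothing triangular is asked of the factor to the left of the word.\<close>

lemma vec_row_wsym:
  assumes "z \<noteq> 0" "list_all is_MF ws" "v + int (length ws) \<le> h"
  shows "vec_row (F v* wsym ws z) z v = (\<Sum>s\<in>{v..h}. vec_row F z s * wop ws s v)"
  using assms(2,3)
proof (induction ws arbitrary: F)
  case Nil
  then show ?case
    by (simp add: wop_Nil if_distrib[of "\<lambda>c. _ * c"] cong: if_cong)
next
  case (Cons x ws)
  then obtain a where x: "x = MF a" by (auto simp: is_MF_def)
  define g where "g s = of_real (step_wt a s) * vec_row F z s * wop ws (s - 1) v" for s
  have "vec_row (F v* wsym (x # ws) z) z v =
      (\<Sum>s\<in>{v..h}. vec_row (F v* M_d z (a 0) (a 1) (a 2)) z s * wop ws s v)"
    using Cons by (simp add: x wsym_Cons flip: vector_matrix_mul_assoc)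
  also have "\<dots> = (\<Sum>s\<in>{v..h}. vec_row F z s * wop ws s v) + (\<Sum>s\<in>{v..h}. g (s + 1))"
    by (simp add: vec_row_M_d[OF assms(1)] distrib_right sum.distrib g_def del: One_nat_def)
  also have "(\<Sum>s\<in>{v..h}. g (s + 1)) = (\<Sum>s\<in>{v + 1..h + 1}. g s)"
    by (rule sum.reindex_bij_witness[where i="\<lambda>s. s - 1" and j="\<lambda>s. s + 1"]) auto
  \<comment> \<open>Shifting the range back costs nothing: bandedness kills the term at h + 1 and
    triangularity the term at v.\<close>
  also have "\<dots> = (\<Sum>s\<in>{v..h}. g s)"
  proof -
    have "g (h + 1) = 0" using Cons.prems by (simp add: g_def wop_banded)
    moreover have "g v = 0" by (simp add: g_def wop_lower)
    ultimately have "(\<Sum>s\<in>{v + 1..h + 1}. g s) = (\<Sum>s\<in>{v..h+1}. g s)"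
      "(\<Sum>s\<in>{v..h}. g s) = (\<Sum>s\<in>{v..h+1}. g s)"
      by (auto intro!: sum.mono_neutral_left) (smt (verit) atLeastAtMost_iff)+
    then show ?thesis by simp
  qed
  finally show ?case
    by (simp add: x wop_Cons fop_MF_lmul[OF wop_lower] distrib_left sum.distrib g_def mult_ac
        del: fop.simps)
qed

lemma fsym_inverse:
  assumes "z \<noteq> 0" "z \<noteq> of_real (a 0 * a 1 * a 2)"
  shows "fsym (NF a) z ** fsym (MF (\<lambda>i. - a i)) z = Finite_Cartesian_Product.mat 1"
    and "fsym (MF (\<lambda>i. - a i)) z ** fsym (NF a) z = Finite_Cartesian_Product.mat 1"
proof -
  have nz: "z - of_real (a 0) * of_real (a 1) * of_real (a 2) \<noteq> (0 :: complex)" using assms by simp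
  then have nz2: "(z - of_real (a 0) * of_real (a 1) * of_real (a 2)) *
      (z - of_real (a 0) * of_real (a 1) * of_real (a 2)) \<noteq> (0 :: complex)" by simp
  have e: "1 - of_real (a 0) * of_real (a 1) * of_real (a 2) / z =
     (z - of_real (a 0) * of_real (a 1) * of_real (a 2)) / (z :: complex)" using assms by (simp add: field_simps)
  show "fsym (NF a) z ** fsym (MF (\<lambda>i. - a i)) z = Finite_Cartesian_Product.mat 1"
    and "fsym (MF (\<lambda>i. - a i)) z ** fsym (NF a) z = Finite_Cartesian_Product.mat 1"
    unfolding Finite_Cartesian_Product.vec_eq_iff forall_3 fsym.simps M_d_def N_d_def of_real_mult e
    using assms(1) nz
    by (simp_all add: matrix_matrix_mult_def sum_3
        Finite_Cartesian_Product.mat_def del: One_nat_def)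
       (simp_all add: field_simps del: One_nat_def, (use nz2 in \<open>simp add: algebra_simps del: mult_eq_0_iff\<close>)+)
qed

lemma period_wt_step:
  assumes "a 0 * a 1 * a 2 = 1"
  shows "period_wt a (u + 1) = period_wt a u * step_wt a (u + 1)"
proof (cases u rule: int_mod3_cases)
  case (2 x)
  then have "u + 1 = 3 * x + 2" by simp
  then show ?thesis using 2 by (simp add: period_wt_def step_wt_def)
next
  case (3 x)
  then have "u + 1 = 3 * x + 3" by simp
  then show ?thesis using 3 assms by (simp add: period_wt_def step_wt_def)
qed (simp add: period_wt_def step_wt_def)

lemma period_wt_nonzero:
  assumes "a 0 * a 1 * a 2 = 1"
  shows "period_wt a u \<noteq> 0"
  using assms by (auto simp: period_wt_def)

text \<open>The recursion in the column index that expresses inversion of a bidiagonal factor; a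
  trailing \<open>NF\<close> is later recognised by it.\<close>

lemma fop_NF_step:
  assumes "a 0 * a 1 * a 2 = 1" "v < u"
  shows "fop (NF a) u v = of_real (step_wt a (v + 1)) * fop (NF a) u (v + 1)"
proof -
  have "step_wt a (v + 1) \<noteq> 0"
    using period_wt_step[OF assms(1), of v] period_wt_nonzero[OF assms(1)] by (metis mult_zero_right)
  then show ?thesis
    using assms by (simp add: period_wt_step)
qed

section \<open>Toeplitz matrices of a contour\<close>

text \<open>Every pole has winding number 1, so the integral equals the same residue sum as over a
  large circle, where z f(z) \<rightarrow> 0 makes it arbitrarily small.\<close>

lemma contour_integral_eq_0_at_infinity:
  assumes \<gamma>: "valid_path \<gamma>" "pathfinish \<gamma> = pathstart \<gamma>"
    and pts: "finite pts" "path_image \<gamma> \<inter> pts = {}" "\<And>p. p \<in> pts \<Longrightarrow> winding_number \<gamma> p = 1"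
    and f: "f holomorphic_on - pts" and lim: "((\<lambda>z. z * f z) \<longlongrightarrow> 0) at_infinity"
  shows "contour_integral \<gamma> f = 0"
proof -
  let ?r = "complex_of_real (2 * pi) * \<i> * (\<Sum>p\<in>pts. residue f p)"
  have I\<gamma>: "contour_integral \<gamma> f = ?r"
    using Residue_theorem[of UNIV pts f \<gamma>] assms by (auto simp: Compl_eq_Diff_UNIV)
  obtain R0 where R0: "\<And>p. p \<in> pts \<Longrightarrow> norm p \<le> R0"
    using finite_imp_bounded[OF pts(1)] by (auto simp: bounded_iff)
  have "norm ?r \<le> 2 * pi * \<epsilon>" if \<epsilon>: "\<epsilon> > 0" for \<epsilon>
  proof -
    obtain B where B: "\<And>z. norm z \<ge> B \<Longrightarrow> norm (z * f z) < \<epsilon>"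
      using tendstoD[OF lim \<epsilon>] by (auto simp: eventually_at_infinity)
    define R where "R = max (max B (R0 + 1)) 1"
    have R: "R \<ge> B" "R > R0" "R > 0" by (auto simp: R_def)
    have img: "path_image (circlepath 0 R) \<inter> pts = {}"
      using R0 R by (auto simp: path_image_circlepath) (metis R(2) linorder_not_less)
    have "contour_integral (circlepath 0 R) f =
        complex_of_real (2 * pi) * \<i> * (\<Sum>p\<in>pts. winding_number (circlepath 0 R) p * residue f p)"
      using Residue_theorem[of UNIV pts f "circlepath 0 R"] f pts(1) img
      by (auto simp: Compl_eq_Diff_UNIV simp del: path_image_circlepath)
    also have "(\<Sum>p\<in>pts. winding_number (circlepath 0 R) p * residue f p) = (\<Sum>p\<in>pts. residue f p)"
    proof (rule sum.cong[OF refl])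
      fix p assume "p \<in> pts"
      then have "norm (p - 0) < R" using R0[of p] R by simp
      then show "winding_number (circlepath 0 R) p * residue f p = residue f p"
        by (simp add: winding_number_circlepath)
    qed
    finally have IR: "contour_integral (circlepath 0 R) f = ?r" .
    have "f contour_integrable_on circlepath 0 R"
      by (rule contour_integrable_holomorphic_simple[OF f])
         (use img pts(1) in \<open>auto simp: open_Compl finite_imp_closed\<close>)
    then have "(f has_contour_integral ?r) (circlepath 0 R)"
      using has_contour_integral_integral IR by metis
    moreover have fb: "norm (f z) \<le> \<epsilon> / R" if "norm (z - 0) = R" for z
    proof -
      have "norm z * norm (f z) < \<epsilon>" using B[of z] R that by (simp add: norm_mult)
      then show ?thesis using R that by (simp add: field_simps)
    qed
    ultimately have "norm ?r \<le> \<epsilon> / R * (2 * pi * R)"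
      using R \<epsilon> by (intro has_contour_integral_bound_circlepath[where f=f and z=0]) auto
    then show ?thesis using R by (simp add: field_simps)
  qed
  note bound = this
  have "norm ?r \<le> 0"
  proof (rule field_le_epsilon)
    fix e :: real assume "e > 0"
    then show "norm ?r \<le> 0 + e" using bound[of "e / (2 * pi)"] by simp
  qed
  then show ?thesis using I\<gamma> by simp
qed

lemma tendsto_power_int_at_infinity:
  assumes "k < 0"
  shows "((\<lambda>z::complex. z powi k) \<longlongrightarrow> 0) at_infinity"
proof -
  have "((\<lambda>z::complex. inverse z ^ nat (- k)) \<longlongrightarrow> 0 ^ nat (- k)) at_infinity"
    by (intro tendsto_intros tendsto_inverse_0)
  then show ?thesis using assms by (simp add: power_int_def power_0_left)
qed

section \<open>Holomorphy of words and their limits at infinity\<close>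

definition hol3 :: "complex set \<Rightarrow> (complex \<Rightarrow> complex^3^3) \<Rightarrow> bool" where
  "hol3 S X \<longleftrightarrow> (\<forall>i j. (\<lambda>z. X z $ i $ j) holomorphic_on S)"

definition conv3 :: "(complex \<Rightarrow> complex^3^3) \<Rightarrow> bool" where
  "conv3 X \<longleftrightarrow> (\<exists>L. \<forall>i j. ((\<lambda>z. X z $ i $ j) \<longlongrightarrow> L i j) at_infinity)"

lemma hol3_mult: "hol3 S X \<Longrightarrow> hol3 S Y \<Longrightarrow> hol3 S (\<lambda>z. X z ** Y z)"
  by (auto simp: hol3_def matrix_matrix_mult_def intro!: holomorphic_intros)

lemma hol3_id: "hol3 S (\<lambda>z. Finite_Cartesian_Product.mat 1)"
  by (auto simp: hol3_def Finite_Cartesian_Product.mat_def intro!: holomorphic_intros)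

lemma conv3_mult: "conv3 X \<Longrightarrow> conv3 Y \<Longrightarrow> conv3 (\<lambda>z. X z ** Y z)"
proof -
  assume "conv3 X" "conv3 Y"
  then obtain L M where "\<And>i j. ((\<lambda>z. X z $ i $ j) \<longlongrightarrow> L i j) at_infinity"
    "\<And>i j. ((\<lambda>z. Y z $ i $ j) \<longlongrightarrow> M i j) at_infinity"
    unfolding conv3_def by blast
  then show ?thesis unfolding conv3_def
    by (intro exI[of _ "\<lambda>i j. \<Sum>k\<in>UNIV. L i k * M k j"])
       (auto simp: matrix_matrix_mult_def intro!: tendsto_intros)
qed

lemma conv3_id: "conv3 (\<lambda>z. Finite_Cartesian_Product.mat 1)"
  unfolding conv3_def by (rule exI[of _ "\<lambda>i j. if i = j then 1 else 0"])
    (auto simp: Finite_Cartesian_Product.mat_def)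

lemma hol3_fsym:
  assumes "0 \<notin> S" "\<And>a. x = NF a \<Longrightarrow> of_real (a 0 * a 1 * a 2) \<notin> S"
  shows "hol3 S (fsym x)"
proof (cases x)
  case (MF a)
  then show ?thesis unfolding hol3_def forall_3 using assms(1)
    by (auto simp: M_d_def intro!: holomorphic_intros)
next
  case (NF a)
  have "of_real (a 0) * of_real (a 1) * of_real (a 2) \<notin> S" using assms(2)[OF NF] by simp
  then show ?thesis unfolding NF hol3_def forall_3 using assms(1)
    by (auto simp: N_d_def intro!: holomorphic_intros)
qed

lemma hol3_wsym:
  assumes "0 \<notin> S" "\<And>a. NF a \<in> set ws \<Longrightarrow> of_real (a 0 * a 1 * a 2) \<notin> S"
  shows "hol3 S (wsym ws)"
  using assms(2)
proof (induction ws)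
  case Nil
  then show ?case by (simp add: hol3_id)
next
  case (Cons x ws)
  then have "hol3 S (fsym x)" "hol3 S (wsym ws)"
    using assms(1) by (auto intro!: hol3_fsym)
  then show ?case unfolding wsym_Cons by (rule hol3_mult)
qed

lemma conv3_fsym: "conv3 (fsym x)"
proof -
  have c: "((\<lambda>z. c / z) \<longlongrightarrow> 0) at_infinity" for c :: complex
    using tendsto_mult[OF tendsto_const[of c] tendsto_inverse_0] by (simp add: field_simps)
  show ?thesis
  proof (cases x)
    case (MF a)
    show ?thesis unfolding MF conv3_def
      by (intro exI[of _ "\<lambda>i j. (vector [vector [1, 0, 0], vector [of_real (a 0), 1, 0],
            vector [0, of_real (a 1), 1]] :: complex^3^3) $ i $ j"])
         (auto simp: forall_3 M_d_def c)
  next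
    case (NF a)
    have e1: "((\<lambda>z. 1 / (1 - A / z)) \<longlongrightarrow> 1) at_infinity" for A :: complex
    proof -
      have "((\<lambda>z. 1 / (1 - A / z)) \<longlongrightarrow> 1 / (1 - 0)) at_infinity"
        by (intro tendsto_intros c) simp
      then show ?thesis by simp
    qed
    have e2: "((\<lambda>z. 1 / (1 - A / z) * b) \<longlongrightarrow> b) at_infinity" for A b :: complex
      using tendsto_mult[OF e1 tendsto_const[of b]] by simp
    have e3: "((\<lambda>z. 1 / (1 - A / z) * b / z) \<longlongrightarrow> 0) at_infinity" for A b :: complex
      using tendsto_mult[OF e1 c[of b]] by simp
    show ?thesis unfolding NF conv3_def
      by (intro exI[of _ "\<lambda>i j. (vector [vector [1, 0, 0], vector [of_real (a 0), 1, 0],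
            vector [of_real (a 0 * a 1), of_real (a 1), 1]] :: complex^3^3) $ i $ j"])
         (auto simp: forall_3 N_d_def simp del: times_divide_eq_left intro!: e1 e2 e3)
  qed
qed

lemma conv3_wsym: "conv3 (wsym ws)"
proof (induction ws)
  case (Cons x ws)
  show ?case unfolding wsym_Cons by (rule conv3_mult[OF conv3_fsym Cons])
qed (simp add: conv3_id)

text \<open>Of the three special points, 0 is the pole of \<open>MF\<close>, 1 that of
  \<open>NF\<close> with parameter product 1, and -1 that of the inverses of \<open>MF\<close> with
  parameter product 1. Both contours of the theorem are instances; all that enters about their
  position is winding numbers.\<close>

locale separating_contour =
  fixes \<gamma> :: "real \<Rightarrow> complex"
  assumes valid: "valid_path \<gamma>" and closed: "pathfinish \<gamma> = pathstart \<gamma>"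
    and avoids: "path_image \<gamma> \<inter> {0, 1, -1} = {}"
    and winding: "winding_number \<gamma> 0 = 1" "winding_number \<gamma> 1 = 1" "winding_number \<gamma> (-1) = 0"
begin

definition toep :: "(complex \<Rightarrow> complex^3^3) \<Rightarrow> int \<Rightarrow> int \<Rightarrow> complex" where
  "toep X u v = contour_integral \<gamma> (\<lambda>z. ent (X z) z u v / z) / (2 * of_real pi * \<i>)"

lemma integrable: "f holomorphic_on - {0, 1, -1} \<Longrightarrow> f contour_integrable_on \<gamma>"
  by (rule contour_integrable_holomorphic_simple[where S="- {0, 1, -1}"])
     (use valid avoids in \<open>auto simp: open_Compl finite_imp_closed\<close>)

lemma on_path: "z \<in> path_image \<gamma> \<Longrightarrow> z \<noteq> 0 \<and> z \<noteq> 1 \<and> z \<noteq> -1"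
  using avoids by auto

lemma ent_holomorphic: "hol3 S X \<Longrightarrow> 0 \<notin> S \<Longrightarrow> (\<lambda>z. ent (X z) z u v / z) holomorphic_on S"
  by (auto simp: hol3_def ent_def intro!: holomorphic_intros)

lemma toep_cong:
  assumes "\<And>z. z \<notin> {0, 1, -1} \<Longrightarrow> X z = Y z"
  shows "toep X u v = toep Y u v"
  unfolding toep_def
  by (intro arg_cong2[where f="(/)"] refl contour_integral_cong) (use assms on_path in auto)

text \<open>Bandedness of the word keeps the sum finite whatever X is, also when the Toeplitz matrix
  of X is not triangular. This replaces the multiplicativity of Toeplitz matrices.\<close>

lemma toep_mult_wsym:
  assumes X: "hol3 (- {0, 1, -1}) X" and ws: "list_all is_MF ws" "v + int (length ws) \<le> h"
  shows "toep (\<lambda>z. X z ** wsym ws z) u v = (\<Sum>s\<in>{v..h}. toep X u s * wop ws s v)"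
proof -
  have e: "ent (X z ** wsym ws z) z u v / z = (\<Sum>s\<in>{v..h}. ent (X z) z u s / z * wop ws s v)"
    if "z \<noteq> 0" for z
    using that
    by (simp add: ent_eq_row matrix_mult_row vec_row_wsym[OF that ws] sum_distrib_left sum_divide_distrib mult.assoc)
  have "contour_integral \<gamma> (\<lambda>z. ent (X z ** wsym ws z) z u v / z) =
      contour_integral \<gamma> (\<lambda>z. \<Sum>s\<in>{v..h}. ent (X z) z u s / z * wop ws s v)"
    by (rule contour_integral_cong) (use e on_path in auto)
  also have "\<dots> = (\<Sum>s\<in>{v..h}. contour_integral \<gamma> (\<lambda>z. ent (X z) z u s / z * wop ws s v))"
    by (intro contour_integral_sum integrable holomorphic_on_mult holomorphic_on_const
          ent_holomorphic[OF X]) auto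
  also have "\<dots> = (\<Sum>s\<in>{v..h}. contour_integral \<gamma> (\<lambda>z. ent (X z) z u s / z) * wop ws s v)"
    by (intro sum.cong refl contour_integral_rmul integrable ent_holomorphic[OF X]) auto
  finally show ?thesis
    unfolding toep_def by (simp add: sum_divide_distrib)
qed

text \<open>All poles are enclosed, and the negative power of z makes the integrand o(1/z) at
  infinity.\<close>

lemma toep_above:
  assumes X: "hol3 (- {0, 1}) X" "conv3 X" and uv: "u div 3 < v div 3"
  shows "toep X u v = 0"
proof -
  obtain L where L: "\<And>i j. ((\<lambda>z. X z $ i $ j) \<longlongrightarrow> L i j) at_infinity"
    using X(2) unfolding conv3_def by blast
  have "contour_integral \<gamma> (\<lambda>z. ent (X z) z u v / z) = 0"
  proof (rule contour_integral_eq_0_at_infinity[OF valid closed])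
    show "(\<lambda>z. ent (X z) z u v / z) holomorphic_on - {0, 1}"
      by (rule ent_holomorphic[OF X(1)]) auto
    have "((\<lambda>z. ent (X z) z u v) \<longlongrightarrow> L (block_index u) (block_index v) * 0) at_infinity"
      unfolding ent_def using uv by (intro tendsto_intros L tendsto_power_int_at_infinity) auto
    then have "((\<lambda>z. ent (X z) z u v) \<longlongrightarrow> 0) at_infinity" by simp
    moreover have "\<forall>\<^sub>F z in at_infinity. ent (X z) z u v = z * (ent (X z) z u v / z)"
      unfolding eventually_at_infinity by (intro exI[of _ 1]) auto
    ultimately show "((\<lambda>z. z * (ent (X z) z u v / z)) \<longlongrightarrow> 0) at_infinity"
      by (rule Lim_transform_eventually)
  qed (use avoids winding in auto)
  then show ?thesis by (simp add: toep_def)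
qed

text \<open>After cancelling 1/z a nonnegative power of z is left, so the integrand is regular
  inside the contour and Cauchy's theorem applies. X and Y may differ at the three excluded points,
  which the contour avoids.\<close>

lemma toep_below:
  assumes X: "\<And>z. z \<notin> {0, 1, -1} \<Longrightarrow> X z = Y z" and Y: "hol3 (- {-1}) Y" and uv: "v div 3 < u div 3"
  shows "toep X u v = 0"
proof -
  have "contour_integral \<gamma> (\<lambda>z. ent (X z) z u v / z) =
      contour_integral \<gamma> (\<lambda>z. Y z $ block_index u $ block_index v * z ^ nat (u div 3 - v div 3 - 1))"
  proof (rule contour_integral_cong[OF refl])
    fix z assume "z \<in> path_image \<gamma>"
    then have z: "z \<notin> {0, 1, -1}" using on_path by auto
    have "z powi (u div 3 - v div 3) = z powi (u div 3 - v div 3 - 1) * z"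
      using z power_int_add_1[of z "u div 3 - v div 3 - 1"] by simp
    also have "z powi (u div 3 - v div 3 - 1) = z ^ nat (u div 3 - v div 3 - 1)"
      using uv by (simp add: power_int_def)
    finally show "ent (X z) z u v / z = Y z $ block_index u $ block_index v * z ^ nat (u div 3 - v div 3 - 1)"
      using z X[OF z] by (simp add: ent_def)
  qed
  also have "\<dots> = 0"
  proof (rule contour_integral_unique, rule Cauchy_theorem_global[OF _ _ valid closed])
    show "(\<lambda>z. Y z $ block_index u $ block_index v * z ^ nat (u div 3 - v div 3 - 1)) holomorphic_on - {-1}"
      using Y unfolding hol3_def by (intro holomorphic_intros) auto
    show "open (- {-1 :: complex})" by (simp add: open_Compl)
  qed (use avoids winding in auto)
  finally show ?thesis by (simp add: toep_def)
qed

lemma toep_id: "toep (\<lambda>z. Finite_Cartesian_Product.mat 1) u v = (if u = v then 1 else 0)"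
proof -
  consider "u div 3 < v div 3" | "v div 3 < u div 3" | "u div 3 = v div 3" by linarith
  then show ?thesis
  proof cases
    case 1
    then show ?thesis using toep_above[OF hol3_id conv3_id 1] by auto
  next
    case 2
    then show ?thesis using toep_below[OF refl hol3_id 2] by auto
  next
    case 3
    have "contour_integral \<gamma> (\<lambda>z. 1 / (z - 0)) = 2 * of_real pi * \<i> * winding_number \<gamma> 0"
      using has_contour_integral_winding_number[OF valid, of 0] avoids
      by (simp add: contour_integral_unique)
    then have I: "contour_integral \<gamma> (\<lambda>z. 1 / z) = 2 * of_real pi * \<i>" using winding by simp
    show ?thesis
    proof (cases "u = v")
      case True
      then show ?thesis using I
        by (simp add: toep_def ent_def Finite_Cartesian_Product.mat_def)
    next
      case False
      then have "block_index u \<noteq> block_index v"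
        using 3 by (cases u rule: int_mod3_cases; cases v rule: int_mod3_cases) auto
      then show ?thesis using False
        by (simp add: toep_def ent_def Finite_Cartesian_Product.mat_def)
    qed
  qed
qed

text \<open>Such words have poles at 0 and 1 only, both enclosed, so the contour yields the lower
  triangular expansion valid for |z| > 1. Factors are peeled off on the right, where
  \<open>toep_mult_wsym\<close> acts.\<close>

lemma toep_wsym:
  assumes "\<And>a. NF a \<in> set ws \<Longrightarrow> a 0 * a 1 * a 2 = 1"
  shows "toep (wsym ws) u v = wop ws u v"
  using assms
proof (induction ws arbitrary: v rule: rev_induct)
  case Nil
  show ?case using toep_id by (simp add: wop_Nil wsym_def)
next
  case (snoc x ws)
  have IH: "toep (wsym ws) u v = wop ws u v" for v using snoc by auto
  have hol: "hol3 (- {0, 1}) (wsym ys)" if "set ys \<subseteq> set (ws @ [x])" for ys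
  proof (rule hol3_wsym)
    fix a assume "NF a \<in> set ys"
    then have "a 0 * a 1 * a 2 = 1" using snoc.prems[of a] that by auto
    then show "complex_of_real (a 0 * a 1 * a 2) \<notin> - {0, 1}" by (simp only: of_real_1) simp
  qed auto
  have hol': "hol3 (- {0, 1, -1}) (wsym ys)" if "set ys \<subseteq> set (ws @ [x])" for ys
    using hol[OF that] unfolding hol3_def by (auto intro: holomorphic_on_subset[of _ "- {0, 1}"])
  show ?case
  proof (cases x)
    case (MF a)
    have "toep (wsym (ws @ [x])) u v = (\<Sum>s\<in>{v..v+1}. toep (wsym ws) u s * wop [x] s v)"
      unfolding wsym_append[abs_def]
      by (rule toep_mult_wsym) (use hol' MF in \<open>auto simp: is_MF_def\<close>)
    \<comment> \<open>The enlarged range contains both the range given by the band and the one given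
      by triangularity.\<close>
    also have "\<dots> = (\<Sum>s\<in>{v..max u (v+1)}. wop ws u s * wop [x] s v)"
      unfolding IH by (rule sum.mono_neutral_left) (auto simp: MF wop_single)
    also have "\<dots> = (\<Sum>s\<in>{v..u}. wop ws u s * wop [x] s v)"
      by (rule sum.mono_neutral_right) (auto simp: wop_lower)
    finally show ?thesis unfolding wop_append lmul_def .
  next
    case (NF a)
    have a: "a 0 * a 1 * a 2 = 1" using snoc.prems[of a] NF by simp
    define Y where "Y = wsym (ws @ [x])"
    define d where "d v = toep Y u v - wop (ws @ [x]) u v" for v
    \<comment> \<open>Undoing the last factor gives both terms the same recursion in \<open>v\<close>, and both vanish for large \<open>v\<close>.\<close>
    have rec1: "toep Y u v = wop ws u v + of_real (step_wt a (v + 1)) * toep Y u (v + 1)" for v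
    proof -
      have "wop ws u v = toep (\<lambda>z. Y z ** wsym [MF (\<lambda>i. - a i)] z) u v"
        unfolding IH[symmetric]
      proof (rule toep_cong)
        fix z :: complex assume "z \<notin> {0, 1, -1}"
        then have "fsym (NF a) z ** fsym (MF (\<lambda>i. - a i)) z = Finite_Cartesian_Product.mat 1"
          by (intro fsym_inverse) (use a in auto)
        then show "wsym ws z = Y z ** wsym [MF (\<lambda>i. - a i)] z"
          unfolding Y_def NF by (simp add: wsym_append wsym_Cons flip: matrix_mul_assoc del: fsym.simps)
      qed
      also have "\<dots> = (\<Sum>s\<in>{v..v+1}. toep Y u s * wop [MF (\<lambda>i. - a i)] s v)"
        by (rule toep_mult_wsym) (use hol' in \<open>auto simp: is_MF_def Y_def\<close>)
      also have "{v..v+1} = {v, v+1}" by auto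
      finally show ?thesis by (simp add: wop_single step_wt_def)
    qed
    have rec2: "wop (ws @ [x]) u v = wop ws u v + of_real (step_wt a (v + 1)) * wop (ws @ [x]) u (v + 1)" for v
    proof (cases "v \<le> u")
      case True
      have "wop (ws @ [x]) u v = (\<Sum>w\<in>{v..u}. wop ws u w * fop x w v)"
        by (simp add: wop_append lmul_def wop_single_eq_fop)
      also have "{v..u} = insert v {v+1..u}" using True by auto
      also have "(\<Sum>w\<in>\<dots>. wop ws u w * fop x w v) = wop ws u v * fop x v v +
          (\<Sum>w\<in>{v+1..u}. wop ws u w * fop x w v)" by simp
      also have "fop x v v = 1" using period_wt_nonzero[OF a] by (simp add: NF)
      also have "(\<Sum>w\<in>{v+1..u}. wop ws u w * fop x w v) =
          (\<Sum>w\<in>{v+1..u}. of_real (step_wt a (v + 1)) * (wop ws u w * fop x w (v + 1)))"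
        by (intro sum.cong refl) (auto simp: NF fop_NF_step[OF a] simp del: fop.simps)
      finally show ?thesis
        by (simp add: wop_append lmul_def wop_single_eq_fop sum_distrib_left)
    qed (simp add: wop_lower)
    have rec: "d v = of_real (step_wt a (v + 1)) * d (v + 1)" for v
      unfolding d_def using rec1[of v] rec2[of v] by (simp add: right_diff_distrib)
    have big: "d v = 0" if "v \<ge> 3 * (u div 3) + 3" for v
    proof -
      have "u div 3 < v div 3" "u < v" using that by presburger+
      then show ?thesis unfolding d_def Y_def
        using toep_above[OF hol conv3_wsym] by (simp add: wop_lower)
    qed
    have "d v = 0" for v
    proof (cases "v \<le> 3 * (u div 3) + 3")
      case True
      then show ?thesis
      proof (induction v rule: int_le_induct)
        case base
        show ?case by (rule big) simp
      next
        case (step i)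
        then show ?case using rec[of "i - 1"] by simp
      qed
    qed (simp add: big)
    then show ?thesis unfolding d_def Y_def by simp
  qed
qed

text \<open>For k \<ge> 0 the only pole is w and Cauchy's formula applies. For k < 0 the poles 0 and
  w are both enclosed and the integrand decays like z^(k - 1). This dichotomy later cuts sums at the
  top height.\<close>

lemma integral_power_over_linear:
  assumes w: "w \<noteq> 0" "w \<notin> path_image \<gamma>" "winding_number \<gamma> w = 1"
  shows "contour_integral \<gamma> (\<lambda>z. z powi k / (z - w)) = (if k \<ge> 0 then 2 * of_real pi * \<i> * w powi k else 0)"
    and "(\<lambda>z. z powi k / (z - w)) contour_integrable_on \<gamma>"
proof -
  show "(\<lambda>z. z powi k / (z - w)) contour_integrable_on \<gamma>"
    by (rule contour_integrable_holomorphic_simple[where S="- {0, w}"])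
       (use valid avoids w in \<open>auto simp: open_Compl finite_imp_closed intro!: holomorphic_intros\<close>)
  show "contour_integral \<gamma> (\<lambda>z. z powi k / (z - w)) = (if k \<ge> 0 then 2 * of_real pi * \<i> * w powi k else 0)"
  proof (cases "k \<ge> 0")
    case True
    have "((\<lambda>z. z ^ nat k / (z - w)) has_contour_integral
        (2 * of_real pi * \<i> * winding_number \<gamma> w * w ^ nat k)) \<gamma>"
    proof -
      have "(\<lambda>z. z ^ nat k) holomorphic_on UNIV" by (intro holomorphic_intros)
      moreover have "path_image \<gamma> \<subseteq> UNIV - {w}" using w by auto
      ultimately show ?thesis
        using Cauchy_integral_formula_global[of UNIV "\<lambda>z. z ^ nat k" w \<gamma>] valid closed by simp
    qed
    then show ?thesis using True w by (simp add: power_int_def contour_integral_unique)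
  next
    case False
    have "contour_integral \<gamma> (\<lambda>z. z powi k / (z - w)) = 0"
    proof (rule contour_integral_eq_0_at_infinity[OF valid closed, where pts="{0, w}"])
      have "((\<lambda>z. z powi k * (1 / (1 - w * inverse z))) \<longlongrightarrow> 0 * (1 / (1 - w * 0))) at_infinity"
        using False by (intro tendsto_intros tendsto_power_int_at_infinity tendsto_inverse_0) auto
      moreover have "\<forall>\<^sub>F z in at_infinity. z powi k * (1 / (1 - w * inverse z)) = z * (z powi k / (z - w))"
      proof (unfold eventually_at_infinity, intro exI[of _ "norm w + 1"] allI impI)
        fix z :: complex assume z: "norm w + 1 \<le> norm z"
        then have "norm z \<ge> 1" "norm z > norm w" using norm_ge_zero[of w] by linarith+
        then have "z \<noteq> 0" "z \<noteq> w" by auto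
        moreover from this have "1 - w * inverse z = (z - w) / z" by (simp add: field_simps)
        ultimately show "z powi k * (1 / (1 - w * inverse z)) = z * (z powi k / (z - w))" by simp
      qed
      ultimately show "((\<lambda>z. z * (z powi k / (z - w))) \<longlongrightarrow> 0) at_infinity"
        by (auto elim: Lim_transform_eventually)
    qed (use avoids winding w in \<open>auto intro!: holomorphic_intros\<close>)
    then show ?thesis using False by simp
  qed
qed

end

section \<open>The commuting factorization\<close>

abbreviation I3 :: "complex^3^3" where "I3 \<equiv> Finite_Cartesian_Product.mat 1"

definition mpow :: "complex^3^3 \<Rightarrow> nat \<Rightarrow> complex^3^3" where
  "mpow X k = (((**) X) ^^ k) I3"

lemma mpow_0 [simp]: "mpow X 0 = I3" and mpow_Suc: "mpow X (Suc k) = X ** mpow X k"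
  by (simp_all add: mpow_def)

lemma mpow_add: "mpow X (j + k) = mpow X j ** mpow X k"
  by (induction j) (simp_all add: mpow_Suc matrix_mul_assoc)

lemma mpow_commute: "X ** Y = Y ** X \<Longrightarrow> mpow X k ** Y = Y ** mpow X k"
  by (induction k) (simp_all add: mpow_Suc matrix_mul_assoc, metis matrix_mul_assoc)

lemma mpow_commute2: "X ** Y = Y ** X \<Longrightarrow> mpow X j ** mpow Y k = mpow Y k ** mpow X j"
  by (metis mpow_commute)

lemma mpow_mult: "X ** Y = Y ** X \<Longrightarrow> mpow (X ** Y) k = mpow X k ** mpow Y k"
proof (induction k)
  case (Suc k)
  have "mpow (X ** Y) (Suc k) = X ** (Y ** mpow X k) ** mpow Y k"
    using Suc by (simp add: mpow_Suc matrix_mul_assoc)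
  also have "Y ** mpow X k = mpow X k ** Y" using mpow_commute[OF Suc.prems] by simp
  finally show ?case by (simp add: mpow_Suc matrix_mul_assoc)
qed simp

lemma mpow_inverse: "X ** Y = I3 \<Longrightarrow> mpow X k ** mpow Y k = I3"
proof (induction k)
  case (Suc k)
  have "mpow X (Suc k) ** mpow Y (Suc k) = mpow X k ** (X ** Y) ** mpow Y k"
    by (simp add: mpow_Suc matrix_mul_assoc) (metis matrix_mul_assoc mpow_commute)
  then show ?case using Suc by simp
qed simp

lemma matrix_inv_eq:
  assumes "X ** Y = I3" "Y ** X = I3"
  shows "matrix_inv X = Y"
proof -
  have "X ** matrix_inv X = I3 \<and> matrix_inv X ** X = I3"
    unfolding matrix_inv_def by (rule someI[of _ Y]) (use assms in simp)
  then show ?thesis using assms by (metis matrix_mul_assoc matrix_mul_lid matrix_mul_rid)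
qed

lemma matrix_powi_nat: "matrix_powi X (int k) = mpow X k"
  by (simp add: matrix_powi_def mpow_def)

lemma matrix_powi_neg:
  assumes "X ** Y = I3" "Y ** X = I3"
  shows "matrix_powi X (- int k) = mpow Y k"
  by (cases "k = 0") (simp_all add: matrix_powi_def mpow_def matrix_inv_eq[OF assms])

lemma commute_inverse:
  assumes "X ** Y = Y ** X" "X ** X' = I3" "X' ** X = I3"
  shows "X' ** Y = Y ** X'"
  by (metis assms matrix_mul_assoc matrix_mul_lid matrix_mul_rid)

text \<open>Values of the symbols at one point z, primes denoting inverses. The lemmas
  \<open>mpow_ABB\<close>, \<open>mpow_ABA\<close> and \<open>mpow_AP\<close> give, in turn, the
  equation that the rows solve, the symbol that is regular inside the contour, and the symbol of the
  z-integral.\<close>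

locale commuting_pair =
  fixes A B A' B' P P' :: "complex^3^3"
  assumes A: "A ** A' = I3" "A' ** A = I3" and B: "B ** B' = I3" "B' ** B = I3"
    and P: "P ** P' = I3" "P' ** P = I3"
    and AB: "A ** B = P" and BA: "B ** A = P"
begin

lemma comm: "A ** B = B ** A" "A' ** B = B ** A'" "A ** B' = B' ** A" "A' ** B' = B' ** A'"
proof -
  show 1: "A ** B = B ** A" using AB BA by simp
  show 2: "A' ** B = B ** A'" by (rule commute_inverse[OF 1 A])
  show 3: "A ** B' = B' ** A" by (rule commute_inverse[OF 1[symmetric] B, symmetric])
  show "A' ** B' = B' ** A'" by (rule commute_inverse[OF 3 A])
qed

lemma P'_eq: "P' = B' ** A'"
proof -
  have "P ** (B' ** A') = I3"
    using A B AB by (metis matrix_mul_assoc matrix_mul_rid)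
  then show ?thesis using P by (metis matrix_mul_assoc matrix_mul_lid matrix_mul_rid)
qed

lemma mpow_P: "mpow P k = mpow A k ** mpow B k"
  using mpow_mult[OF comm(1)] AB by simp

lemma mpow_ABB:
  assumes "k \<le> n"
  shows "mpow A (n - k) ** mpow B' k ** mpow B n = mpow P (n - k)"
proof -
  have "mpow B n = mpow B k ** mpow B (n - k)" using assms mpow_add[of B k "n - k"] by simp
  then have "mpow A (n - k) ** mpow B' k ** mpow B n =
      mpow A (n - k) ** (mpow B' k ** mpow B k) ** mpow B (n - k)"
    by (simp add: matrix_mul_assoc)
  then show ?thesis using mpow_inverse[OF B(2)] by (simp add: mpow_P)
qed

lemma mpow_ABA:
  assumes "k \<le> n"
  shows "mpow A (n - k) ** mpow B' k ** mpow A' n = mpow P' k"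
proof -
  have "mpow A' n = mpow A' (n - k) ** mpow A' k" using assms mpow_add[of A' "n - k" k] by simp
  then have "mpow A (n - k) ** mpow B' k ** mpow A' n =
      mpow B' k ** (mpow A (n - k) ** mpow A' (n - k)) ** mpow A' k"
    using mpow_commute2[OF comm(3), of "n - k" k] by (simp add: matrix_mul_assoc)
  also have "\<dots> = mpow B' k ** mpow A' k" using mpow_inverse[OF A(1)] by simp
  also have "\<dots> = mpow P' k" using mpow_mult[OF comm(4)[symmetric]] by (simp add: P'_eq)
  finally show ?thesis .
qed

lemma mpow_AP:
  assumes "k \<le> n"
  shows "mpow A' n ** mpow P k = mpow A' (n - k) ** mpow B k"
proof -
  have "mpow A' n = mpow A' (n - k) ** mpow A' k" using assms mpow_add[of A' "n - k" k] by simp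
  then have "mpow A' n ** mpow P k = mpow A' (n - k) ** (mpow A' k ** mpow A k) ** mpow B k"
    by (simp add: mpow_P matrix_mul_assoc)
  then show ?thesis using mpow_inverse[OF A(2)] by simp
qed

end

text \<open>The number a for which the symbol has determinant 1 + a/z (\<open>MF\<close>) or 1 / (1
  - a/z) (\<open>NF\<close>). It locates poles: \<open>NF\<close> has one at a, and the inverse of
  \<open>MF\<close> has one at -a.\<close>

primrec fdet :: "factor \<Rightarrow> real" where
  "fdet (MF a) = a 0 * a 1 * a 2" | "fdet (NF a) = a 0 * a 1 * a 2"

primrec finv :: "factor \<Rightarrow> factor" where
  "finv (MF a) = NF (\<lambda>i. - a i)" | "finv (NF a) = MF (\<lambda>i. - a i)"

definition winv :: "factor list \<Rightarrow> factor list" where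
  "winv ws = rev (map finv ws)"

definition wpow :: "factor list \<Rightarrow> nat \<Rightarrow> factor list" where
  "wpow ws k = concat (replicate k ws)"

lemma fdet_finv: "fdet (finv x) = - fdet x" by (cases x) simp_all

lemma wsym_wpow: "wsym (wpow ws k) z = mpow (wsym ws z) k"
  by (induction k) (simp_all add: wpow_def wsym_append mpow_Suc)

lemma set_wpow: "set (wpow ws k) \<subseteq> set ws"
  by (auto simp: wpow_def)

lemma length_wpow: "length (wpow ws k) = k * length ws"
  by (induction k) (simp_all add: wpow_def)

lemma finv_inverse:
  assumes "z \<notin> {0, 1, -1}" "fdet x \<in> {1, -1}"
  shows "fsym x z ** fsym (finv x) z = I3" "fsym (finv x) z ** fsym x z = I3"
proof -
  have inv: "fsym (NF a) z ** fsym (MF (\<lambda>i. - a i)) z = I3"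
    "fsym (MF (\<lambda>i. - a i)) z ** fsym (NF a) z = I3" if "a 0 * a 1 * a 2 \<in> {1, -1}" for a
  proof -
    have "z \<noteq> complex_of_real (a 0 * a 1 * a 2)"
      using that assms(1) by (elim insertE) (simp_all only: of_real_minus of_real_1, auto)
    then show "fsym (NF a) z ** fsym (MF (\<lambda>i. - a i)) z = I3"
      "fsym (MF (\<lambda>i. - a i)) z ** fsym (NF a) z = I3"
      using fsym_inverse[of z a] assms(1) by auto
  qed
  show "fsym x z ** fsym (finv x) z = I3" "fsym (finv x) z ** fsym x z = I3"
    using assms(2) inv inv[of "\<lambda>i. - a i" for a]
    by (cases x; force simp del: fsym.simps)+
qed

lemma winv_inverse:
  assumes z: "z \<notin> {0, 1, -1}" and "\<And>x. x \<in> set ws \<Longrightarrow> fdet x \<in> {1, -1}"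
  shows "wsym ws z ** wsym (winv ws) z = I3" "wsym (winv ws) z ** wsym ws z = I3"
proof -
  have "wsym ws z ** wsym (winv ws) z = I3 \<and> wsym (winv ws) z ** wsym ws z = I3"
    using assms(2)
  proof (induction ws)
    case (Cons x ws)
    have x: "fsym x z ** fsym (finv x) z = I3" "fsym (finv x) z ** fsym x z = I3"
      using finv_inverse[OF z] Cons.prems by auto
    have IH: "wsym ws z ** wsym (winv ws) z = I3" "wsym (winv ws) z ** wsym ws z = I3"
      using Cons by auto
    have e: "wsym (winv (x # ws)) z = wsym (winv ws) z ** fsym (finv x) z"
      by (simp add: winv_def wsym_append wsym_Cons)
    have "wsym (x # ws) z ** wsym (winv (x # ws)) z =
        fsym x z ** (wsym ws z ** wsym (winv ws) z) ** fsym (finv x) z"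
      unfolding e wsym_Cons by (simp add: matrix_mul_assoc)
    moreover have "wsym (winv (x # ws)) z ** wsym (x # ws) z =
        wsym (winv ws) z ** (fsym (finv x) z ** fsym x z) ** wsym ws z"
      unfolding e wsym_Cons by (simp add: matrix_mul_assoc)
    ultimately show ?case by (simp add: IH x)
  qed (simp add: winv_def)
  then show "wsym ws z ** wsym (winv ws) z = I3" "wsym (winv ws) z ** wsym ws z = I3" by auto
qed

section \<open>The exchange of neighbouring factors\<close>

definition cyc :: "(nat \<Rightarrow> real) \<Rightarrow> (nat \<Rightarrow> real) \<Rightarrow> nat \<Rightarrow> real" where
  "cyc c a = (\<lambda>i. if i = 0 then a 2 * c 0 else if i = 1 then a 0 * c 1 else a 1 * c 2)"

text \<open>The linear part of the exchange relation; the quadratic part holds by itself because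
  both parameter triples are rescaled by the same c.\<close>

definition balanced :: "(nat \<Rightarrow> real) \<Rightarrow> (nat \<Rightarrow> real) \<Rightarrow> (nat \<Rightarrow> real) \<Rightarrow> bool" where
  "balanced c a b \<longleftrightarrow> c 0 * (a 2 + b 2) = a 0 + b 0 \<and> c 1 * (a 0 + b 0) = a 1 + b 1 \<and>
     c 2 * (a 1 + b 1) = a 2 + b 2"

lemma balanced_sym: "balanced c a b \<Longrightarrow> balanced c b a"
  by (simp add: balanced_def add.commute)

text \<open>The shift preserves the sums a_i + b_i, on which alone the condition depends, so the
  same c serves in all later exchanges.\<close>

lemma balanced_cyc: "balanced c a b \<Longrightarrow> balanced c (cyc c a) (cyc c b)"
proof -
  assume h: "balanced c a b"
  have "cyc c a 0 + cyc c b 0 = a 0 + b 0" "cyc c a 1 + cyc c b 1 = a 1 + b 1"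
    "cyc c a 2 + cyc c b 2 = a 2 + b 2"
    using h by (simp_all add: cyc_def balanced_def algebra_simps)
  then show ?thesis using h by (simp add: balanced_def)
qed

lemma cyc_prod:
  assumes "c 0 * c 1 * c 2 = 1"
  shows "cyc c a 0 * cyc c a 1 * cyc c a 2 = a 0 * a 1 * a 2"
proof -
  have "cyc c a 0 * cyc c a 1 * cyc c a 2 = a 0 * a 1 * a 2 * (c 0 * c 1 * c 2)"
    by (simp add: cyc_def)
  then show ?thesis using assms by simp
qed

lemma cyc_cube:
  assumes "c 0 * c 1 * c 2 = 1"
  shows "cyc c (cyc c (cyc c a)) 0 = a 0" "cyc c (cyc c (cyc c a)) 1 = a 1" "cyc c (cyc c (cyc c a)) 2 = a 2"
proof -
  have "cyc c (cyc c (cyc c a)) 0 = a 0 * (c 0 * c 1 * c 2)"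
    "cyc c (cyc c (cyc c a)) 1 = a 1 * (c 0 * c 1 * c 2)"
    "cyc c (cyc c (cyc c a)) 2 = a 2 * (c 0 * c 1 * c 2)"
    by (simp_all add: cyc_def)
  then show "cyc c (cyc c (cyc c a)) 0 = a 0" "cyc c (cyc c (cyc c a)) 1 = a 1" "cyc c (cyc c (cyc c a)) 2 = a 2"
    using assms by simp_all
qed

lemma MF_MF_swap:
  assumes "balanced c a b"
  shows "fsym (MF (\<lambda>i. - cyc c b i)) z ** fsym (MF a) z = fsym (MF (cyc c a)) z ** fsym (MF (\<lambda>i. - b i)) z"
proof -
  have r: "a 0 - b 2 * c 0 = a 2 * c 0 - b 0" "a 1 - b 0 * c 1 = a 0 * c 1 - b 1"
    "a 2 - b 1 * c 2 = a 1 * c 2 - b 2"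
    using assms by (simp_all add: balanced_def algebra_simps)
  have h: "complex_of_real (a 0) - of_real (b 2) * of_real (c 0) = of_real (a 2) * of_real (c 0) - of_real (b 0)"
    "complex_of_real (a 1) - of_real (b 0) * of_real (c 1) = of_real (a 0) * of_real (c 1) - of_real (b 1)"
    "complex_of_real (a 2) - of_real (b 1) * of_real (c 2) = of_real (a 1) * of_real (c 2) - of_real (b 2)"
    unfolding of_real_mult[symmetric] of_real_diff[symmetric] r by simp_all
  have h2: "complex_of_real (a 2) / z - of_real (b 1) * of_real (c 2) / z =
      of_real (a 1) * of_real (c 2) / z - of_real (b 2) / z"
    unfolding diff_divide_distrib[symmetric] h ..
  show ?thesis
    unfolding Finite_Cartesian_Product.vec_eq_iff forall_3 fsym.simps
    by (simp add: matrix_matrix_mult_def sum_3 M_d_def cyc_def del: One_nat_def)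
       (intro conjI h h2)
qed

text \<open>This is \<open>MF_MF_swap\<close> freed of its negated factors by multiplying with their
  inverses \<open>NF\<close> on both sides. Moving an \<open>NF\<close> to the left applies the
  shift to both parameter triples.\<close>

lemma NF_MF_swap:
  assumes z: "z \<notin> {0, 1, -1}" and c: "c 0 * c 1 * c 2 = 1" and ab: "balanced c a b"
    and b: "b 0 * b 1 * b 2 = 1"
  shows "fsym (NF (cyc c b)) z ** fsym (MF (cyc c a)) z = fsym (MF a) z ** fsym (NF b) z"
proof -
  let ?X = "fsym (MF (\<lambda>i. - cyc c b i)) z" and ?Y = "fsym (MF (\<lambda>i. - b i)) z"
  have X: "fsym (NF (cyc c b)) z ** ?X = I3"
    using finv_inverse(1)[OF z, of "NF (cyc c b)"] cyc_prod[of c b, OF c] b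
    by (simp del: fsym.simps One_nat_def)
  have Y: "?Y ** fsym (NF b) z = I3"
    using finv_inverse(2)[OF z, of "NF b"] b by (simp del: fsym.simps One_nat_def)
  have "fsym (NF (cyc c b)) z ** (fsym (MF (cyc c a)) z ** ?Y) ** fsym (NF b) z =
     (fsym (NF (cyc c b)) z ** ?X) ** (fsym (MF a) z ** fsym (NF b) z)"
    by (simp add: MF_MF_swap[OF ab, symmetric] matrix_mul_assoc del: fsym.simps)
  also have "fsym (NF (cyc c b)) z ** (fsym (MF (cyc c a)) z ** ?Y) ** fsym (NF b) z =
     fsym (NF (cyc c b)) z ** fsym (MF (cyc c a)) z ** (?Y ** fsym (NF b) z)"
    by (simp add: matrix_mul_assoc del: fsym.simps)
  finally show ?thesis by (simp only: X Y matrix_mul_lid matrix_mul_rid)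
qed

text \<open>The inverse of \<open>NF b\<close> is 1 - L and \<open>MF b\<close> is 1 + L for the
  same weighted shift L.\<close>

lemma NF_MF_commute:
  assumes z: "z \<notin> {0, 1, -1}" and b: "b 0 * b 1 * b 2 = 1"
  shows "fsym (NF b) z ** fsym (MF b) z = fsym (MF b) z ** fsym (NF b) z"
proof -
  let ?Y = "fsym (MF (\<lambda>i. - b i)) z"
  have Y: "?Y ** fsym (NF b) z = I3" "fsym (NF b) z ** ?Y = I3"
    using finv_inverse[OF z, of "NF b"] b by (simp_all del: fsym.simps One_nat_def)
  have "?Y ** fsym (MF b) z = fsym (MF b) z ** ?Y"
    unfolding Finite_Cartesian_Product.vec_eq_iff forall_3 fsym.simps
    by (simp add: matrix_matrix_mult_def sum_3 M_d_def mult.commute del: One_nat_def)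
  then show ?thesis by (rule commute_inverse[OF _ Y])
qed

lemma fsym_cyc_cube:
  assumes "c 0 * c 1 * c 2 = 1"
  shows "fsym (MF (cyc c (cyc c (cyc c a)))) z = fsym (MF a) z"
    "fsym (NF (cyc c (cyc c (cyc c a)))) z = fsym (NF a) z"
  unfolding fsym.simps cyc_cube[OF assms] by simp_all

definition A_word :: "(nat \<Rightarrow> real) \<Rightarrow> (nat \<Rightarrow> real) \<Rightarrow> (nat \<Rightarrow> real) \<Rightarrow> factor list" where
  "A_word c a b = [NF a, NF (cyc c b), NF (cyc c a), NF (cyc c (cyc c b)), NF (cyc c (cyc c a)), NF b]"

definition B_word :: "(nat \<Rightarrow> real) \<Rightarrow> (nat \<Rightarrow> real) \<Rightarrow> (nat \<Rightarrow> real) \<Rightarrow> factor list" where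
  "B_word c a b = [MF a, MF (cyc c (cyc c b)), MF (cyc c (cyc c a)), MF (cyc c b), MF (cyc c a), MF b]"

definition P_word :: "(nat \<Rightarrow> real) \<Rightarrow> (nat \<Rightarrow> real) \<Rightarrow> factor list" where
  "P_word a b = concat (replicate 3 [MF a, NF a, MF b, NF b])"

text \<open>Both factorizations sort the alternating word by moving the factors \<open>NF\<close> to one side; a factor
  \<open>MF\<close> and a factor \<open>NF\<close> with the same parameters commute, and otherwise they are exchanged with
  a cyclic shift of their parameters.\<close>

lemma P_word_factorization:
  assumes z: "z \<notin> {0, 1, -1}" and c: "c 0 * c 1 * c 2 = 1" and ab: "balanced c a b"
    and a: "a 0 * a 1 * a 2 = 1" and b: "b 0 * b 1 * b 2 = 1"
  shows "wsym (A_word c a b) z ** wsym (B_word c a b) z = wsym (P_word a b) z"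
    and "wsym (B_word c a b) z ** wsym (A_word c a b) z = wsym (P_word a b) z"
proof -
  note ba = balanced_sym[OF ab]
  note ab1 = balanced_cyc[OF ab] and ba1 = balanced_cyc[OF ba]
  note ab2 = balanced_cyc[OF ab1] and ba2 = balanced_cyc[OF ba1]
  have a1: "cyc c a 0 * cyc c a 1 * cyc c a 2 = 1" and b1: "cyc c b 0 * cyc c b 1 * cyc c b 2 = 1"
    by (simp_all only: cyc_prod[OF c] a b)
  have a2: "cyc c (cyc c a) 0 * cyc c (cyc c a) 1 * cyc c (cyc c a) 2 = 1"
    and b2: "cyc c (cyc c b) 0 * cyc c (cyc c b) 1 * cyc c (cyc c b) 2 = 1"
    by (simp_all only: cyc_prod[OF c] a b)
  \<comment> \<open>Two orders of the pair at three shift levels; at the last level a third shift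
    restores the original parameters, so the list is closed under further exchanges.\<close>
  note sw = NF_MF_swap[OF z c ab b] NF_MF_swap[OF z c ba a] NF_MF_swap[OF z c ab1 b1]
    NF_MF_swap[OF z c ba1 a1] NF_MF_swap[OF z c ab2 b2, unfolded fsym_cyc_cube[OF c]]
    NF_MF_swap[OF z c ba2 a2, unfolded fsym_cyc_cube[OF c]]
    NF_MF_commute[OF z a] NF_MF_commute[OF z b] NF_MF_commute[OF z a1] NF_MF_commute[OF z b1]
    NF_MF_commute[OF z a2] NF_MF_commute[OF z b2]
  have ext: "X ** Y = Z ** U \<Longrightarrow> X ** (Y ** V) = Z ** (U ** V)" for X Y Z U V :: "complex^3^3"
    by (simp add: matrix_mul_assoc)
  \<comment> \<open>\<open>swx\<close> moves \<open>NF\<close> to the right and \<open>swy\<close>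
    moves it to the left. Each rewrite removes one inversion, so the alternating word is sorted in
    either direction.\<close>
  note swx = sw[THEN ext] and swy = sw[symmetric, THEN ext]
  have P: "wsym (P_word a b) z = fsym (MF a) z ** (fsym (NF a) z ** (fsym (MF b) z ** (fsym (NF b) z **
     (fsym (MF a) z ** (fsym (NF a) z ** (fsym (MF b) z ** (fsym (NF b) z **
     (fsym (MF a) z ** (fsym (NF a) z ** (fsym (MF b) z ** (fsym (NF b) z ** I3)))))))))))"
    by (simp add: P_word_def wsym_Cons numeral_3_eq_3 del: fsym.simps)
  show "wsym (A_word c a b) z ** wsym (B_word c a b) z = wsym (P_word a b) z"
    unfolding wsym_append[symmetric] A_word_def B_word_def P
    by (simp only: append.simps wsym_Cons wsym_Nil swy)
  show "wsym (B_word c a b) z ** wsym (A_word c a b) z = wsym (P_word a b) z"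
    unfolding wsym_append[symmetric] A_word_def B_word_def P
    by (simp only: append.simps wsym_Cons wsym_Nil swx)
qed

section \<open>The inverse Toeplitz matrix and the double integral\<close>

text \<open>Agreement is asked only off 0, 1, -1, because at the poles of the single factors the
  product takes the default values of division.\<close>

definition regular_inside :: "(complex \<Rightarrow> complex^3^3) \<Rightarrow> bool" where
  "regular_inside X \<longleftrightarrow> (\<exists>Y. hol3 (- {-1}) Y \<and> (\<forall>z. z \<notin> {0, 1, -1} \<longrightarrow> X z = Y z))"

lemma regular_inside_mult:
  "regular_inside X \<Longrightarrow> regular_inside Y \<Longrightarrow> regular_inside (\<lambda>z. X z ** Y z)"
proof -
  assume "regular_inside X" "regular_inside Y"
  then obtain X' Y' where "hol3 (- {-1}) X'" "hol3 (- {-1}) Y'"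
    "\<And>z. z \<notin> {0, 1, -1} \<Longrightarrow> X z = X' z" "\<And>z. z \<notin> {0, 1, -1} \<Longrightarrow> Y z = Y' z"
    unfolding regular_inside_def by metis
  then show ?thesis unfolding regular_inside_def
    by (intro exI[of _ "\<lambda>z. X' z ** Y' z"]) (auto intro: hol3_mult)
qed

lemma regular_inside_id: "regular_inside (\<lambda>z. I3)"
  unfolding regular_inside_def using hol3_id by blast

lemma regular_inside_mpow: "regular_inside X \<Longrightarrow> regular_inside (\<lambda>z. mpow (X z) k)"
  by (induction k) (auto simp: mpow_Suc regular_inside_id intro: regular_inside_mult)

text \<open>Neither factor below is regular at \<open>0\<close> and \<open>1\<close>, but their product is \<open>2 N - 1\<close>, where \<open>N\<close> is
  the second factor, whose only pole is \<open>-1\<close>.\<close>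

lemma regular_inside_pair:
  assumes b: "b 0 * b 1 * b 2 = 1"
  shows "regular_inside (\<lambda>z. fsym (MF (\<lambda>i. - b i)) z ** fsym (NF (\<lambda>i. - b i)) z)"
proof -
  \<comment> \<open>The prefactor of the inverse of \<open>MF b\<close> is written as z / (z + 1);
    its z absorbs the entries with 1/z, so no pole at 0 remains.\<close>
  define Y :: "complex \<Rightarrow> complex^3^3" where "Y z = (\<chi> i j. 2 * ((vector
      [vector [z, of_real (b 1 * b 2), - of_real (b 2)],
       vector [- of_real (b 0) * z, z, of_real (b 0 * b 2)],
       vector [of_real (b 0 * b 1) * z, - of_real (b 1) * z, z]] :: complex^3^3) $ i $ j / (z + 1)) - I3 $ i $ j)" for z
  have "hol3 (- {-1}) Y"
    unfolding hol3_def forall_3 Y_def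
    by (auto simp: Finite_Cartesian_Product.mat_def add_eq_0_iff2 intro!: holomorphic_intros)
  moreover have "fsym (MF (\<lambda>i. - b i)) z ** fsym (NF (\<lambda>i. - b i)) z = Y z" if z: "z \<notin> {0, 1, -1}" for z
  proof -
    let ?N = "fsym (NF (\<lambda>i. - b i)) z"
    have nz: "z \<noteq> 0" "z + 1 \<noteq> 0" using z by (auto simp: add_eq_0_iff2)
    have rb: "(- b 0) * (- b 1) * (- b 2) = -1" using b by simp
    have bc: "complex_of_real ((- b 0) * (- b 1) * (- b 2)) = -1"
      unfolding rb by simp
    have two: "(fsym (MF (\<lambda>i. - b i)) z ** N) $ i $ j = 2 * N $ i $ j - (fsym (MF b) z ** N) $ i $ j"
      for N :: "complex^3^3" and i j
    proof -
      have "\<forall>i. (fsym (MF (\<lambda>i. - b i)) z ** N) $ i $ j = 2 * N $ i $ j - (fsym (MF b) z ** N) $ i $ j"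
        unfolding forall_3 by (simp add: matrix_matrix_mult_def sum_3 M_d_def del: One_nat_def)
      then show ?thesis by blast
    qed
    have "fsym (MF b) z ** ?N = I3"
      using finv_inverse(2)[OF z, of "NF (\<lambda>i. - b i)"] b by (simp del: fsym.simps One_nat_def)
    moreover have "\<forall>i j. 2 * ?N $ i $ j - I3 $ i $ j = Y z $ i $ j"
      unfolding forall_3 fsym.simps N_d_def bc Y_def
      using nz by (simp add: field_simps del: One_nat_def)
    ultimately show ?thesis
      unfolding Finite_Cartesian_Product.vec_eq_iff two by simp
  qed
  ultimately show ?thesis unfolding regular_inside_def by blast
qed

text \<open>Inversion reverses the word, so the inverse of each \<open>NF\<close> stands directly to
  the left of the inverse of the \<open>MF\<close> with the same parameters, and the word is a
  product of regular pairs.\<close>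

lemma regular_inside_winv_P_word:
  assumes a: "a 0 * a 1 * a 2 = 1" and b: "b 0 * b 1 * b 2 = 1"
  shows "regular_inside (wsym (winv (P_word a b)))"
proof -
  have "winv (P_word a b) = concat (replicate 3
      [MF (\<lambda>i. - b i), NF (\<lambda>i. - b i), MF (\<lambda>i. - a i), NF (\<lambda>i. - a i)])"
    by (simp add: winv_def P_word_def numeral_3_eq_3)
  then have "wsym (winv (P_word a b)) = (\<lambda>z. mpow (wsym [MF (\<lambda>i. - b i), NF (\<lambda>i. - b i),
      MF (\<lambda>i. - a i), NF (\<lambda>i. - a i)] z) 3)"
    by (auto simp: wsym_wpow[symmetric] wpow_def)
  moreover have "regular_inside (wsym [MF (\<lambda>i. - b i), NF (\<lambda>i. - b i), MF (\<lambda>i. - a i), NF (\<lambda>i. - a i)])"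
    using regular_inside_mult[OF regular_inside_pair[of b, OF b] regular_inside_pair[of a, OF a]]
    by (simp add: wsym_Cons[abs_def] wsym_def matrix_mul_assoc del: fsym.simps)
  ultimately show ?thesis by (simp add: regular_inside_mpow)
qed

lemma int_less_div3: "y < 0 \<Longrightarrow> 0 \<le> u \<Longrightarrow> y div 3 < u div (3::int)"
  by presburger

text \<open>Because of the cut at h the row in y is not a Toeplitz row near the top. Below height 0,
  however, the cut is not felt and the coefficients of the regular symbol E vanish, so the sum over
  y may be extended downwards. After that \<open>Ai\<close> and \<open>W\<close> are triangular and
  can be multiplied first.\<close>

lemma (in separating_contour) inverse_row:
  assumes S: "hol3 (- {0, 1, -1}) S" and Ai: "list_all is_MF Ai" and Q: "list_all is_MF Q"
    and W: "\<And>a. NF a \<in> set W \<Longrightarrow> a 0 * a 1 * a 2 = 1"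
    and eq: "\<And>z. z \<notin> {0, 1, -1} \<Longrightarrow> wsym Ai z ** wsym W z = wsym Q z"
    and inner: "\<And>z. z \<notin> {0, 1, -1} \<Longrightarrow> S z ** wsym Ai z = E z" "regular_inside E"
    and h: "int (length Ai) \<le> h + 1" and u: "0 \<le> u"
  shows "(\<Sum>y\<in>{0..h}. (\<Sum>s\<in>{y..h}. toep S u s * wop Ai s y) * wop W y x) =
    (\<Sum>s\<in>{x..h}. toep S u s * wop Q s x)"
proof -
  define \<beta> where "\<beta> y = (\<Sum>s\<in>{y..h}. toep S u s * wop Ai s y)" for y
  obtain Y where Y: "hol3 (- {-1}) Y" "\<And>z. z \<notin> {0, 1, -1} \<Longrightarrow> E z = Y z"
    using inner(2) unfolding regular_inside_def by blast
  have \<beta>0: "\<beta> y = 0" if "y < 0" for y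
  proof -
    \<comment> \<open>For y \<le> -1 the band above y ends at or below h, since its length is at
      most h + 1.\<close>
    have "\<beta> y = toep (\<lambda>z. S z ** wsym Ai z) u y"
      unfolding \<beta>_def by (rule toep_mult_wsym[OF S Ai, symmetric]) (use that h in simp)
    also have "\<dots> = 0"
      by (rule toep_below[where Y=Y]) (use Y inner(1) u that in \<open>auto intro: int_less_div3\<close>)
    finally show ?thesis .
  qed
  \<comment> \<open>The two triangular matrices are compared through their contour coefficients,
    which see the symbols only on the contour.\<close>
  have QW: "lmul (wop Ai) (wop W) = wop Q"
  proof (intro ext)
    fix s x
    have 1: "NF a \<notin> set Ai" "NF a \<notin> set Q" for a
      using Ai Q by (auto simp: list_all_iff is_MF_def)
    have "lmul (wop Ai) (wop W) s x = toep (wsym (Ai @ W)) s x"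
      unfolding wop_append[symmetric] by (rule toep_wsym[symmetric]) (use 1 W in auto)
    also have "\<dots> = toep (wsym Q) s x"
      by (rule toep_cong) (simp add: wsym_append eq)
    also have "\<dots> = wop Q s x" by (rule toep_wsym) (use 1 in auto)
    finally show "lmul (wop Ai) (wop W) s x = wop Q s x" .
  qed
  have "(\<Sum>y\<in>{0..h}. \<beta> y * wop W y x) = (\<Sum>y\<in>{min 0 x..h}. \<beta> y * wop W y x)"
    by (rule sum.mono_neutral_left) (auto simp: \<beta>0)
  also have "\<dots> = (\<Sum>y\<in>{x..h}. \<beta> y * wop W y x)"
    by (rule sum.mono_neutral_right) (auto simp: wop_lower)
  also have "\<dots> = (\<Sum>y\<in>{x..h}. \<Sum>s\<in>{y..h}. toep S u s * wop Ai s y * wop W y x)"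
    by (simp add: \<beta>_def sum_distrib_right)
  also have "\<dots> = (\<Sum>s\<in>{x..h}. \<Sum>y\<in>{x..s}. toep S u s * wop Ai s y * wop W y x)"
  proof -
    have "(\<Sum>y\<in>{x..h}. \<Sum>s\<in>{y..h}. toep S u s * wop Ai s y * wop W y x) =
        (\<Sum>p\<in>Sigma {x..h} (\<lambda>y. {y..h}). toep S u (snd p) * wop Ai (snd p) (fst p) * wop W (fst p) x)"
      by (subst sum.Sigma) (auto simp: case_prod_unfold)
    also have "\<dots> = (\<Sum>p\<in>Sigma {x..h} (\<lambda>s. {x..s}). toep S u (fst p) * wop Ai (fst p) (snd p) * wop W (snd p) x)"
      by (rule sum.reindex_bij_witness[where i="\<lambda>p. (snd p, fst p)" and j="\<lambda>p. (snd p, fst p)"]) auto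
    also have "\<dots> = (\<Sum>s\<in>{x..h}. \<Sum>y\<in>{x..s}. toep S u s * wop Ai s y * wop W y x)"
      by (subst sum.Sigma) (auto simp: case_prod_unfold)
    finally show ?thesis .
  qed
  also have "\<dots> = (\<Sum>s\<in>{x..h}. toep S u s * lmul (wop Ai) (wop W) s x)"
    by (simp add: lmul_def sum_distrib_left mult.assoc)
  finally show ?thesis unfolding QW \<beta>_def .
qed

lemma (in separating_contour) toep_shift: "toep X (u + 3 * k) (v + 3 * k) = toep X u v"
proof -
  have "(u + 3 * k) div 3 = u div 3 + k" "(v + 3 * k) div 3 = v div 3 + k"
    "(u + 3 * k) mod 3 = u mod 3" "(v + 3 * k) mod 3 = v mod 3" by presburger+
  then show ?thesis unfolding toep_def ent_def block_index_def by simp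
qed

text \<open>The banded symbol Q is expanded in powers of z. The inner integral returns the power at
  w if the exponent is nonnegative and 0 otherwise, so 1 / (z - w) acts as a cut of the sum at
  height -1; what remains in w are Toeplitz coefficients of S.\<close>

theorem double_contour_integral:
  assumes i: "separating_contour \<gamma>" and e: "separating_contour \<gamma>'"
    and sep: "\<And>w. w \<in> path_image \<gamma> \<Longrightarrow> w \<notin> path_image \<gamma>' \<and> winding_number \<gamma>' w = 1"
    and S: "hol3 (- {0, 1, -1}) S" and Q: "list_all is_MF Q"
  shows "1 / (2 * of_real pi * \<i>)\<^sup>2 * contour_integral \<gamma> (\<lambda>w. contour_integral \<gamma>' (\<lambda>z.
      (S w ** wsym Q z) $ block_index u $ block_index v *
      (w powi (u div 3) / z powi (v div 3 + 1)) / (z - w))) =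
    (\<Sum>s\<in>{v..-1}. separating_contour.toep \<gamma> S u s * wop Q s v)"
proof -
  interpret i: separating_contour \<gamma> by (rule i)
  interpret e: separating_contour \<gamma>' by (rule e)
  \<comment> \<open>Large enough for the band of Q and for the range up to -1 that survives.\<close>
  define h where "h = max (v + int (length Q)) (-1)"
  let ?c = "2 * complex_of_real pi * \<i>"
  have inner: "contour_integral \<gamma>' (\<lambda>z. (S w ** wsym Q z) $ block_index u $ block_index v *
      (w powi (u div 3) / z powi (v div 3 + 1)) / (z - w)) =
      (\<Sum>s\<in>{v..-1}. (?c * wop Q s v) * (ent (S w) w u s / w))"
    if w: "w \<in> path_image \<gamma>" for w
  proof -
    have w0: "w \<noteq> 0" using i.on_path[OF w] by simp
    note wi = w0 conjunct1[OF sep[OF w]] conjunct2[OF sep[OF w]]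
    define b where "b s = w powi (u div 3) * S w $ block_index u $ block_index s * wop Q s v" for s
    have "contour_integral \<gamma>' (\<lambda>z. (S w ** wsym Q z) $ block_index u $ block_index v *
      (w powi (u div 3) / z powi (v div 3 + 1)) / (z - w)) =
      contour_integral \<gamma>' (\<lambda>z. \<Sum>s\<in>{v..h}. b s * (z powi (- (s div 3) - 1) / (z - w)))"
    proof (rule contour_integral_cong[OF refl])
      fix z assume "z \<in> path_image \<gamma>'"
      then have z: "z \<noteq> 0" using e.on_path by simp
      have "(S w ** wsym Q z) $ block_index u $ block_index v / z powi (v div 3 + 1) =
          vec_row (S w $ block_index u v* wsym Q z) z v / z"
        using z by (simp add: matrix_mult_row vec_row_def power_int_add power_int_minus field_simps)
      also have "\<dots> = (\<Sum>s\<in>{v..h}. vec_row (S w $ block_index u) z s / z * wop Q s v)"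
        by (subst vec_row_wsym[OF z Q, of _ h]) (auto simp: h_def sum_divide_distrib)
      also have "\<dots> = (\<Sum>s\<in>{v..h}. S w $ block_index u $ block_index s * wop Q s v * z powi (- (s div 3) - 1))"
        using z by (simp add: vec_row_def power_int_diff mult_ac)
      finally have *: "(S w ** wsym Q z) $ block_index u $ block_index v / z powi (v div 3 + 1) = \<dots>" .
      have "(S w ** wsym Q z) $ block_index u $ block_index v *
        (w powi (u div 3) / z powi (v div 3 + 1)) / (z - w) =
        (S w ** wsym Q z) $ block_index u $ block_index v / z powi (v div 3 + 1) * (w powi (u div 3) / (z - w))"
        by simp
      also have "\<dots> = (\<Sum>s\<in>{v..h}. b s * (z powi (- (s div 3) - 1) / (z - w)))"
        unfolding * sum_distrib_right b_def by (intro sum.cong) (auto simp: mult_ac)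
      finally show "(S w ** wsym Q z) $ block_index u $ block_index v *
        (w powi (u div 3) / z powi (v div 3 + 1)) / (z - w) =
        (\<Sum>s\<in>{v..h}. b s * (z powi (- (s div 3) - 1) / (z - w)))" .
    qed
    also have "\<dots> = (\<Sum>s\<in>{v..h}. contour_integral \<gamma>' (\<lambda>z. b s * (z powi (- (s div 3) - 1) / (z - w))))"
      by (intro contour_integral_sum contour_integrable_lmul e.integral_power_over_linear(2) wi) auto
    also have "\<dots> = (\<Sum>s\<in>{v..h}. b s * (if - (s div 3) - 1 \<ge> 0 then ?c * w powi (- (s div 3) - 1) else 0))"
      by (intro sum.cong refl)
        (simp only: contour_integral_lmul[OF e.integral_power_over_linear(2)[OF wi]]
          e.integral_power_over_linear(1)[OF wi])
    also have "\<dots> = (\<Sum>s\<in>{v..-1}. b s * (?c * w powi (- (s div 3) - 1)))"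
    proof -
      \<comment> \<open>The cut falls on a block boundary: the exponent is nonnegative exactly for
        the blocks below block 0.\<close>
      have iff: "- (s div 3) - 1 \<ge> 0 \<longleftrightarrow> s \<le> -1" for s :: int by presburger
      show ?thesis unfolding iff
        by (rule sum.mono_neutral_cong_right) (auto simp: h_def)
    qed
    also have "\<dots> = (\<Sum>s\<in>{v..-1}. (?c * wop Q s v) * (ent (S w) w u s / w))"
      using w0 by (intro sum.cong) (auto simp: b_def ent_def power_int_diff power_int_minus field_simps)
    finally show ?thesis .
  qed
  have "contour_integral \<gamma> (\<lambda>w. contour_integral \<gamma>' (\<lambda>z.
      (S w ** wsym Q z) $ block_index u $ block_index v *
      (w powi (u div 3) / z powi (v div 3 + 1)) / (z - w))) =
    contour_integral \<gamma> (\<lambda>w. \<Sum>s\<in>{v..-1}. (?c * wop Q s v) * (ent (S w) w u s / w))"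
    by (rule contour_integral_cong[OF refl]) (rule inner)
  also have "\<dots> = (\<Sum>s\<in>{v..-1}. contour_integral \<gamma> (\<lambda>w. (?c * wop Q s v) * (ent (S w) w u s / w)))"
    by (intro contour_integral_sum contour_integrable_lmul i.integrable i.ent_holomorphic[OF S]) auto
  also have "\<dots> = (\<Sum>s\<in>{v..-1}. ?c\<^sup>2 * (i.toep S u s * wop Q s v))"
  proof (rule sum.cong[OF refl])
    fix s
    have "contour_integral \<gamma> (\<lambda>w. (?c * wop Q s v) * (ent (S w) w u s / w)) =
      (?c * wop Q s v) * contour_integral \<gamma> (\<lambda>w. ent (S w) w u s / w)"
      by (intro contour_integral_lmul i.integrable i.ent_holomorphic[OF S]) auto
    then show "contour_integral \<gamma> (\<lambda>w. (?c * wop Q s v) * (ent (S w) w u s / w)) =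
      ?c\<^sup>2 * (i.toep S u s * wop Q s v)"
      by (simp add: i.toep_def power2_eq_square)
  qed
  finally show ?thesis by (simp add: sum_distrib_left[symmetric])
qed

section \<open>Laurent coefficients of the factors\<close>

text \<open>Here w stands for 1/z, so w = 0 is excluded and the constant term is found as a limit;
  division by w then shifts to the next coefficient.\<close>

lemma power_series_zero_coeff:
  fixes a :: "nat \<Rightarrow> complex"
  assumes "\<And>w. w \<noteq> 0 \<Longrightarrow> norm w < 1 \<Longrightarrow> (\<lambda>n. a n * w ^ n) sums 0"
  shows "a n = 0"
  using assms
proof (induction n arbitrary: a)
  case 0
  have "((\<lambda>w::complex. 0) \<longlongrightarrow> a 0) (at 0)"
    by (rule powser_limit_0_strong[of 1]) (use 0 in auto)
  then show ?case by (simp add: tendsto_const_iff)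
next
  case (Suc n)
  have a0: "a 0 = 0"
  proof -
    have "((\<lambda>w::complex. 0) \<longlongrightarrow> a 0) (at 0)"
      by (rule powser_limit_0_strong[of 1]) (use Suc.prems in auto)
    then show ?thesis by (simp add: tendsto_const_iff)
  qed
  show ?case
  proof (rule Suc.IH[of "\<lambda>n. a (Suc n)"])
    fix w :: complex assume w: "w \<noteq> 0" "norm w < 1"
    have "(\<lambda>n. a (Suc n) * w ^ Suc n) sums 0"
      using Suc.prems[OF w] by (subst sums_Suc_iff) (simp add: a0)
    then have "(\<lambda>n. inverse w * (a (Suc n) * w ^ Suc n)) sums (inverse w * 0)" by (rule sums_mult)
    also have "(\<lambda>n. inverse w * (a (Suc n) * w ^ Suc n)) = (\<lambda>n. a (Suc n) * w ^ n)"
      using w by (auto simp: field_simps)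
    finally show "(\<lambda>n. a (Suc n) * w ^ n) sums 0" by simp
  qed
qed

lemma laurent_tail_zero:
  fixes e :: "int \<Rightarrow> complex"
  assumes pos: "\<And>k. k > 0 \<Longrightarrow> e k = 0"
    and sum: "\<And>z. norm z > 1 \<Longrightarrow> ((\<lambda>k. e k * z powi k) has_sum 0) UNIV"
  shows "e k = 0"
proof (cases "k > 0")
  case False
  have "e (- int n) = 0" for n
  proof (rule power_series_zero_coeff[of "\<lambda>n. e (- int n)"])
    fix w :: complex assume w: "w \<noteq> 0" "norm w < 1"
    have "((\<lambda>k. e k * inverse w powi k) has_sum 0) UNIV"
      by (rule sum) (use w in \<open>simp add: norm_inverse one_less_inverse_iff\<close>)
    also have "((\<lambda>k. e k * inverse w powi k) has_sum 0) UNIV \<longleftrightarrow>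
        ((\<lambda>k. e k * inverse w powi k) has_sum 0) (range (\<lambda>n. - int n))"
    proof (rule has_sum_cong_neutral)
      fix k :: int assume "k \<in> UNIV - range (\<lambda>n. - int n)"
      then have "k > 0" by (metis DiffD2 minus_minus nonneg_int_cases not_less rangeI neg_0_le_iff_le)
      then show "e k * inverse w powi k = 0" using pos by simp
    qed auto
    also have "\<dots> \<longleftrightarrow> (((\<lambda>k. e k * inverse w powi k) \<circ> (\<lambda>n. - int n)) has_sum 0) UNIV"
      by (rule has_sum_reindex) (simp add: inj_on_def)
    also have "(\<lambda>k. e k * inverse w powi k) \<circ> (\<lambda>n. - int n) = (\<lambda>n. e (- int n) * w ^ n)"
      by (auto simp: power_int_minus power_inverse)
    finally show "(\<lambda>n. e (- int n) * w ^ n) sums 0" by (rule has_sum_imp_sums)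
  qed
  from this[of "nat (- k)"] show ?thesis using False by simp
qed (simp add: pos)

text \<open>Uniqueness of the expansion, which pins down the value of \<open>THE\<close> in
  \<open>laurent_coeff\<close>.\<close>

lemma laurent_coeff_eq:
  fixes c :: "int \<Rightarrow> complex^3^3" and f :: "complex \<Rightarrow> complex^3^3"
  assumes pos: "\<And>k. k > 0 \<Longrightarrow> c k = 0"
    and sum: "\<And>z i j. norm z > 1 \<Longrightarrow> ((\<lambda>k. c k $ i $ j * z powi k) has_sum f z $ i $ j) UNIV"
  shows "laurent_coeff f = c"
  unfolding laurent_coeff_def
proof (rule the_equality)
  show "(\<forall>k>0. c k = 0) \<and> (\<forall>z. 1 < norm z \<longrightarrow>
      (\<forall>i j. ((\<lambda>k. c k $ i $ j * z powi k) has_sum f z $ i $ j) UNIV))"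
    using assms by blast
next
  fix d :: "int \<Rightarrow> complex^3^3" assume d: "(\<forall>k>0. d k = 0) \<and> (\<forall>z. 1 < norm z \<longrightarrow>
      (\<forall>i j. ((\<lambda>k. d k $ i $ j * z powi k) has_sum f z $ i $ j) UNIV))"
  have "d k $ i $ j - c k $ i $ j = 0" for k i j
  proof (rule laurent_tail_zero[of "\<lambda>k. d k $ i $ j - c k $ i $ j"])
    fix z :: complex assume z: "norm z > 1"
    have "((\<lambda>k. d k $ i $ j * z powi k + - (c k $ i $ j * z powi k)) has_sum
        (f z $ i $ j + - (f z $ i $ j))) UNIV"
      using d z sum[OF z] by (intro has_sum_add) (auto simp: has_sum_uminus)
    then show "((\<lambda>k. (d k $ i $ j - c k $ i $ j) * z powi k) has_sum 0) UNIV"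
      by (simp add: left_diff_distrib)
  qed (use d pos in auto)
  then show "d = c" by (auto simp: Finite_Cartesian_Product.vec_eq_iff fun_eq_iff)
qed

lemma has_sum_geometric_down:
  fixes z :: complex
  assumes "norm z > 1"
  shows "((\<lambda>k. z powi k) has_sum (1 / (1 - 1 / z))) {..0}"
proof -
  have n: "norm (inverse z) < 1" using assms by (simp add: norm_inverse inverse_less_1_iff)
  have "((\<lambda>n. inverse z ^ n) has_sum (1 / (1 - inverse z))) UNIV"
    using n by (intro norm_summable_imp_has_sum geometric_sums) (simp add: norm_power summable_geometric)
  also have "(\<lambda>n. inverse z ^ n) = (\<lambda>k. z powi k) \<circ> (\<lambda>n. - int n)"
    by (auto simp: power_int_minus power_inverse)
  also have "(\<dots> has_sum (1 / (1 - inverse z))) UNIV \<longleftrightarrow>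
      ((\<lambda>k. z powi k) has_sum (1 / (1 - inverse z))) (range (\<lambda>n. - int n))"
    by (rule has_sum_reindex[symmetric]) (simp add: inj_on_def)
  also have "range (\<lambda>n. - int n) = {..0}"
    by (auto simp: image_iff) (rule_tac x="nat (- x)" in exI, simp)
  finally show ?thesis by (simp add: inverse_eq_divide)
qed

lemma has_sum_geometric_down':
  fixes z :: complex
  assumes "norm z > 1"
  shows "((\<lambda>k. z powi k) has_sum (1 / (1 - 1 / z) / z)) {..-1}"
proof -
  have "((\<lambda>k. z powi k * (1 / z)) has_sum (1 / (1 - 1 / z) * (1 / z))) {..0}"
    by (intro has_sum_cmult_left has_sum_geometric_down assms)
  also have "?this \<longleftrightarrow> (((\<lambda>k. z powi k) \<circ> (\<lambda>k. k - 1)) has_sum (1 / (1 - 1 / z) * (1 / z))) {..0}"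
    using assms by (intro has_sum_cong) (auto simp: power_int_diff)
  also have "\<dots> \<longleftrightarrow> ((\<lambda>k. z powi k) has_sum (1 / (1 - 1 / z) * (1 / z))) ((\<lambda>k. k - 1) ` {..0})"
    by (rule has_sum_reindex[symmetric]) (simp add: inj_on_def)
  also have "(\<lambda>k. k - 1) ` {..0::int} = {..-1}"
    by (auto simp: image_iff) (rule_tac x="x + 1" in bexI, auto)
  finally show ?thesis by simp
qed

definition block_pos :: "3 \<Rightarrow> int" where
  "block_pos i = (if i = 1 then 0 else if i = 2 then 1 else 2)"

lemma block_pos_simps [simp]: "block_pos 1 = 0" "block_pos 2 = 1" "block_pos 3 = 2"
  by (simp_all add: block_pos_def)

lemma block_pos_block_index: "block_pos (block_index u) = u mod 3"
  by (cases u rule: int_mod3_cases) simp_all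

lemma fop_shift: "fop x (u + 3 * k) (v + 3 * k) = fop x u v"
proof -
  have "(u + 3 * k) mod 3 = u mod 3" "(v + 3 * k) mod 3 = v mod 3" "(u + 3 * k - 1) mod 3 = (u - 1) mod 3"
    by presburger+
  then show ?thesis by (cases x) (auto simp: step_wt_def period_wt_def)
qed

lemma fop_block_has_sum:
  assumes x: "\<And>a. x = NF a \<Longrightarrow> a 0 * a 1 * a 2 = 1" and z: "norm z > 1"
  shows "((\<lambda>k. fop x (block_pos i) (3 * k + block_pos j) * z powi k) has_sum fsym x z $ i $ j) UNIV"
proof (cases x)
  case (MF a)
  have "((\<lambda>k. fop x (block_pos i) (3 * k + block_pos j) * z powi k) has_sum
      (\<Sum>k\<in>{0, -1}. fop x (block_pos i) (3 * k + block_pos j) * z powi k)) {0, -1}"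
    by (rule has_sum_finite) simp
  moreover have "((\<lambda>k. fop x (block_pos i) (3 * k + block_pos j) * z powi k) has_sum
      (\<Sum>k\<in>{0, -1}. fop x (block_pos i) (3 * k + block_pos j) * z powi k)) {0, -1} \<longleftrightarrow>
     ((\<lambda>k. fop x (block_pos i) (3 * k + block_pos j) * z powi k) has_sum
      (\<Sum>k\<in>{0, -1}. fop x (block_pos i) (3 * k + block_pos j) * z powi k)) UNIV"
    by (rule has_sum_cong_neutral) (auto simp: MF block_pos_def)
  moreover have "\<forall>i j. (\<Sum>k\<in>{0, -1}. fop x (block_pos i) (3 * k + block_pos j) * z powi k) = fsym x z $ i $ j"
    unfolding forall_3 by (simp add: MF M_d_def step_wt_def divide_inverse)
  ultimately show ?thesis by simp
next
  case (NF a)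
  note a = x[OF NF]
  have a': "complex_of_real (a 0) * of_real (a 1) * of_real (a 2) = 1"
    using a by (metis of_real_mult of_real_1)
  \<comment> \<open>For a column to the right of the diagonal of its block, the block k = 0
    contributes nothing and the geometric series starts at k = -1; this is the extra 1/z in the
    upper entries of \<open>N_d\<close>.\<close>
  define S where "S = (if block_pos j \<le> block_pos i then {..0::int} else {..-1})"
  define T where "T = (if block_pos j \<le> block_pos i then 1 / (1 - 1 / z) else 1 / (1 - 1 / z) / z)"
  define r where "r = complex_of_real (period_wt a (block_pos i) / period_wt a (block_pos j))"
  have "((\<lambda>k. r * z powi k) has_sum (r * T)) S"
    using has_sum_cmult_right[OF has_sum_geometric_down[OF z], of r]
      has_sum_cmult_right[OF has_sum_geometric_down'[OF z], of r] by (simp add: S_def T_def)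
  also have "?this \<longleftrightarrow> ((\<lambda>k. fop x (block_pos i) (3 * k + block_pos j) * z powi k) has_sum (r * T)) UNIV"
  proof (rule has_sum_cong_neutral)
    fix k assume "k \<in> S \<inter> UNIV"
    then have "3 * k + block_pos j \<le> block_pos i"
      by (auto simp: S_def block_pos_def split: if_splits)
    moreover have "period_wt a (3 * k + block_pos j) = period_wt a (block_pos j)"
      by (simp add: period_wt_def)
    ultimately show "r * z powi k = fop x (block_pos i) (3 * k + block_pos j) * z powi k"
      by (simp add: NF r_def)
  next
    fix k assume "k \<in> UNIV - S"
    then have "\<not> 3 * k + block_pos j \<le> block_pos i"
      by (auto simp: S_def block_pos_def split: if_splits)
    then show "fop x (block_pos i) (3 * k + block_pos j) * z powi k = 0" by (simp add: NF)
  qed auto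
  also have "r * T = fsym x z $ i $ j"
  proof -
    have nz: "a 0 \<noteq> 0" "a 1 \<noteq> 0" "a 2 \<noteq> 0" using a by auto
    have q: "\<forall>i j. period_wt a (block_pos i) / period_wt a (block_pos j) =
        (vector [vector [1, a 1 * a 2, a 2], vector [a 0, 1, a 0 * a 2],
          vector [a 0 * a 1, a 1, 1]] :: real^3^3) $ i $ j"
      unfolding forall_3 using nz a by (simp add: period_wt_def field_simps del: One_nat_def)
    have "\<forall>i j. complex_of_real (period_wt a (block_pos i) / period_wt a (block_pos j)) *
       (if block_pos j \<le> block_pos i then 1 / (1 - 1 / z) else 1 / (1 - 1 / z) / z) = fsym x z $ i $ j"
      unfolding q[rule_format] unfolding forall_3 NF fsym.simps N_d_def of_real_mult a'
      by (simp add: mult_ac del: One_nat_def)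
    then show ?thesis unfolding r_def T_def by simp
  qed
  finally show ?thesis .
qed

lemma block_toeplitz_fsym:
  assumes x: "\<And>a. x = NF a \<Longrightarrow> a 0 * a 1 * a 2 = 1"
  shows "block_toeplitz (fsym x) u v = fop x u v"
proof -
  have c: "laurent_coeff (fsym x) = (\<lambda>k. \<chi> i j. fop x (block_pos i) (3 * k + block_pos j))"
  proof (rule laurent_coeff_eq)
    fix k :: int assume "k > 0"
    then have "fop x (block_pos i) (3 * k + block_pos j) = 0" for i j
      by (intro fop_lower) (auto simp: block_pos_def)
    then show "(\<chi> i j. fop x (block_pos i) (3 * k + block_pos j)) = 0"
      by (simp add: Finite_Cartesian_Product.vec_eq_iff)
  qed (use fop_block_has_sum[OF x] in simp)
  have "block_toeplitz (fsym x) u v = fop x (u mod 3) (3 * (v div 3 - u div 3) + v mod 3)"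
    unfolding block_toeplitz_def c by (simp add: block_pos_block_index)
  also have "\<dots> = fop x (u mod 3 + 3 * (u div 3)) (3 * (v div 3 - u div 3) + v mod 3 + 3 * (u div 3))"
    by (rule fop_shift[symmetric])
  also have "\<dots> = fop x u v" by (simp add: algebra_simps)
  finally show ?thesis .
qed

section \<open>Total positivity\<close>

lemma strict_mono_endo_id:
  fixes f :: "nat \<Rightarrow> nat"
  assumes mono: "\<And>i j. i < j \<Longrightarrow> j < k \<Longrightarrow> f i < f j" and f: "\<And>i. i < k \<Longrightarrow> f i < k" and i: "i < k"
  shows "f i = i"
proof -
  have ge: "j \<le> f j" if "j < k" for j
    using that
  proof (induction j)
    case (Suc j)
    then show ?case using mono[of j "Suc j"] by simp
  qed simp
  have "inj_on f {..<k}"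
    using mono by (intro linorder_inj_onI) (auto simp: less_imp_neq)
  then have "f ` {..<k} = {..<k}" using f by (intro endo_inj_surj) auto
  then have "(\<Sum>j<k. f j) = (\<Sum>j<k. j)"
    using sum.reindex[OF \<open>inj_on f {..<k}\<close>, of "\<lambda>j. j"] by simp
  show ?thesis
  proof (rule ccontr)
    assume "f i \<noteq> i"
    then have "i < f i" using ge[OF i] by simp
    then have "(\<Sum>j<k. j) < (\<Sum>j<k. f j)"
      by (intro sum_strict_mono_ex1 bexI[of _ i]) (use ge i in simp_all)
    then show False using \<open>(\<Sum>j<k. f j) = (\<Sum>j<k. j)\<close> by simp
  qed
qed

lemma det_mat_eq_diagonal:
  assumes "\<And>p. p permutes {0..<k} \<Longrightarrow> (\<And>i. i < k \<Longrightarrow> f (i, p i) \<noteq> (0 :: 'a :: idom)) \<Longrightarrow> p = id"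
  shows "Determinant.det (Matrix.mat k k f) = (\<Prod>i=0..<k. f (i, i))"
proof -
  have "signof p * (\<Prod>i=0..<k. f (i, p i)) = 0" if "p permutes {0..<k}" "p \<noteq> id" for p
    using assms[OF that(1)] that(2) by (auto simp: prod_zero_iff)
  then have "(\<Sum>p\<in>{p. p permutes {0..<k}}. signof p * (\<Prod>i=0..<k. f (i, p i))) =
      (\<Sum>p\<in>{id}. signof p * (\<Prod>i=0..<k. f (i, p i)))"
    by (intro sum.mono_neutral_right) (auto simp: finite_permutations permutes_id)
  then show ?thesis unfolding det_mat_eq by simp
qed

text \<open>A nonzero Leibniz term moves each height down by at most 1. Since the heights increase
  strictly, the permutation is increasing, hence the identity.\<close>

lemma det_MF:
  assumes u: "\<And>i j. i < j \<Longrightarrow> j < k \<Longrightarrow> u i < u j" and v: "\<And>i j. i < j \<Longrightarrow> j < k \<Longrightarrow> v i < v j"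
  shows "Determinant.det (Matrix.mat k k (\<lambda>(i, j). fop (MF a) (u i) (v j))) = (\<Prod>i=0..<k. fop (MF a) (u i) (v i))"
proof (subst det_mat_eq_diagonal)
  fix p assume p: "p permutes {0..<k}"
    and nz: "\<And>i. i < k \<Longrightarrow> (case (i, p i) of (i, j) \<Rightarrow> fop (MF a) (u i) (v j)) \<noteq> 0"
  have near: "v (p i) = u i \<or> v (p i) = u i - 1" if "i < k" for i
    using nz[OF that] by (auto split: if_splits)
  have lt: "p i < p j" if ij: "i < j" "j < k" for i j
  proof -
    have "v (p i) \<le> v (p j)" using near[of i] near[of j] u[OF ij] ij by auto
    moreover have "p i \<noteq> p j" using permutes_inj[OF p] ij by (auto dest: injD)
    moreover have "v (p j) < v (p i)" if "p j < p i"
      by (rule v[OF that]) (use permutes_image_lessThan[OF p, of i] ij in simp)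
    ultimately show ?thesis by (meson linorder_neqE_nat not_less)
  qed
  have "p i = i" for i
  proof (cases "i < k")
    case True
    show ?thesis by (rule strict_mono_endo_id[OF lt permutes_image_lessThan[OF p] True])
  next
    case False
    then show ?thesis using permutes_not_in[OF p, of i] by simp
  qed
  then show "p = id" by auto
qed simp

lemma det_staircase_triangular:
  assumes "\<And>i j. i < k \<Longrightarrow> j < k \<Longrightarrow> v j \<le> (u i :: int) \<longleftrightarrow> j \<le> i"
  shows "Determinant.det (Matrix.mat k k (\<lambda>(i, j). if v j \<le> u i then 1 else (0 :: complex))) = 1"
proof (subst det_mat_eq_diagonal)
  fix p assume p: "p permutes {0..<k}"
    and nz: "\<And>i. i < k \<Longrightarrow> (case (i, p i) of (i, j) \<Rightarrow> if v j \<le> u i then 1 else (0 :: complex)) \<noteq> 0"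
  have "p i \<le> i" if "i < k" for i
    using nz[OF that] assms[OF that permutes_image_lessThan[OF p that]] by (auto split: if_splits)
  then have "p i \<le> i" for i using permutes_not_in[OF p, of i] by (cases "i < k") auto
  then show "p = id" using permutes_natset_le[OF p] by auto
qed (use assms in simp)

text \<open>Row i is the indicator of an initial segment of the columns, and the segments grow with
  i. An empty or a repeated row gives 0; otherwise k strictly growing nonempty segments of k columns
  have sizes 1, ..., k and the matrix is unitriangular.\<close>

lemma det_staircase:
  assumes u: "\<And>i j. i < j \<Longrightarrow> j < k \<Longrightarrow> u i < u j" and v: "\<And>i j. i < j \<Longrightarrow> j < k \<Longrightarrow> v i < (v j :: int)"
  shows "Determinant.det (Matrix.mat k k (\<lambda>(i, j). if v j \<le> u i then 1 else 0)) \<in> {0, 1 :: complex}"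
proof -
  let ?D = "Determinant.det (Matrix.mat k k (\<lambda>(i, j). if v j \<le> u i then 1 else (0 :: complex)))"
  define R where "R i = {j. j < k \<and> v j \<le> u i}" for i
  have finR: "finite (R i)" for i unfolding R_def by simp
  have down: "j' \<in> R i" if "j \<in> R i" "j' \<le> j" for i j j'
  proof (cases "j' = j")
    case False
    then have "v j' < v j" using that by (intro v) (auto simp: R_def)
    then show ?thesis using that by (simp add: R_def)
  qed (use that in simp)
  consider (zero) i where "i < k" "R i = {}" | (same) i i' where "i < i'" "i' < k" "R i = R i'"
    | (strict) "\<And>i. i < k \<Longrightarrow> R i \<noteq> {}" "\<And>i i'. i < i' \<Longrightarrow> i' < k \<Longrightarrow> R i \<noteq> R i'"
    by (metis (no_types))
  then show ?thesis
  proof cases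
    case zero
    have "?D = 0"
    proof (rule ccontr)
      assume "?D \<noteq> 0"
      then obtain p where "p permutes {0..<k}"
        "\<And>i. i < k \<Longrightarrow> (case (i, p i) of (i, j) \<Rightarrow> if v j \<le> u i then 1 else (0 :: complex)) \<noteq> 0"
        by (rule det_mat_nonzero_obtains_permutation) blast
      note p = this
      have "v (p i) \<le> u i" using p(2)[OF zero(1)] by (cases "v (p i) \<le> u i") auto
      then have "p i \<in> R i" using zero(1) permutes_image_lessThan[OF p(1)] by (simp add: R_def)
      then show False using zero by simp
    qed
    then show ?thesis by simp
  next
    case same
    have "?D = 0"
    proof (rule det_mat_identical_rows[of i k i'])
      fix j assume "j < k"
      moreover have "j \<in> R i \<longleftrightarrow> j \<in> R i'" using same(3) by simp
      ultimately have "v j \<le> u i \<longleftrightarrow> v j \<le> u i'" by (simp add: R_def)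
      then show "(case (i, j) of (i, j) \<Rightarrow> if v j \<le> u i then 1 else (0 :: complex)) =
          (case (i', j) of (i, j) \<Rightarrow> if v j \<le> u i then 1 else 0)" by simp
    qed (use same in simp_all)
    then show ?thesis by simp
  next
    case strict
    have Req: "R i = {..<card (R i)}" for i
    proof -
      have "j < card (R i)" if "j \<in> R i" for j
      proof -
        have "card {..j} \<le> card (R i)" by (rule card_mono[OF finR]) (use down[OF that] in blast)
        then show ?thesis by simp
      qed
      then have "R i \<subseteq> {..<card (R i)}" by blast
      then show ?thesis by (rule card_subset_eq[rotated]) simp_all
    qed
    have sub: "R i \<subset> R i'" if "i < i'" "i' < k" for i i'
    proof
      show "R i \<subseteq> R i'"
      proof
        fix j assume "j \<in> R i"
        then have "j < k" "v j \<le> u i" by (simp_all add: R_def)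
        then show "j \<in> R i'" using u[OF that] by (simp add: R_def)
      qed
    qed (rule strict(2)[OF that])
    have "card (R i) - 1 = i" if "i < k" for i
    proof (rule strict_mono_endo_id[where f="\<lambda>i. card (R i) - 1", OF _ _ that])
      fix i j assume ij: "i < j" "j < k"
      then have "card (R i) < card (R j)" using sub[OF ij] finR by (simp add: psubset_card_mono)
      moreover have "card (R i) > 0" using strict(1)[of i] ij finR[of i] by (simp add: card_gt_0_iff)
      ultimately show "card (R i) - 1 < card (R j) - 1" by simp
    next
      fix i assume i: "i < k"
      have "card (R i) \<le> card {..<k}" by (rule card_mono) (auto simp: R_def)
      then show "card (R i) - 1 < k" using i by simp
    qed
    note cR = this
    have RR: "R i = {..<i + 1}" if "i < k" for i
    proof -
      have "card (R i) > 0" using strict(1)[OF that] finR[of i] by (simp add: card_gt_0_iff)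
      then have card: "card (R i) = i + 1" using cR[OF that] by linarith
      show ?thesis by (subst Req[of i]) (simp add: card)
    qed
    have "?D = 1"
    proof (rule det_staircase_triangular)
      fix i j assume ij: "i < k" "j < k"
      have "v j \<le> u i \<longleftrightarrow> j \<in> R i" using ij by (simp add: R_def)
      also have "\<dots> \<longleftrightarrow> j \<le> i" unfolding RR[OF ij(1)] by auto
      finally show "v j \<le> u i \<longleftrightarrow> j \<le> i" .
    qed
    then show ?thesis by simp
  qed
qed

text \<open>Each entry of \<open>NF\<close> is a staircase indicator up to a factor of its row and a
  factor of its column.\<close>

lemma det_NF:
  "Determinant.det (Matrix.mat k k (\<lambda>(i, j). fop (NF a) (u i) (v j))) =
    of_real ((\<Prod>i=0..<k. period_wt a (u i)) * (\<Prod>i=0..<k. 1 / period_wt a (v i))) *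
    Determinant.det (Matrix.mat k k (\<lambda>(i, j). if v j \<le> u i then 1 else 0))"
proof -
  have "Determinant.det (Matrix.mat k k (\<lambda>(i, j). fop (NF a) (u i) (v j))) =
     Determinant.det (Matrix.mat k k (\<lambda>(i, j). complex_of_real (period_wt a (u i)) *
        ((if v j \<le> u i then 1 else 0) * complex_of_real (1 / period_wt a (v j)))))"
    by (rule det_mat_cong) auto
  then show ?thesis
    by (simp only: det_mat_scale_rows[where c="\<lambda>i. complex_of_real (period_wt a (u i))"]
      det_mat_scale_cols[where c="\<lambda>i. complex_of_real (1 / period_wt a (v i))"]
      of_real_prod[symmetric] of_real_mult mult.assoc)
qed

definition pos_factor :: "factor \<Rightarrow> bool" where
  "pos_factor x \<longleftrightarrow> (\<exists>a. (x = MF a \<or> x = NF a) \<and> a 0 > 0 \<and> a 1 > 0 \<and> a 2 > 0)"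

lemma step_wt_pos: "a 0 > 0 \<Longrightarrow> a 1 > 0 \<Longrightarrow> a 2 > 0 \<Longrightarrow> step_wt a u > 0"
proof -
  assume a: "a 0 > 0" "a 1 > 0" "a 2 > 0"
  have "(u - 1) mod 3 = 0 \<or> (u - 1) mod 3 = 1 \<or> (u - 1) mod 3 = 2" by presburger
  then show ?thesis using a by (auto simp: step_wt_def)
qed

lemma period_wt_pos: "a 0 > 0 \<Longrightarrow> a 1 > 0 \<Longrightarrow> period_wt a u > 0"
  by (simp add: period_wt_def)

lemma det_fop_nonneg:
  assumes x: "pos_factor x"
    and u: "\<And>i j. i < j \<Longrightarrow> j < k \<Longrightarrow> u i < u j" and v: "\<And>i j. i < j \<Longrightarrow> j < k \<Longrightarrow> v i < v j"
  shows "Determinant.det (Matrix.mat k k (\<lambda>(i, j). fop x (u i) (v j))) \<in> \<real>\<^sub>\<ge>\<^sub>0"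
proof -
  obtain a where a: "x = MF a \<or> x = NF a" "a 0 > 0" "a 1 > 0" "a 2 > 0"
    using x unfolding pos_factor_def by blast
  have prod: "(\<Prod>i\<in>A. f i) \<in> \<real>\<^sub>\<ge>\<^sub>0" if "\<And>i. i \<in> A \<Longrightarrow> f i \<in> \<real>\<^sub>\<ge>\<^sub>0" for A and f :: "nat \<Rightarrow> complex"
    using that by (induction A rule: infinite_finite_induct) (auto intro: nonneg_Reals_mult_I)
  from a(1) show ?thesis
  proof
    assume x: "x = MF a"
    have "Determinant.det (Matrix.mat k k (\<lambda>(i, j). fop x (u i) (v j))) = (\<Prod>i=0..<k. fop x (u i) (v i))"
      unfolding x by (rule det_MF) (fact u, fact v)
    moreover have "\<dots> \<in> \<real>\<^sub>\<ge>\<^sub>0"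
      using step_wt_pos[of a, OF a(2,3,4)] unfolding x by (intro prod) (auto simp: less_imp_le)
    ultimately show ?thesis by simp
  next
    assume x: "x = NF a"
    have "(\<Prod>i=0..<k. period_wt a (u i)) * (\<Prod>i=0..<k. 1 / period_wt a (v i)) \<ge> 0"
      using period_wt_pos[of a, OF a(2,3)] by (intro mult_nonneg_nonneg prod_nonneg) (auto simp: less_imp_le)
    then show ?thesis unfolding x det_NF
      using det_staircase[of k u v] u v
      by (intro nonneg_Reals_mult_I) (auto simp del: of_real_mult of_real_prod)
  qed
qed

text \<open>Triangularity read as a matching of consecutive levels along which no path goes
  up.\<close>

lemma det_fop_nonzero_obtains:
  assumes "Determinant.det (Matrix.mat k k (\<lambda>(i, j). fop x (u i) (v j))) \<noteq> 0"
  obtains p where "p permutes {0..<k}" "\<And>i. i < k \<Longrightarrow> v (p i) \<le> u i"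
proof -
  obtain p where "p permutes {0..<k}"
    and nz: "\<And>i. i < k \<Longrightarrow> (case (i, p i) of (i, j) \<Rightarrow> fop x (u i) (v j)) \<noteq> 0"
    using assms by (rule det_mat_nonzero_obtains_permutation) blast
  moreover have "v (p i) \<le> u i" if "i < k" for i
    using nz[OF that] fop_lower[of "u i" "v (p i)" x] by (cases "v (p i) \<le> u i") auto
  ultimately show ?thesis using that by blast
qed

text \<open>Triangularity keeps all intermediate heights between u and x, so restricting the sums to
  the window loses nothing.\<close>

lemma chain_eq_wop:
  fixes l :: "nat \<Rightarrow> factor"
  assumes x: "x \<in> {lo..hi}" and u: "u \<in> {lo..hi}"
  shows "chain {lo..hi} (\<lambda>j. fop (l j)) (\<lambda>_ _. 1) x m u = wop (map l [1..<m + 1]) x u"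
  using u
proof (induction m arbitrary: u)
  case 0
  then show ?case by (auto simp: wop_Nil)
next
  case (Suc m)
  have "chain {lo..hi} (\<lambda>j. fop (l j)) (\<lambda>_ _. 1) x (Suc m) u =
     (\<Sum>w\<in>{lo..hi}. wop (map l [1..<m + 1]) x w * fop (l (Suc m)) w u)"
    using Suc.IH by simp
  also have "\<dots> = (\<Sum>w\<in>{u..x}. wop (map l [1..<m + 1]) x w * fop (l (Suc m)) w u)"
    by (rule sum.mono_neutral_right) (use x Suc.prems in \<open>auto simp: wop_lower fop_lower\<close>)
  also have "\<dots> = wop (map l [1..<m + 1] @ [l (Suc m)]) x u"
    by (simp add: wop_append lmul_def wop_single_eq_fop)
  finally show ?case by simp
qed

section \<open>The finite measure\<close>

definition level_factor :: "(nat \<Rightarrow> real) \<Rightarrow> (nat \<Rightarrow> real) \<Rightarrow> nat \<Rightarrow> factor" where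
  "level_factor \<alpha> \<beta> m = (if m mod 4 = 1 then MF \<alpha> else if m mod 4 = 2 then NF \<alpha>
     else if m mod 4 = 3 then MF \<beta> else NF \<beta>)"

lemma phi_eq_fsym: "phi \<alpha> \<beta> m = fsym (level_factor \<alpha> \<beta> m)"
  by (auto simp: phi_def level_factor_def fun_eq_iff)

lemma nth_elem_interval:
  assumes "i < k"
  shows "nth_elem {a..<a + int k} i = a + int i"
  using assms
proof (induction k)
  case (Suc k)
  have e: "{a..<a + int (Suc k)} = insert (a + int k) {a..<a + int k}" by auto
  have "sorted_list_of_set {a..<a + int (Suc k)} = sorted_list_of_set {a..<a + int k} @ [a + int k]"
    unfolding e by (subst sorted_list_of_set_insert_remove) (auto intro!: sorted_insort_is_snoc)
  then show ?case using Suc by (cases "i = k") (auto simp: nth_append)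
qed simp

locale aztec_weights =
  fixes \<alpha> \<beta> :: "nat \<Rightarrow> real" and N n H :: nat
  assumes pos: "\<alpha> 0 > 0" "\<alpha> 1 > 0" "\<alpha> 2 > 0" "\<beta> 0 > 0" "\<beta> 1 > 0" "\<beta> 2 > 0"
    and prod: "\<alpha> 0 * \<alpha> 1 * \<alpha> 2 = 1" "\<beta> 0 * \<beta> 1 * \<beta> 2 = 1" and N: "1 \<le> N"
begin

text \<open>Nonzero weights need no heights above \<open>3 n - 1\<close>; the margin \<open>H\<close> lets the window contain all points
  whose probability is asked for.\<close>

definition window :: "int set" where
  "window = {- 6 * int N..3 * int n - 1 + int H}"

definition start_pos :: "nat \<Rightarrow> int" where "start_pos j = int j"

definition end_pos :: "nat \<Rightarrow> int" where "end_pos j = - 6 * int N + int j"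

abbreviation R :: "nat \<Rightarrow> int \<Rightarrow> int \<Rightarrow> complex" where
  "R m \<equiv> fop (level_factor \<alpha> \<beta> m)"

definition levels :: "(nat \<times> int) set \<Rightarrow> nat \<Rightarrow> int set" where
  "levels C m = {u. (m, u) \<in> C}"

definition window_configs :: "(nat \<times> int) set set" where
  "window_configs = {C \<in> configs N n. C \<subseteq> {1..12 * N - 1} \<times> window}"

abbreviation weight :: "(nat \<times> int) set \<Rightarrow> complex" where
  "weight \<equiv> config_weight \<alpha> \<beta> N n"

lemma factor_prod: "level_factor \<alpha> \<beta> m = NF a \<Longrightarrow> a 0 * a 1 * a 2 = 1"
  using prod by (auto simp: level_factor_def split: if_splits)

lemma factor_pos: "pos_factor (level_factor \<alpha> \<beta> m)"
  using pos by (auto simp: level_factor_def pos_factor_def)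

lemma weight_eq_prod_det: "weight C = (\<Prod>m=1..12 * N. Determinant.det (Matrix.mat (3 * n) (3 * n)
    (\<lambda>(j, k). R m (path_pos N n C (m - 1) j) (path_pos N n C m k))))"
  unfolding config_weight_def phi_eq_fsym
  using block_toeplitz_fsym[OF factor_prod] by (intro prod.cong refl det_mat_cong) auto

lemma path_pos_eq: "m < 12 * N \<Longrightarrow> path_pos N n C m j = level_pos start_pos (levels C) m j"
  by (simp add: path_pos_def level_pos_def start_pos_def levels_def)

lemma path_pos_end: "path_pos N n C (12 * N) j = end_pos j"
  using N by (simp add: path_pos_def end_pos_def)

lemma weight_eq_chain_weight: "weight C = chain_weight (3 * n) R start_pos end_pos (12 * N) (levels C)"
proof -
  have ins: "{1..12 * N} = insert (12 * N) {1..<12 * N}" using N by auto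
  have "(\<Prod>m=1..<12 * N. Determinant.det (Matrix.mat (3 * n) (3 * n)
      (\<lambda>(j, k). R m (path_pos N n C (m - 1) j) (path_pos N n C m k)))) =
    (\<Prod>m=1..<12 * N. Determinant.det (Matrix.mat (3 * n) (3 * n)
      (\<lambda>(i, j). R m (level_pos start_pos (levels C) (m - 1) i) (nth_elem (levels C m) j))))"
    by (intro prod.cong refl det_mat_cong) (auto simp: path_pos_eq level_pos_def[of _ _ "Suc _"] level_pos_def)
  moreover have "Determinant.det (Matrix.mat (3 * n) (3 * n)
      (\<lambda>(j, k). R (12 * N) (path_pos N n C (12 * N - 1) j) (path_pos N n C (12 * N) k))) =
    Determinant.det (Matrix.mat (3 * n) (3 * n)
      (\<lambda>(i, j). R (12 * N) (level_pos start_pos (levels C) (12 * N - 1) i) (end_pos j)))"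
    by (intro det_mat_cong) (use N in \<open>auto simp: path_pos_eq path_pos_end\<close>)
  ultimately show ?thesis
    unfolding weight_eq_prod_det chain_weight_def ins by (simp add: mult.commute)
qed

lemma config_level:
  assumes "C \<in> configs N n" "m \<in> {1..12 * N - 1}"
  shows "finite (levels C m)" "card (levels C m) = 3 * n"
proof -
  have "levels C m \<subseteq> snd ` C"
  proof
    fix u assume "u \<in> levels C m"
    then show "u \<in> snd ` C" by (intro image_eqI[of _ _ "(m, u)"]) (simp_all add: levels_def)
  qed
  moreover have "finite C" using assms(1) by (simp add: configs_def)
  ultimately show "finite (levels C m)" by (rule finite_subset[OF _ finite_imageI])
  show "card (levels C m) = 3 * n" using assms by (simp add: configs_def levels_def)
qed

lemma path_pos_strict_mono:
  assumes C: "C \<in> configs N n" and m: "m \<le> 12 * N" and ij: "i < j" "j < 3 * n"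
  shows "path_pos N n C m i < path_pos N n C m j"
proof -
  consider "m = 0" | "m = 12 * N" | "m \<in> {1..12 * N - 1}" using m by fastforce
  then show ?thesis
  proof cases
    case 3
    then have "0 < m" "m < 12 * N" by auto
    then show ?thesis
      using nth_elem_strict_mono[of "levels C m" i j] config_level[OF C 3] ij
      by (simp add: path_pos_eq level_pos_def)
  qed (use ij in \<open>auto simp: path_pos_def\<close>)
qed

lemma weight_nonneg:
  assumes C: "C \<in> configs N n"
  shows "weight C \<in> \<real>\<^sub>\<ge>\<^sub>0"
proof -
  have prod: "(\<Prod>i\<in>A. f i) \<in> \<real>\<^sub>\<ge>\<^sub>0" if "\<And>i. i \<in> A \<Longrightarrow> f i \<in> \<real>\<^sub>\<ge>\<^sub>0" for A and f :: "nat \<Rightarrow> complex"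
    using that by (induction A rule: infinite_finite_induct) (auto intro: nonneg_Reals_mult_I)
  show ?thesis unfolding weight_eq_prod_det
  proof (rule prod)
    fix m assume "m \<in> {1..12 * N}"
    then show "Determinant.det (Matrix.mat (3 * n) (3 * n)
      (\<lambda>(j, k). R m (path_pos N n C (m - 1) j) (path_pos N n C m k))) \<in> \<real>\<^sub>\<ge>\<^sub>0"
      by (intro det_fop_nonneg factor_pos path_pos_strict_mono[OF C]) auto
  qed
qed

text \<open>Bounds travel along the matchings that never go up: the starting heights bound all
  levels from above by forward induction, the end heights bound them from below by backward
  induction.\<close>

lemma weight_nonzero_window:
  assumes C: "C \<in> configs N n" and nz: "weight C \<noteq> 0"
  shows "C \<in> window_configs"
proof -
  have step: "\<exists>p. p permutes {0..<3 * n} \<and>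
      (\<forall>i<3 * n. path_pos N n C (Suc m) (p i) \<le> path_pos N n C m i)" if "m < 12 * N" for m
  proof -
    have "Suc m \<in> {1..12 * N}" using that by simp
    then have "Determinant.det (Matrix.mat (3 * n) (3 * n)
      (\<lambda>(j, k). R (Suc m) (path_pos N n C (Suc m - 1) j) (path_pos N n C (Suc m) k))) \<noteq> 0"
      using nz[unfolded weight_eq_prod_det prod_zero_iff[OF finite_atLeastAtMost]] by blast
    then show ?thesis by (rule det_fop_nonzero_obtains) auto
  qed
  have upper: "path_pos N n C m j \<le> 3 * int n - 1" if "m \<le> 12 * N" "j < 3 * n" for m j
    using that
  proof (induction m arbitrary: j)
    case (Suc m)
    obtain p where p: "p permutes {0..<3 * n}"
      "\<forall>i<3 * n. path_pos N n C (Suc m) (p i) \<le> path_pos N n C m i" using step[of m] Suc by auto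
    have "j \<in> p ` {0..<3 * n}" using permutes_image[OF p(1)] Suc.prems(2) by simp
    then obtain i where i: "i < 3 * n" "p i = j" by auto
    then have "path_pos N n C (Suc m) j \<le> path_pos N n C m i" using p(2) by auto
    also have "\<dots> \<le> 3 * int n - 1" using Suc i by simp
    finally show ?case .
  qed (simp add: path_pos_def)
  have lower: "- 6 * int N \<le> path_pos N n C (12 * N - d) j" if "d \<le> 12 * N" "j < 3 * n" for d j
    using that
  proof (induction d arbitrary: j)
    case 0
    then show ?case by (simp add: path_pos_end end_pos_def)
  next
    case (Suc d)
    obtain p where p: "p permutes {0..<3 * n}"
      "\<forall>i<3 * n. path_pos N n C (Suc (12 * N - Suc d)) (p i) \<le> path_pos N n C (12 * N - Suc d) i"
      using step[of "12 * N - Suc d"] Suc by auto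
    have "Suc (12 * N - Suc d) = 12 * N - d" using Suc.prems by simp
    then have "path_pos N n C (12 * N - d) (p j) \<le> path_pos N n C (12 * N - Suc d) j"
      using p(2) Suc.prems by auto
    moreover have "- 6 * int N \<le> path_pos N n C (12 * N - d) (p j)"
      using Suc permutes_image_lessThan[OF p(1), of j] by simp
    ultimately show ?case by simp
  qed
  have "u \<in> window" if mu: "(m, u) \<in> C" for m u
  proof -
    have m: "m \<in> {1..12 * N - 1}" using C mu by (auto simp: configs_def)
    have "u \<in> nth_elem (levels C m) ` {0..<3 * n}"
      using bij_betw_imp_surj_on[OF bij_betw_nth_elem[OF config_level[OF C m]]] mu
      by (simp add: levels_def)
    then obtain j where j: "j < 3 * n" "nth_elem (levels C m) j = u" by auto
    have m': "0 < m" "m < 12 * N" using m by auto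
    have eq: "path_pos N n C m j = u" using j(2) m' by (simp add: path_pos_eq level_pos_def)
    have "path_pos N n C m j \<le> 3 * int n - 1" by (rule upper) (use m' j(1) in simp_all)
    moreover have "- 6 * int N \<le> path_pos N n C (12 * N - (12 * N - m)) j"
      by (rule lower) (use j(1) in simp_all)
    ultimately show ?thesis using m' eq by (simp add: window_def)
  qed
  then show ?thesis using C by (auto simp: window_configs_def configs_def)
qed

lemma finite_window_configs: "finite window_configs"
proof (rule finite_subset)
  show "window_configs \<subseteq> Pow ({1..12 * N - 1} \<times> window)" by (auto simp: window_configs_def)
  show "finite (Pow ({1..12 * N - 1} \<times> window))" by (simp add: window_def)
qed

text \<open>Outside 1, ..., 12 N - 1 the levels of a configuration are empty whereas a restricted
  family is \<open>undefined\<close> there, so \<open>P\<close> is evaluated on the family completed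
  by empty levels.\<close>

lemma sum_window_configs:
  "(\<Sum>C | C \<in> window_configs \<and> P (levels C). weight C) =
   (\<Sum>s | s \<in> {1..<12 * N} \<rightarrow>\<^sub>E {S. S \<subseteq> window \<and> card S = 3 * n} \<and> P (\<lambda>m. if m \<in> {1..<12 * N} then s m else {}).
      chain_weight (3 * n) R start_pos end_pos (12 * N) s)"
proof (rule sum.reindex_bij_witness[where i="Sigma {1..<12 * N}" and j="\<lambda>C. restrict (levels C) {1..<12 * N}"])
  have I: "{1..12 * N - 1} = {1..<12 * N}" by auto
  have cw: "chain_weight (3 * n) R start_pos end_pos (12 * N) (restrict s {1..<12 * N}) =
      chain_weight (3 * n) R start_pos end_pos (12 * N) s" for s
    unfolding chain_weight_def
    by (intro arg_cong2[where f="(*)"] prod.cong refl det_mat_cong) (use N in \<open>auto simp: level_pos_def\<close>)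
  {
    fix C assume C: "C \<in> {C. C \<in> window_configs \<and> P (levels C)}"
    then have sub: "C \<subseteq> {1..<12 * N} \<times> window" unfolding window_configs_def I by blast
    then have lev: "(\<lambda>m. if m \<in> {1..<12 * N} then restrict (levels C) {1..<12 * N} m else {}) = levels C"
      by (auto simp: fun_eq_iff levels_def)
    show "Sigma {1..<12 * N} (restrict (levels C) {1..<12 * N}) = C"
      using sub by (auto simp: levels_def)
    have "levels C m \<subseteq> window" for m using sub by (auto simp: levels_def)
    moreover have "card (levels C m) = 3 * n" if "m \<in> {1..<12 * N}" for m
      using config_level(2)[of C m] C that I by (auto simp: window_configs_def)
    ultimately show "restrict (levels C) {1..<12 * N} \<in> {s. s \<in> {1..<12 * N} \<rightarrow>\<^sub>E {S. S \<subseteq> window \<and> card S = 3 * n} \<and>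
        P (\<lambda>m. if m \<in> {1..<12 * N} then s m else {})}"
      using C unfolding mem_Collect_eq lev by simp
    show "chain_weight (3 * n) R start_pos end_pos (12 * N) (restrict (levels C) {1..<12 * N}) = weight C"
      unfolding cw weight_eq_chain_weight ..
  }
  {
    fix s assume s: "s \<in> {s. s \<in> {1..<12 * N} \<rightarrow>\<^sub>E {S. S \<subseteq> window \<and> card S = 3 * n} \<and>
        P (\<lambda>m. if m \<in> {1..<12 * N} then s m else {})}"
    have lev: "levels (Sigma {1..<12 * N} s) = (\<lambda>m. if m \<in> {1..<12 * N} then s m else {})"
      by (auto simp: levels_def fun_eq_iff)
    then show "restrict (levels (Sigma {1..<12 * N} s)) {1..<12 * N} = s"
      using s by (auto simp: fun_eq_iff PiE_def extensional_def)
    have sm: "s m \<subseteq> window \<and> card (s m) = 3 * n" if "m \<in> {1..<12 * N}" for m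
      using s that by auto
    have fin: "finite (s m)" if "m \<in> {1..<12 * N}" for m
      using sm[OF that] finite_subset[of "s m" window] by (simp add: window_def)
    have "card {u. (m, u) \<in> Sigma {1..<12 * N} s} = 3 * n" if "m \<in> {1..<12 * N}" for m
    proof -
      have "{u. (m, u) \<in> Sigma {1..<12 * N} s} = s m" using that by blast
      then show ?thesis using sm[OF that] by simp
    qed
    then have "Sigma {1..<12 * N} s \<in> configs N n"
      unfolding configs_def I using fin by blast
    moreover have "Sigma {1..<12 * N} s \<subseteq> {1..12 * N - 1} \<times> window"
      unfolding I using sm by blast
    moreover have "P (levels (Sigma {1..<12 * N} s))" unfolding lev using s by blast
    ultimately show "Sigma {1..<12 * N} s \<in> {C. C \<in> window_configs \<and> P (levels C)}"
      unfolding window_configs_def by blast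
  }
qed

lemma weight_sum_pos: "0 < Re (\<Sum>C\<in>window_configs. weight C)"
proof -
  \<comment> \<open>All paths move in parallel, one step down at each \<open>MF\<close> and none at
    each \<open>NF\<close>. After m symbols they have descended by (m + 1) div 2, which is 6 N at
    the end, as the end positions require.\<close>
  define s where "s m = {- int ((m + 1) div 2)..<- int ((m + 1) div 2) + int (3 * n)}" for m :: nat
  define C where "C = Sigma {1..12 * N - 1} s"
  have lev: "levels C m = s m" if "m \<in> {1..12 * N - 1}" for m
    using that by (auto simp: levels_def C_def)
  have cs: "card (s m) = 3 * n" for m by (simp add: s_def)
  have Cc: "C \<in> configs N n"
    using cs lev[unfolded levels_def] by (auto simp: configs_def C_def s_def)
  have pp: "path_pos N n C m i = int i - int ((m + 1) div 2)" if le: "m \<le> 12 * N" and i: "i < 3 * n" for m i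
  proof -
    consider "m = 0" | "m = 12 * N" | "m \<in> {1..12 * N - 1}" using le by fastforce
    then show ?thesis
    proof cases
      case 2
      then have "(m + 1) div 2 = 6 * N" by simp
      then show ?thesis using 2 by (simp add: path_pos_end end_pos_def)
    next
      case 3
      then have "path_pos N n C m i = nth_elem (s m) i"
        using lev by (auto simp: path_pos_eq level_pos_def)
      then show ?thesis unfolding s_def nth_elem_interval[OF i] by simp
    qed (simp add: path_pos_def)
  qed
  have posdet: "0 < Re (Determinant.det (Matrix.mat (3 * n) (3 * n)
      (\<lambda>(j, k). R m (path_pos N n C (m - 1) j) (path_pos N n C m k))))" if m: "m \<in> {1..12 * N}" for m
  proof -
    obtain a where a: "level_factor \<alpha> \<beta> m = MF a \<or> level_factor \<alpha> \<beta> m = NF a" "a 0 > 0" "a 1 > 0" "a 2 > 0"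
      using factor_pos[of m] unfolding pos_factor_def by blast
    from a(1) show ?thesis
    proof
      assume M: "level_factor \<alpha> \<beta> m = MF a"
      then have "odd m" by (auto simp: level_factor_def split: if_splits) presburger+
      then have half: "(m + 1) div 2 = (m - 1 + 1) div 2 + 1" using m by (auto elim!: oddE)
      have "Determinant.det (Matrix.mat (3 * n) (3 * n)
        (\<lambda>(j, k). R m (path_pos N n C (m - 1) j) (path_pos N n C m k))) =
        (\<Prod>i=0..<3 * n. R m (path_pos N n C (m - 1) i) (path_pos N n C m i))"
        unfolding M using m by (intro det_MF path_pos_strict_mono[OF Cc]) auto
      also have "\<dots> = (\<Prod>i=0..<3 * n. of_real (step_wt a (path_pos N n C (m - 1) i)))"
      proof (rule prod.cong[OF refl])
        fix i assume "i \<in> {0..<3 * n}"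
        then have "path_pos N n C m i = path_pos N n C (m - 1) i - 1"
          using pp[of m i] pp[of "m - 1" i] m half by (simp add: le_diff_conv)
        then show "R m (path_pos N n C (m - 1) i) (path_pos N n C m i) =
          of_real (step_wt a (path_pos N n C (m - 1) i))" by (simp add: M)
      qed
      also have "\<dots> = of_real (\<Prod>i=0..<3 * n. step_wt a (path_pos N n C (m - 1) i))" by simp
      finally have "Determinant.det (Matrix.mat (3 * n) (3 * n)
        (\<lambda>(j, k). R m (path_pos N n C (m - 1) j) (path_pos N n C m k))) =
        of_real (\<Prod>i=0..<3 * n. step_wt a (path_pos N n C (m - 1) i))" .
      moreover have "(\<Prod>i=0..<3 * n. step_wt a (path_pos N n C (m - 1) i)) > 0"
        by (intro prod_pos) (simp add: step_wt_pos[of a, OF a(2-4)])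
      ultimately show ?thesis by (simp only: Re_complex_of_real)
    next
      assume M: "level_factor \<alpha> \<beta> m = NF a"
      then have "even m" by (auto simp: level_factor_def split: if_splits) presburger+
      then have half: "(m + 1) div 2 = (m - 1 + 1) div 2" using m by (auto elim!: evenE)
      have "Determinant.det (Matrix.mat (3 * n) (3 * n) (\<lambda>(i, j). if path_pos N n C m j \<le>
          path_pos N n C (m - 1) i then 1 else (0 :: complex))) = 1"
        by (rule det_staircase_triangular) (use pp[of m] pp[of "m - 1"] m half in \<open>simp add: le_diff_conv\<close>)
      then have "Determinant.det (Matrix.mat (3 * n) (3 * n)
        (\<lambda>(j, k). R m (path_pos N n C (m - 1) j) (path_pos N n C m k))) =
        of_real ((\<Prod>i=0..<3 * n. period_wt a (path_pos N n C (m - 1) i)) *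
          (\<Prod>i=0..<3 * n. 1 / period_wt a (path_pos N n C m i)))"
        unfolding M det_NF by simp
      moreover have "(\<Prod>i=0..<3 * n. period_wt a (path_pos N n C (m - 1) i)) *
          (\<Prod>i=0..<3 * n. 1 / period_wt a (path_pos N n C m i)) > 0"
        using period_wt_pos[of a, OF a(2,3)] by (intro mult_pos_pos prod_pos) auto
      ultimately show ?thesis by (simp only: Re_complex_of_real)
    qed
  qed
  have "weight C \<noteq> 0"
    unfolding weight_eq_prod_det using posdet by (auto simp: prod_zero_iff) (metis less_irrefl zero_complex.sel(1))
  then have CW: "C \<in> window_configs" and "weight C \<noteq> 0" using weight_nonzero_window[OF Cc] by auto
  then have "Re (weight C) > 0"
    using weight_nonneg[OF Cc] by (auto simp: complex_nonneg_Reals_iff complex_eq_iff)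
  moreover have "Re (weight D) \<ge> 0" if "D \<in> window_configs" for D
    using weight_nonneg[of D] that by (auto simp: window_configs_def complex_nonneg_Reals_iff)
  ultimately show ?thesis
    unfolding Re_sum using CW finite_window_configs by (intro sum_pos2[of _ C]) auto
qed

text \<open>There are in general infinitely many configurations, but only the finitely many in the
  window can carry mass, so the normalised point measure is a quotient of finite sums with positive
  denominator.\<close>

lemma measure_path_measure:
  "complex_of_real (Sigma_Algebra.measure (path_measure \<alpha> \<beta> N n) {C \<in> configs N n. P C}) =
     (\<Sum>C | C \<in> window_configs \<and> P C. weight C) / (\<Sum>C\<in>window_configs. weight C)"
proof -
  define W where "W = point_measure (configs N n) (\<lambda>C. ennreal (Re (weight C)))"
  have Re0: "Re (weight D) \<ge> 0" "Im (weight D) = 0" if "D \<in> configs N n" for D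
    using weight_nonneg[OF that] by (auto simp: complex_nonneg_Reals_iff)
  have pos_iff: "0 < Re (weight D) \<Longrightarrow> D \<in> configs N n \<Longrightarrow> D \<in> window_configs" for D
    using weight_nonzero_window[of D] by (cases "weight D = 0") auto
  have em: "emeasure W {C \<in> configs N n. P C} = ennreal (\<Sum>C | C \<in> window_configs \<and> P C. Re (weight C))" for P
  proof -
    have eq: "{C \<in> {C \<in> configs N n. P C}. 0 < ennreal (Re (weight C))} =
       {C \<in> {C. C \<in> window_configs \<and> P C}. 0 < Re (weight C)}"
      using pos_iff by (auto simp: window_configs_def)
    have fin: "finite {C. C \<in> window_configs \<and> P C}" using finite_window_configs by simp
    have "emeasure W {C \<in> configs N n. P C} =
       (\<Sum>C\<in>{C \<in> {C \<in> configs N n. P C}. 0 < ennreal (Re (weight C))}. ennreal (Re (weight C)))"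
    proof -
      have "finite {C \<in> {C \<in> configs N n. P C}. 0 < ennreal (Re (weight C))}"
        unfolding eq by (rule finite_subset[OF _ fin]) blast
      then show ?thesis unfolding W_def by (rule emeasure_point_measure) blast
    qed
    also have "\<dots> = ennreal (\<Sum>C\<in>{C \<in> {C. C \<in> window_configs \<and> P C}. 0 < Re (weight C)}. Re (weight C))"
      unfolding eq by (rule sum_ennreal) auto
    also have "(\<Sum>C\<in>{C \<in> {C. C \<in> window_configs \<and> P C}. 0 < Re (weight C)}. Re (weight C)) =
       (\<Sum>C | C \<in> window_configs \<and> P C. Re (weight C))"
      by (rule sum.mono_neutral_left[OF fin])
         (use Re0 in \<open>force simp: window_configs_def not_less intro: antisym\<close>)+
    finally show ?thesis .
  qed
  define z where "z = (\<Sum>C\<in>window_configs. Re (weight C))"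
  define e where "e = (\<Sum>C | C \<in> window_configs \<and> P C. Re (weight C))"
  have z: "z > 0" using weight_sum_pos by (simp add: z_def)
  have e: "e \<ge> 0" unfolding e_def by (rule sum_nonneg) (use Re0 in \<open>auto simp: window_configs_def\<close>)
  have sp: "emeasure W (space W) = ennreal z"
    using em[of "\<lambda>_. True"] by (simp add: W_def space_point_measure z_def)
  have "emeasure (path_measure \<alpha> \<beta> N n) {C \<in> configs N n. P C} = 1 / ennreal z * ennreal e"
    unfolding path_measure_def W_def[symmetric] Let_def emeasure_scale_measure sp em e_def ..
  also have "\<dots> = ennreal (1 / z) * ennreal e"
    using divide_ennreal[of 1 z] z by simp
  also have "\<dots> = ennreal (e / z)"
    using z e by (simp add: ennreal_mult[symmetric])
  finally have "Sigma_Algebra.measure (path_measure \<alpha> \<beta> N n) {C \<in> configs N n. P C} = e / z"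
    using z e by (simp add: Sigma_Algebra.measure_def)
  moreover have "(\<Sum>C\<in>A. weight C) = of_real (\<Sum>C\<in>A. Re (weight C))" if "A \<subseteq> window_configs" for A
    unfolding of_real_sum
    by (rule sum.cong[OF refl]) (use Re0 that in \<open>auto simp: window_configs_def complex_eq_iff\<close>)
  ultimately show ?thesis
    unfolding e_def z_def by (subst (1 2) \<open>\<And>A. A \<subseteq> window_configs \<Longrightarrow> _\<close>) auto
qed

end

section \<open>The kernel\<close>

lemma level_factor_mod: "level_factor \<alpha> \<beta> m = level_factor \<alpha> \<beta> (m mod 4)"
  by (simp add: level_factor_def)

text \<open>The offset 12 a is a multiple of the period 4 and drops out; every 12 levels append one
  more copy of the word.\<close>

lemma map_level_factor:
  "map (\<lambda>j. level_factor \<alpha> \<beta> (12 * a + j)) [1..<12 * k + 1] = wpow (P_word \<alpha> \<beta>) k"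
proof (induction k)
  case (Suc k)
  define b where "b = 12 * k"
  have b4: "(12 * a + (b + c)) mod 4 = c mod 4" for c
  proof -
    have "12 * a + (b + c) = c + 4 * (3 * a + 3 * k)" by (simp add: b_def)
    then show ?thesis by (simp only: mod_mult_self2)
  qed
  have lf: "level_factor \<alpha> \<beta> (12 * a + (b + c)) = level_factor \<alpha> \<beta> (c mod 4)" for c
    by (subst level_factor_mod) (simp only: b4)
  have "[1..<12 * Suc k + 1] = [1..<b + 1] @ [b + 1..<b + 1 + 12]"
    unfolding b_def by (subst upt_add_eq_append[symmetric]) (auto intro: arg_cong2[where f=upt])
  moreover have "[b + 1..<b + 1 + 12] = map (\<lambda>c. b + c) [1..<13]"
    by (rule nth_equalityI) auto
  moreover have "map (\<lambda>c. level_factor \<alpha> \<beta> (12 * a + (b + c))) [1..<13] = P_word \<alpha> \<beta>"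
  proof -
    have "[1..<13::nat] = [1, 2, 3, 4, 5, 6, 7, 8, 9, 10, 11, 12]"
      by (simp add: numeral_eq_Suc)
    moreover have "P_word \<alpha> \<beta> = [MF \<alpha>, NF \<alpha>, MF \<beta>, NF \<beta>, MF \<alpha>, NF \<alpha>, MF \<beta>, NF \<beta>,
        MF \<alpha>, NF \<alpha>, MF \<beta>, NF \<beta>]"
      by (simp add: P_word_def numeral_3_eq_3)
    ultimately show ?thesis unfolding lf by (simp add: level_factor_def)
  qed
  moreover have "wpow (P_word \<alpha> \<beta>) (Suc k) = wpow (P_word \<alpha> \<beta>) k @ P_word \<alpha> \<beta>"
  proof -
    have "replicate (Suc k) (P_word \<alpha> \<beta>) = replicate k (P_word \<alpha> \<beta>) @ [P_word \<alpha> \<beta>]"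
      by (simp add: replicate_append_same)
    then show ?thesis by (simp only: wpow_def concat_append concat.simps append_Nil2)
  qed
  ultimately show ?case using Suc.IH by (simp add: b_def o_def)
qed (simp add: wpow_def)

lemma separating_contourI:
  assumes \<gamma>: "pos_simple_closed_contour \<gamma>" and i: "0 \<in> inside (path_image \<gamma>)" "1 \<in> inside (path_image \<gamma>)"
    and o: "- 1 \<in> outside (path_image \<gamma>)"
  shows "separating_contour \<gamma>"
proof
  show "valid_path \<gamma>" "pathfinish \<gamma> = pathstart \<gamma>" "winding_number \<gamma> 0 = 1" "winding_number \<gamma> 1 = 1"
    using \<gamma> i by (auto simp: pos_simple_closed_contour_def)
  show "path_image \<gamma> \<inter> {0, 1, - 1} = {}"
    using i o inside_no_overlap[of "path_image \<gamma>"] outside_no_overlap[of "path_image \<gamma>"] by blast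
  show "winding_number \<gamma> (- 1) = 0"
    using winding_number_zero_in_outside[OF _ _ o] \<gamma>
    by (auto simp: pos_simple_closed_contour_def valid_path_imp_path)
qed

section \<open>The words of the kernel and its identification with the contour integrals\<close>

context aztec_weights
begin

definition "cc = c_coeff \<alpha> \<beta>"
definition "Aw = A_word cc \<alpha> \<beta>"
definition "Bw = B_word cc \<alpha> \<beta>"
definition "Pw = P_word \<alpha> \<beta>"

text \<open>The factor of the double integral in w, A^(N - m) B^(-m); \<open>Q_word\<close> is the
  one in z. The subtraction is that of natural numbers, so both are meant for m \<le> N.\<close>

definition S_word :: "nat \<Rightarrow> factor list" where
  "S_word m = wpow Aw (N - m) @ wpow (winv Bw) m"

definition Q_word :: "nat \<Rightarrow> factor list" where
  "Q_word m = wpow (winv Aw) (N - m) @ wpow Bw m"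

lemma cc_prod: "cc 0 * cc 1 * cc 2 = 1"
  using pos by (simp add: cc_def c_coeff_def)

lemma cc_balanced: "balanced cc \<alpha> \<beta>"
  using pos by (simp add: balanced_def cc_def c_coeff_def)

lemma A_mat_eq: "A_mat \<alpha> \<beta> z = wsym Aw z"
  by (simp add: A_mat_def Aw_def A_word_def wsym_Cons cyc_def Let_def matrix_mul_assoc flip: cc_def)

lemma B_mat_eq: "B_mat \<alpha> \<beta> z = wsym Bw z"
  by (simp add: B_mat_def Bw_def B_word_def wsym_Cons cyc_def Let_def matrix_mul_assoc flip: cc_def)

lemma fdet_words: "x \<in> set Aw \<union> set Bw \<union> set Pw \<Longrightarrow> fdet x = 1"
proof -
  have c: "cyc cc a 0 * cyc cc a 1 * cyc cc a 2 = a 0 * a 1 * a 2" for a by (rule cyc_prod[OF cc_prod])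
  assume "x \<in> set Aw \<union> set Bw \<union> set Pw"
  then show ?thesis
    by (auto simp: Aw_def Bw_def Pw_def A_word_def B_word_def P_word_def c prod simp del: One_nat_def)
qed

lemma fdet_winv: "x \<in> set (winv ws) \<Longrightarrow> (\<And>y. y \<in> set ws \<Longrightarrow> fdet y = 1) \<Longrightarrow> fdet x = -1"
  by (auto simp: winv_def fdet_finv)

lemma commuting:
  assumes z: "z \<notin> {0, 1, -1}"
  shows "commuting_pair (wsym Aw z) (wsym Bw z) (wsym (winv Aw) z) (wsym (winv Bw) z) (wsym Pw z) (wsym (winv Pw) z)"
proof
  show "wsym Aw z ** wsym Bw z = wsym Pw z" "wsym Bw z ** wsym Aw z = wsym Pw z"
    unfolding Aw_def Bw_def Pw_def by (rule P_word_factorization[OF z cc_prod cc_balanced prod])+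
qed (use winv_inverse[OF z] fdet_words in auto)

lemma hol_word: "(\<And>x. x \<in> set ws \<Longrightarrow> fdet x \<in> {1, -1}) \<Longrightarrow> hol3 (- {0, 1, -1}) (wsym ws)"
proof (rule hol3_wsym)
  fix a assume "\<And>x. x \<in> set ws \<Longrightarrow> fdet x \<in> {1, -1}" "NF a \<in> set ws"
  then have "a 0 * a 1 * a 2 \<in> {1, -1}" by force
  then show "complex_of_real (a 0 * a 1 * a 2) \<notin> - {0, 1, - 1}"
    by (elim insertE) (simp_all only: of_real_minus of_real_1, auto)
qed auto

lemma hol_S: "hol3 (- {0, 1, -1}) (wsym (S_word m))"
proof (rule hol_word)
  fix x assume "x \<in> set (S_word m)"
  then have "x \<in> set Aw \<or> x \<in> set (winv Bw)"
    using set_wpow[of Aw] set_wpow[of "winv Bw"] by (auto simp: S_word_def)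
  then show "fdet x \<in> {1, -1}" using fdet_words fdet_winv[of x Bw] by auto
qed

lemma MF_words: "list_all is_MF (wpow (winv Aw) k)" "list_all is_MF (wpow Bw k)" "list_all is_MF (Q_word m)"
proof -
  have 1: "list_all is_MF (winv Aw)" "list_all is_MF Bw"
    by (simp_all add: winv_def Aw_def Bw_def A_word_def B_word_def is_MF_def)
  then show 2: "list_all is_MF (wpow (winv Aw) k)" "list_all is_MF (wpow Bw k)" for k
    using set_wpow by (fastforce simp: list_all_iff)+
  show "list_all is_MF (Q_word m)" by (simp add: Q_word_def 2)
qed

lemma NF_Pw: "NF a \<in> set (wpow Pw k) \<Longrightarrow> a 0 * a 1 * a 2 = 1"
  using set_wpow[of Pw k] fdet_words[of "NF a"] by auto

lemma NF_MF_word: "list_all is_MF ws \<Longrightarrow> NF a \<notin> set ws"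
  by (auto simp: list_all_iff is_MF_def)

lemma length_words: "length (wpow (winv Aw) k) = 6 * k" "length (wpow Bw k) = 6 * k"
  by (simp_all add: length_wpow winv_def Aw_def Bw_def A_word_def B_word_def)

lemma matrix_powi_S:
  assumes z: "z \<notin> {0, 1, -1}" and m: "m \<le> N"
  shows "matrix_powi (A_mat \<alpha> \<beta> z) (int N - int m) ** matrix_powi (B_mat \<alpha> \<beta> z) (- int m) = wsym (S_word m) z"
proof -
  interpret commuting_pair "wsym Aw z" "wsym Bw z" "wsym (winv Aw) z" "wsym (winv Bw) z" "wsym Pw z" "wsym (winv Pw) z"
    by (rule commuting[OF z])
  have "int N - int m = int (N - m)" using m by simp
  then show ?thesis
    by (simp add: A_mat_eq B_mat_eq matrix_powi_nat matrix_powi_neg[OF B] S_word_def wsym_append wsym_wpow del: of_nat_diff)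
qed

lemma matrix_powi_Q:
  assumes z: "z \<notin> {0, 1, -1}" and m: "m \<le> N"
  shows "matrix_powi (A_mat \<alpha> \<beta> z) (int m - int N) ** matrix_powi (B_mat \<alpha> \<beta> z) (int m) = wsym (Q_word m) z"
proof -
  interpret commuting_pair "wsym Aw z" "wsym Bw z" "wsym (winv Aw) z" "wsym (winv Bw) z" "wsym Pw z" "wsym (winv Pw) z"
    by (rule commuting[OF z])
  have "int m - int N = - int (N - m)" using m by simp
  then show ?thesis
    by (simp add: A_mat_eq B_mat_eq matrix_powi_nat matrix_powi_neg[OF A] Q_word_def wsym_append wsym_wpow del: of_nat_diff)
qed

lemma matrix_powi_P:
  assumes z: "z \<notin> {0, 1, -1}" and m: "m' \<le> m"
  shows "matrix_powi (A_mat \<alpha> \<beta> z) (int m - int m') ** matrix_powi (B_mat \<alpha> \<beta> z) (int m - int m') =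
    wsym (wpow Pw (m - m')) z"
proof -
  interpret commuting_pair "wsym Aw z" "wsym Bw z" "wsym (winv Aw) z" "wsym (winv Bw) z" "wsym Pw z" "wsym (winv Pw) z"
    by (rule commuting[OF z])
  have "int m - int m' = int (m - m')" using m by simp
  then show ?thesis
    by (simp add: A_mat_eq B_mat_eq matrix_powi_nat wsym_wpow mpow_P del: of_nat_diff)
qed

text \<open>The contour formula becomes a finite expression in matrix entries: the double integral
  by \<open>double_contour_integral\<close>, the single one because (A B)^(m - m') has the contour
  coefficients of a power of the periodic word.\<close>

lemma K_limit_eq:
  assumes i: "separating_contour \<gamma>" and e: "separating_contour \<gamma>'"
    and sep: "\<And>w. w \<in> path_image \<gamma> \<Longrightarrow> w \<notin> path_image \<gamma>' \<and> winding_number \<gamma>' w = 1"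
    and m: "m \<le> N" "m' \<le> N"
  shows "K_limit \<alpha> \<beta> N \<gamma> \<gamma>' (12 * m, v) (12 * m', u) =
    (\<Sum>s\<in>{v..-1}. separating_contour.toep \<gamma> (wsym (S_word m')) u s * wop (Q_word m) s v) -
    (if m' < m then wop (wpow Pw (m - m')) u v else 0)"
proof -
  interpret i: separating_contour \<gamma> by (rule i)
  interpret e: separating_contour \<gamma>' by (rule e)
  have first: "- (if m > m' then 1 else 0) / (2 * of_real pi * \<i>) *
         contour_integral \<gamma> (\<lambda>z.
           (matrix_powi (A_mat \<alpha> \<beta> z) (int m - int m') **
            matrix_powi (B_mat \<alpha> \<beta> z) (int m - int m')) $ block_index u $ block_index v
           * z powi (u div 3 - v div 3) / z) = - (if m' < m then wop (wpow Pw (m - m')) u v else 0)"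
  proof (cases "m' < m")
    case True
    have "contour_integral \<gamma> (\<lambda>z.
           (matrix_powi (A_mat \<alpha> \<beta> z) (int m - int m') **
            matrix_powi (B_mat \<alpha> \<beta> z) (int m - int m')) $ block_index u $ block_index v
           * z powi (u div 3 - v div 3) / z) =
        contour_integral \<gamma> (\<lambda>z. ent (wsym (wpow Pw (m - m')) z) z u v / z)"
    proof (rule contour_integral_cong[OF refl])
      fix z assume "z \<in> path_image \<gamma>"
      then have z: "z \<notin> {0, 1, -1}" using i.on_path by auto
      show "(matrix_powi (A_mat \<alpha> \<beta> z) (int m - int m') **
            matrix_powi (B_mat \<alpha> \<beta> z) (int m - int m')) $ block_index u $ block_index v
           * z powi (u div 3 - v div 3) / z = ent (wsym (wpow Pw (m - m')) z) z u v / z"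
        using True by (subst matrix_powi_P[OF z]) (simp_all add: ent_def)
    qed
    also have "\<dots> = 2 * of_real pi * \<i> * wop (wpow Pw (m - m')) u v"
      using i.toep_wsym[where ws="wpow Pw (m - m')" and u=u and v=v, OF NF_Pw] by (simp add: i.toep_def field_simps)
    finally show ?thesis using True by simp
  qed simp
  have "contour_integral \<gamma> (\<lambda>w. contour_integral \<gamma>' (\<lambda>z.
           (matrix_powi (A_mat \<alpha> \<beta> w) (int N - int m') **
            matrix_powi (B_mat \<alpha> \<beta> w) (- int m') **
            matrix_powi (A_mat \<alpha> \<beta> z) (int m - int N) **
            matrix_powi (B_mat \<alpha> \<beta> z) (int m)) $ block_index u $ block_index v
           * (w powi (u div 3) / z powi (v div 3 + 1)) / (z - w))) =
     contour_integral \<gamma> (\<lambda>w. contour_integral \<gamma>' (\<lambda>z.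
      (wsym (S_word m') w ** wsym (Q_word m) z) $ block_index u $ block_index v *
      (w powi (u div 3) / z powi (v div 3 + 1)) / (z - w)))"
  proof (rule contour_integral_cong[OF refl], rule contour_integral_cong[OF refl])
    fix w z assume "w \<in> path_image \<gamma>" "z \<in> path_image \<gamma>'"
    then have w: "w \<notin> {0, 1, -1}" and z: "z \<notin> {0, 1, -1}" using i.on_path e.on_path by auto
    show "(matrix_powi (A_mat \<alpha> \<beta> w) (int N - int m') **
            matrix_powi (B_mat \<alpha> \<beta> w) (- int m') **
            matrix_powi (A_mat \<alpha> \<beta> z) (int m - int N) **
            matrix_powi (B_mat \<alpha> \<beta> z) (int m)) $ block_index u $ block_index v
           * (w powi (u div 3) / z powi (v div 3 + 1)) / (z - w) =
      (wsym (S_word m') w ** wsym (Q_word m) z) $ block_index u $ block_index v *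
      (w powi (u div 3) / z powi (v div 3 + 1)) / (z - w)"
      unfolding matrix_powi_S[OF w m(2), symmetric] matrix_powi_Q[OF z m(1), symmetric]
      by (simp only: matrix_mul_assoc)
  qed
  with double_contour_integral[OF i e sep hol_S[of m'] MF_words(3)[of m], of u v] first
  show ?thesis
    unfolding K_limit_def K_block_def by simp
qed

text \<open>Invariance under shifts by whole blocks is read off from contour coefficients, where it
  is immediate.\<close>

lemma wop_shift:
  assumes i: "separating_contour \<gamma>" and "\<And>a. NF a \<in> set ws \<Longrightarrow> a 0 * a 1 * a 2 = 1"
  shows "wop ws (u + 3 * k) (v + 3 * k) = wop ws u v"
proof -
  interpret i: separating_contour \<gamma> by (rule i)
  show ?thesis using i.toep_shift[of "wsym ws" u k v] i.toep_wsym[of ws, OF assms(2)] by simp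
qed

text \<open>\<open>\<beta>'\<close> is the row attached to the point at level 12 m' and height u.
  The first identity evaluates it against the transition to level 12 m, the second shows that it
  solves the linear system. The bound on x holds for all end heights -6 N + j with j < 3 n, with
  equality at the topmost.\<close>

lemma kernel_rows:
  assumes i: "separating_contour \<gamma>" and n: "2 * N \<le> n" and m: "m \<le> N" "m' \<le> N" and u: "0 \<le> u"
  defines "\<beta>' \<equiv> \<lambda>y. \<Sum>s\<in>{y..3 * int n - 1}. separating_contour.toep \<gamma> (wsym (S_word m')) u s * wop (wpow (winv Aw) N) s y"
  shows "(\<Sum>y\<in>{0..3 * int n - 1}. \<beta>' y * wop (wpow Pw m) y x) =
      (\<Sum>s\<in>{x..3 * int n - 1}. separating_contour.toep \<gamma> (wsym (S_word m')) u s * wop (Q_word m) s x)"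
    and "x + 6 * int N \<le> 3 * int n - 1 \<Longrightarrow>
      (\<Sum>y\<in>{0..3 * int n - 1}. \<beta>' y * wop (wpow Pw N) y x) = wop (wpow Pw (N - m')) u x"
proof -
  interpret i: separating_contour \<gamma> by (rule i)
  have E: "regular_inside (\<lambda>z. mpow (wsym (winv Pw) z) m')"
    unfolding Pw_def by (intro regular_inside_mpow regular_inside_winv_P_word prod)
  have SA: "wsym (S_word m') z ** wsym (wpow (winv Aw) N) z = mpow (wsym (winv Pw) z) m'"
    if "z \<notin> {0, 1, -1}" for z
    using commuting_pair.mpow_ABA[OF commuting[OF that] m(2)]
    by (simp add: S_word_def wsym_append wsym_wpow)
  have rows: "(\<Sum>y\<in>{0..3 * int n - 1}. \<beta>' y * wop (wpow Pw m) y x) =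
      (\<Sum>s\<in>{x..3 * int n - 1}. i.toep (wsym (S_word m')) u s * wop (Q_word m) s x)" if m: "m \<le> N" for m
    unfolding \<beta>'_def
  \<comment> \<open>The condition 2 N \<le> n enters here: the band of the 6 N factors of A^-N has
    length at most (3 n - 1) + 1.\<close>
  proof (rule i.inverse_row[OF hol_S MF_words(1) MF_words(3) NF_Pw _ SA E _ u])
    fix z :: complex assume z: "z \<notin> {0, 1, -1}"
    show "wsym (wpow (winv Aw) N) z ** wsym (wpow Pw m) z = wsym (Q_word m) z"
      using commuting_pair.mpow_AP[OF commuting[OF z] m] by (simp add: Q_word_def wsym_append wsym_wpow)
  qed (use n in \<open>auto simp: length_words\<close>)
  show "(\<Sum>y\<in>{0..3 * int n - 1}. \<beta>' y * wop (wpow Pw m) y x) =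
      (\<Sum>s\<in>{x..3 * int n - 1}. i.toep (wsym (S_word m')) u s * wop (Q_word m) s x)"
    by (rule rows[OF m(1)])
  assume x: "x + 6 * int N \<le> 3 * int n - 1"
  have Q: "Q_word N = wpow Bw N" by (simp add: Q_word_def wpow_def)
  \<comment> \<open>The bound on x puts the band of B^N below the top height, so the truncated sum
    is a full Toeplitz coefficient.\<close>
  have "(\<Sum>y\<in>{0..3 * int n - 1}. \<beta>' y * wop (wpow Pw N) y x) =
      i.toep (\<lambda>z. wsym (S_word m') z ** wsym (wpow Bw N) z) u x"
    unfolding rows[OF order_refl] Q
    by (rule i.toep_mult_wsym[OF hol_S MF_words(2), symmetric]) (use x in \<open>simp add: length_words\<close>)
  also have "\<dots> = i.toep (wsym (wpow Pw (N - m'))) u x"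
  proof (rule i.toep_cong)
    fix z :: complex assume z: "z \<notin> {0, 1, -1}"
    show "wsym (S_word m') z ** wsym (wpow Bw N) z = wsym (wpow Pw (N - m')) z"
      using commuting_pair.mpow_ABB[OF commuting[OF z] m(2)] by (simp add: S_word_def wsym_append wsym_wpow)
  qed
  also have "\<dots> = wop (wpow Pw (N - m')) u x" by (rule i.toep_wsym[OF NF_Pw])
  finally show "(\<Sum>y\<in>{0..3 * int n - 1}. \<beta>' y * wop (wpow Pw N) y x) = wop (wpow Pw (N - m')) u x" .
qed

lemma chain_window:
  assumes "u \<in> window" "v \<in> window"
  shows "chain window (\<lambda>j. R (12 * a + j)) (\<lambda>_ _. 1) u (12 * k) v = wop (wpow Pw k) u v"
  using chain_eq_wop[where l="\<lambda>j. level_factor \<alpha> \<beta> (12 * a + j)" and m="12 * k"] assms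
  unfolding window_def map_level_factor Pw_def by simp

lemma measure_points:
  assumes i: "separating_contour \<gamma>" and e: "separating_contour \<gamma>'"
    and sep: "\<And>w. w \<in> path_image \<gamma> \<Longrightarrow> w \<notin> path_image \<gamma>' \<and> winding_number \<gamma>' w = 1"
    and n: "2 * N \<le> n" and m: "\<And>k. k < L \<Longrightarrow> 0 < m k \<and> m k < N"
    and u: "\<And>k. k < L \<Longrightarrow> 0 \<le> 3 * int n + u k \<and> u k < int H"
    and inj: "inj_on (\<lambda>k. (12 * m k, u k)) {..<L}"
  shows "complex_of_real (Sigma_Algebra.measure (path_measure \<alpha> \<beta> N n)
            {C \<in> configs N n. \<forall>k<L. (12 * m k, 3 * int n + u k) \<in> C}) =
         Determinant.det (Matrix.mat L L (\<lambda>(k, l). K_limit \<alpha> \<beta> N \<gamma> \<gamma>' (12 * m k, u k) (12 * m l, u l)))"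
proof -
  interpret i: separating_contour \<gamma> by (rule i)
  define h where "h = 3 * int n - 1"
  define \<upsilon> where "\<upsilon> k = 3 * int n + u k" for k
  define b where "b l y = (\<Sum>s\<in>{y..h}. i.toep (wsym (S_word (m l))) (\<upsilon> l) s * wop (wpow (winv Aw) N) s y)" for l y
  \<comment> \<open>Transposed: the first index of the Eynard-Mehta kernel selects the row that
    solves the linear system, which in \<open>K_limit\<close> belongs to the second point. The
    determinant is transposed back at the end.\<close>
  define K where "K l l' = K_limit \<alpha> \<beta> N \<gamma> \<gamma>' (12 * m l', u l') (12 * m l, u l)" for l l'
  let ?T = "{1..<12 * N} \<rightarrow>\<^sub>E {S. S \<subseteq> window \<and> card S = 3 * n}"
  let ?w = "chain_weight (3 * n) R start_pos end_pos (12 * N)"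
  have \<upsilon>W: "\<upsilon> k \<in> window" if "k < L" for k using u[OF that] by (auto simp: \<upsilon>_def window_def)
  have startW: "start_pos j \<in> window" if "j < 3 * n" for j using that by (auto simp: start_pos_def window_def)
  have endW: "end_pos j \<in> window" if "j < 3 * n" for j using that by (auto simp: end_pos_def window_def)
  have reindex: "(\<Sum>j<3 * n. f (int j)) = (\<Sum>y\<in>{0..h}. f y)" for f :: "int \<Rightarrow> complex"
    by (rule sum.reindex_bij_witness[where i=nat and j=int]) (auto simp: h_def)
  have levels_of: "12 * m l' - 12 * m l = 12 * (m l' - m l)" "12 * N - 12 * m l = 12 * (N - m l)" for l l'
    by simp_all
  have EM: "(\<Sum>s | s \<in> ?T \<and> (\<forall>l<L. \<upsilon> l \<in> s (12 * m l)). ?w s) =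
      (\<Sum>s\<in>?T. ?w s) * Determinant.det (Matrix.mat L L (\<lambda>(l, l'). K l l'))"
  proof (rule Eynard_Mehta[where \<beta>="\<lambda>l j. b l (int j)"])
    show "finite window" by (simp add: window_def)
    show "1 \<le> 12 * N" using N by simp
    show "inj_on (\<lambda>l. (12 * m l, \<upsilon> l)) {..<L}"
      using inj by (auto simp: inj_on_def \<upsilon>_def)
    show "1 \<le> 12 * m l \<and> 12 * m l < 12 * N" if "l < L" for l using m[OF that] by simp
    fix l assume l: "l < L"
    have ml: "m l \<le> N" and ul: "0 \<le> \<upsilon> l" using m[OF l] u[OF l] by (auto simp: \<upsilon>_def)
    show "(\<Sum>i<3 * n. b l (int i) * chain window R (\<lambda>_ _. 1) (start_pos i) (12 * N) (end_pos j)) =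
       chain window (\<lambda>m'. R (12 * m l + m')) (\<lambda>_ _. 1) (\<upsilon> l) (12 * N - 12 * m l) (end_pos j)"
      if j: "j < 3 * n" for j
    proof -
      have "(\<Sum>i<3 * n. b l (int i) * chain window R (\<lambda>_ _. 1) (start_pos i) (12 * N) (end_pos j)) =
         (\<Sum>i<3 * n. b l (int i) * wop (wpow Pw N) (int i) (end_pos j))"
        using chain_window[of _ _ 0 N] startW endW[OF j] by (intro sum.cong) (auto simp: start_pos_def)
      also have "\<dots> = (\<Sum>y\<in>{0..h}. b l y * wop (wpow Pw N) y (end_pos j))"
        by (rule reindex)
      also have "\<dots> = wop (wpow Pw (N - m l)) (\<upsilon> l) (end_pos j)"
        unfolding b_def h_def
        by (rule kernel_rows(2)[OF i n ml ml ul]) (use j in \<open>auto simp: end_pos_def\<close>)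
      also have "\<dots> = chain window (\<lambda>m'. R (12 * m l + m')) (\<lambda>_ _. 1) (\<upsilon> l) (12 * N - 12 * m l) (end_pos j)"
        unfolding levels_of by (rule chain_window[OF \<upsilon>W[OF l] endW[OF j], symmetric])
      finally show ?thesis .
    qed
    show "K l l' = (\<Sum>i<3 * n. b l (int i) * chain window R (\<lambda>_ _. 1) (start_pos i) (12 * m l') (\<upsilon> l')) -
         (if 12 * m l < 12 * m l' then chain window (\<lambda>m'. R (12 * m l + m')) (\<lambda>_ _. 1) (\<upsilon> l)
            (12 * m l' - 12 * m l) (\<upsilon> l') else 0)"
      if l': "l' < L" for l'
    proof -
      have ml': "m l' \<le> N" using m[OF l'] by simp
      have "(\<Sum>i<3 * n. b l (int i) * chain window R (\<lambda>_ _. 1) (start_pos i) (12 * m l') (\<upsilon> l')) =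
         (\<Sum>i<3 * n. b l (int i) * wop (wpow Pw (m l')) (int i) (\<upsilon> l'))"
        using chain_window[of _ _ 0 "m l'"] startW \<upsilon>W[OF l'] by (intro sum.cong) (auto simp: start_pos_def)
      also have "\<dots> = (\<Sum>y\<in>{0..h}. b l y * wop (wpow Pw (m l')) y (\<upsilon> l'))"
        by (rule reindex)
      also have "\<dots> = (\<Sum>s\<in>{\<upsilon> l'..h}. i.toep (wsym (S_word (m l))) (\<upsilon> l) s * wop (Q_word (m l')) s (\<upsilon> l'))"
        unfolding b_def h_def by (rule kernel_rows(1)[OF i n ml' ml ul])
      \<comment> \<open>Lowering all heights by 3 n, a whole number of blocks, turns the top height
        3 n - 1 into -1 and removes n.\<close>
      also have "\<dots> = (\<Sum>s\<in>{u l'..-1}. i.toep (wsym (S_word (m l))) (u l) s * wop (Q_word (m l')) s (u l'))"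
      proof (rule sum.reindex_bij_witness[where i="\<lambda>s. s + 3 * int n" and j="\<lambda>s. s - 3 * int n"])
        fix s
        show "i.toep (wsym (S_word (m l))) (u l) (s - 3 * int n) * wop (Q_word (m l')) (s - 3 * int n) (u l') =
          i.toep (wsym (S_word (m l))) (\<upsilon> l) s * wop (Q_word (m l')) s (\<upsilon> l')"
          using i.toep_shift[of "wsym (S_word (m l))" "u l" "int n" "s - 3 * int n"]
            wop_shift[OF i, of "Q_word (m l')" "s - 3 * int n" "int n" "u l'"] NF_MF_word[OF MF_words(3)]
          by (simp add: \<upsilon>_def add.commute)
      qed (auto simp: \<upsilon>_def h_def)
      finally have 1: "(\<Sum>i<3 * n. b l (int i) * chain window R (\<lambda>_ _. 1) (start_pos i) (12 * m l') (\<upsilon> l')) = \<dots>" .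
      have "chain window (\<lambda>m'. R (12 * m l + m')) (\<lambda>_ _. 1) (\<upsilon> l) (12 * m l' - 12 * m l) (\<upsilon> l') =
          wop (wpow Pw (m l' - m l)) (\<upsilon> l) (\<upsilon> l')"
        unfolding levels_of by (rule chain_window[OF \<upsilon>W[OF l] \<upsilon>W[OF l']])
      also have "\<dots> = wop (wpow Pw (m l' - m l)) (u l) (u l')"
        using wop_shift[OF i, where ws="wpow Pw (m l' - m l)" and u="u l" and v="u l'" and k="int n", OF NF_Pw] by (simp add: \<upsilon>_def add.commute)
      finally have 2: "chain window (\<lambda>m'. R (12 * m l + m')) (\<lambda>_ _. 1) (\<upsilon> l) (12 * m l' - 12 * m l) (\<upsilon> l') =
          wop (wpow Pw (m l' - m l)) (u l) (u l')" .
      have "K l l' = (\<Sum>s\<in>{u l'..-1}. i.toep (wsym (S_word (m l))) (u l) s * wop (Q_word (m l')) s (u l')) -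
          (if m l < m l' then wop (wpow Pw (m l' - m l)) (u l) (u l') else 0)"
        unfolding K_def by (rule K_limit_eq[OF i e _ ml' ml]) (rule sep)
      then show ?thesis unfolding 1 2 by simp
    qed
  qed (use startW \<upsilon>W in auto)
  have Z: "(\<Sum>C\<in>window_configs. weight C) = (\<Sum>s\<in>?T. ?w s)"
    using sum_window_configs[of "\<lambda>_. True"] by simp
  have "(\<Sum>C | C \<in> window_configs \<and> (\<forall>k<L. (12 * m k, \<upsilon> k) \<in> C). weight C) =
      (\<Sum>C | C \<in> window_configs \<and> (\<forall>k<L. \<upsilon> k \<in> levels C (12 * m k)). weight C)"
    by (simp add: levels_def)
  also have "\<dots> = (\<Sum>s | s \<in> ?T \<and> (\<forall>k<L. \<upsilon> k \<in> (if 12 * m k \<in> {1..<12 * N} then s (12 * m k) else {})). ?w s)"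
    by (rule sum_window_configs)
  also have "\<dots> = (\<Sum>s | s \<in> ?T \<and> (\<forall>l<L. \<upsilon> l \<in> s (12 * m l)). ?w s)"
  proof -
    have "12 * m k \<in> {1..<12 * N}" if "k < L" for k using m[OF that] by simp
    then have "(\<forall>k<L. \<upsilon> k \<in> (if 12 * m k \<in> {1..<12 * N} then s (12 * m k) else {})) \<longleftrightarrow>
        (\<forall>l<L. \<upsilon> l \<in> s (12 * m l))" for s :: "nat \<Rightarrow> int set"
      by (metis (full_types))
    then show ?thesis by (simp only:)
  qed
  finally have P: "(\<Sum>C | C \<in> window_configs \<and> (\<forall>k<L. (12 * m k, \<upsilon> k) \<in> C). weight C) = \<dots>" .
  have "(\<Sum>s\<in>?T. ?w s) \<noteq> 0" using weight_sum_pos by (metis Z less_irrefl zero_complex.sel(1))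
  then have "complex_of_real (Sigma_Algebra.measure (path_measure \<alpha> \<beta> N n)
            {C \<in> configs N n. \<forall>k<L. (12 * m k, \<upsilon> k) \<in> C}) =
      Determinant.det (Matrix.mat L L (\<lambda>(l, l'). K l l'))"
    unfolding measure_path_measure P Z EM by simp
  also have "\<dots> = Determinant.det (Matrix.transpose_mat (Matrix.mat L L (\<lambda>(l, l'). K l l')))"
    by (rule det_transpose[symmetric]) auto
  also have "Matrix.transpose_mat (Matrix.mat L L (\<lambda>(l, l'). K l l')) = Matrix.mat L L (\<lambda>(k, l). K l k)"
    by (rule eq_matI) auto
  finally show ?thesis unfolding K_def \<upsilon>_def .
qed

end

theorem theorem5p3:
  fixes \<alpha> \<beta> :: "nat \<Rightarrow> real" and N L :: nat
    and \<gamma>int \<gamma>ext :: "real \<Rightarrow> complex"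
    and m :: "nat \<Rightarrow> nat" and \<xi> r :: "nat \<Rightarrow> int"
  assumes "\<alpha> 0 > 0" "\<alpha> 1 > 0" "\<alpha> 2 > 0" "\<beta> 0 > 0" "\<beta> 1 > 0" "\<beta> 2 > 0"
    and "\<alpha> 0 * \<alpha> 1 * \<alpha> 2 = 1" and "\<beta> 0 * \<beta> 1 * \<beta> 2 = 1"
    and "N \<ge> 1"
    and "pos_simple_closed_contour \<gamma>int"
    and "0 \<in> inside (path_image \<gamma>int)" and "1 \<in> inside (path_image \<gamma>int)"
    and "- 1 \<in> outside (path_image \<gamma>int)"
    and "pos_simple_closed_contour \<gamma>ext"
    and "path_image \<gamma>int \<subseteq> inside (path_image \<gamma>ext)"
    and "- 1 \<in> outside (path_image \<gamma>ext)"
    and "\<And>k. k < L \<Longrightarrow> 0 < m k \<and> m k < N"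
    and "\<And>k. k < L \<Longrightarrow> r k \<in> {0, 1, 2}"
    and "inj_on (\<lambda>k. (12 * m k, 3 * \<xi> k + r k)) {..<L}"
  shows "(\<lambda>n. complex_of_real (measure (path_measure \<alpha> \<beta> N n)
            {C \<in> configs N n. \<forall>k<L. (12 * m k, 3 * int n + 3 * \<xi> k + r k) \<in> C}))
         \<longlonglongrightarrow>
         Determinant.det (Matrix.mat L L (\<lambda>(k, l).
            K_limit \<alpha> \<beta> N \<gamma>int \<gamma>ext
              (12 * m k, 3 * \<xi> k + r k) (12 * m l, 3 * \<xi> l + r l)))"
proof -
  have i: "separating_contour \<gamma>int" by (rule separating_contourI) (fact assms)+
  \<comment> \<open>The points 0 and 1 are only assumed to lie inside the inner contour; nesting
    carries them inside the outer one.\<close>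
  have "inside (path_image \<gamma>int) \<subseteq> inside (path_image \<gamma>ext)"
  proof (rule inside_inside_compact_connected)
    have paths: "path \<gamma>int" "path \<gamma>ext"
      using assms(10,14) by (auto simp: pos_simple_closed_contour_def valid_path_imp_path)
    show "closed (path_image \<gamma>int)" "compact (path_image \<gamma>ext)" "connected (path_image \<gamma>ext)"
      using paths by (auto simp: closed_path_image compact_path_image connected_path_image)
  qed (fact assms)
  then have e: "separating_contour \<gamma>ext"
    using assms by (intro separating_contourI) auto
  have sep: "w \<notin> path_image \<gamma>ext \<and> winding_number \<gamma>ext w = 1" if "w \<in> path_image \<gamma>int" for w
  proof -
    have "w \<in> inside (path_image \<gamma>ext)" using assms(15) that by blast
    then show ?thesis
      using assms(14) inside_no_overlap[of "path_image \<gamma>ext"]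
      unfolding pos_simple_closed_contour_def by blast
  qed
  define u where "u k = 3 * \<xi> k + r k" for k
  \<comment> \<open>Any bound above all \<open>u k\<close> serves; a sum also covers L = 0.\<close>
  define H where "H = (\<Sum>k<L. nat (u k) + 1)"
  have H: "u k < int H" if "k < L" for k
  proof -
    have "nat (u k) + 1 \<le> H" unfolding H_def by (rule member_le_sum) (use that in auto)
    then show ?thesis by linarith
  qed
  show ?thesis
  proof (rule tendsto_eventually)
    \<comment> \<open>A crude way to make 3 n + u_k nonnegative, since the rows vanish at negative
      heights only when the height of the point itself is nonnegative.\<close>
    have "\<forall>\<^sub>F n in sequentially. \<forall>k\<in>{..<L}. nat (- u k) \<le> n"
      by (intro eventually_ball_finite) (auto simp: eventually_ge_at_top)
    then have "\<forall>\<^sub>F n in sequentially. 2 * N \<le> n \<and> (\<forall>k\<in>{..<L}. nat (- u k) \<le> n)"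
      by (intro eventually_conj eventually_ge_at_top)
    then show "\<forall>\<^sub>F n in sequentially. complex_of_real (measure (path_measure \<alpha> \<beta> N n)
            {C \<in> configs N n. \<forall>k<L. (12 * m k, 3 * int n + 3 * \<xi> k + r k) \<in> C}) =
         Determinant.det (Matrix.mat L L (\<lambda>(k, l).
            K_limit \<alpha> \<beta> N \<gamma>int \<gamma>ext
              (12 * m k, 3 * \<xi> k + r k) (12 * m l, 3 * \<xi> l + r l)))"
    proof (rule eventually_mono)
      fix n assume n: "2 * N \<le> n \<and> (\<forall>k\<in>{..<L}. nat (- u k) \<le> n)"
      interpret aztec_weights \<alpha> \<beta> N n H by unfold_locales (fact assms)+
      have "complex_of_real (measure (path_measure \<alpha> \<beta> N n)
            {C \<in> configs N n. \<forall>k<L. (12 * m k, 3 * int n + u k) \<in> C}) =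
         Determinant.det (Matrix.mat L L (\<lambda>(k, l).
            K_limit \<alpha> \<beta> N \<gamma>int \<gamma>ext (12 * m k, u k) (12 * m l, u l)))"
      proof (rule measure_points[OF i e sep])
        show "0 \<le> 3 * int n + u k \<and> u k < int H" if k: "k < L" for k
        proof -
          have "nat (- u k) \<le> n" using n k by simp
          then show ?thesis using H[OF k] by linarith
        qed
      qed (use n assms in \<open>simp_all add: u_def\<close>)
      then show "complex_of_real (measure (path_measure \<alpha> \<beta> N n)
            {C \<in> configs N n. \<forall>k<L. (12 * m k, 3 * int n + 3 * \<xi> k + r k) \<in> C}) =
         Determinant.det (Matrix.mat L L (\<lambda>(k, l).
            K_limit \<alpha> \<beta> N \<gamma>int \<gamma>ext
              (12 * m k, 3 * \<xi> k + r k) (12 * m l, 3 * \<xi> l + r l)))"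
        by (simp add: u_def add.assoc)
    qed
  qed
qed

end
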